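(* Let $\Bbbk$ be a perfect field of characteristic $p>0$ and let $L$ be a (two-sided) ladder with $v$ lower-outside corners. For $\mathbf{t}=(t_1,\ldots,t_v)\in\mathbb{Z}_{>0}^v$ let $I_{\mathbf t}(L)\subseteq \Bbbk[L]$ be the corresponding mixed ladder determinantal ideal. Then the symbolic Rees algebra $\mathcal{R}^s(I_{\mathbf t}(L))=\bigoplus_{n\ge 0} I_{\mathbf t}(L)^{(n)}$ is strongly $F$-regular.
   Context: Ladders. Let $X=(x_{i,j})$ be a $k\times\ell$ matrix of distinct indeterminates. A subset $L\subseteq X$ is a (two-sided) ladder if whenever $x_{i,j},x_{i',j'}\in L$ with $i\le i'$ and $j\ge j'$, then $x_{u,w}\in L$ for all $i\le u\le i'$, $j'\le w\le j$. (An entry with indices out of range is regarded as not in $L$.) The upper-outside corners of $L$ are the elements $x_{b_1,a_1},\ldots,x_{b_u,a_u}\in L$, with $1=b_1<\cdots<b_u$ and $a_1<\cdots<a_u=\ell$, defined by $x_{b_h-1,a_h}\notin L$ and $x_{b_h,a_h+1}\notin L$. The lower-outside corners $x_{d_1,c_1},\ldots,x_{d_v,c_v}\in L$, with $d_1\le\cdots\le d_v=k$ and $1=c_1\le\cdots\le c_v$, are part of the data of the ladder: they include all $x_{i,j}\in L$ with $x_{i+1,j}\notin L$ and $x_{i,j-1}\notin L$, and each of them satisfies $x_{d_h+1,c_h}\notin L$ or $x_{d_h,c_h-1}\notin L$. All corners are assumed distinct. For $j=1,\ldots,v$ set $L_j=\{x_{b,a}\in L\mid 1\le b\le d_j,\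 c_j\le a\le \ell\}$. Ideals. $\Bbbk[L]$ is the polynomial ring over $\Bbbk$ in the entries of $L$. For a positive integer $t$ and a subladder $L'\subseteq L$, $I_t(L')$ is the ideal of $\Bbbk[L]$ generated by the $t$-minors of $X$ all of whose entries lie in $L'$. The mixed ladder determinantal ideal is $I_{\mathbf t}(L)=I_{t_1}(L_1)+\cdots+I_{t_v}(L_v)$; it is prime. Standing assumptions: (1) every entry of $L$ is involved in some of the generating minors of $I_{\mathbf t}(L)$; (2) no two consecutive corners coincide, and no two upper-outside corners belong to the same row or the same column; (3) $I_{t_i}(L_i)\not\subseteq I_{t_j}(L_j)$ for all $i\ne j$; (4) no proper submatrix of $X$ contains $L$. $I^{(n)}$ denotes the $n$-th symbolic power of $I$, with $I^{(0)}$ the whole ring. The multiplication on $\mathcal{R}^s(I)$ is that of the subring $\bigoplus_n I^{(n)}T^n\subseteq \Bbbk[L][T]$. A Noetherian $F$-finite reduced ring $S$ of characteristic $p>0$ is strongly $F$-regular if for every $c\in S$ not in any minimal prime there is $e>0$ such that the $S$-linear map $S\to S^{1/p^e}$, $1\mapsto c^{1/p^e}$, splits. *)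

theory Defs
  imports
    "HOL-Algebra.Algebra"
    "HOL-Algebra.Algebraic_Closure_Type"
    "HOL-Library.Poly_Mapping"
    "Jordan_Normal_Form.Determinant"
begin

section \<open>Strong F-regularity\<close>

definition minimal_primes :: "('a, 'm) ring_scheme \<Rightarrow> 'a set \<Rightarrow> 'a set set" where
  "minimal_primes R I =
     {P. primeideal P R \<and> I \<subseteq> P \<and> (\<forall>Q. primeideal Q R \<and> I \<subseteq> Q \<and> Q \<subseteq> P \<longrightarrow> Q = P)}"

definition reduced_ring :: "('a, 'm) ring_scheme \<Rightarrow> bool" where
  "reduced_ring R \<longleftrightarrow> (\<forall>x\<in>carrier R. \<forall>n::nat. x [^]\<^bsub>R\<^esub> n = \<zero>\<^bsub>R\<^esub> \<longrightarrow> x = \<zero>\<^bsub>R\<^esub>)"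

definition has_characteristic :: "('a, 'm) ring_scheme \<Rightarrow> nat \<Rightarrow> bool" where
  "has_characteristic R p \<longleftrightarrow> (\<forall>n::nat. [n] \<cdot>\<^bsub>R\<^esub> \<one>\<^bsub>R\<^esub> = \<zero>\<^bsub>R\<^esub> \<longleftrightarrow> p dvd n)"

definition self_module :: "('a, 'm) ring_scheme \<Rightarrow> ('a, 'a) module" where
  "self_module R =
     \<lparr>carrier = carrier R, monoid.mult = monoid.mult R, one = \<one>\<^bsub>R\<^esub>, ring.zero = \<zero>\<^bsub>R\<^esub>, ring.add = ring.add R,
      module.smult = monoid.mult R\<rparr>"

definition linear_maps ::
  "('a, 'm) ring_scheme \<Rightarrow> ('a, 'b, 'n) module_scheme \<Rightarrow> ('a, 'c, 'o) module_scheme \<Rightarrow> ('b \<Rightarrow> 'c) set"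
where
  "linear_maps R M N = {f \<in> carrier M \<rightarrow> carrier N.
     (\<forall>x\<in>carrier M. \<forall>y\<in>carrier M. f (x \<oplus>\<^bsub>M\<^esub> y) = f x \<oplus>\<^bsub>N\<^esub> f y) \<and>
     (\<forall>s\<in>carrier R. \<forall>x\<in>carrier M. f (s \<odot>\<^bsub>M\<^esub> x) = s \<odot>\<^bsub>N\<^esub> f x)}"

definition linear_map_splits ::
  "('a, 'm) ring_scheme \<Rightarrow> ('a, 'b, 'n) module_scheme \<Rightarrow> ('a, 'c, 'o) module_scheme \<Rightarrow> ('b \<Rightarrow> 'c) \<Rightarrow> bool"
where
  "linear_map_splits R M N f \<longleftrightarrow>
     f \<in> linear_maps R M N \<and> (\<exists>g\<in>linear_maps R N M. \<forall>x\<in>carrier M. g (f x) = x)"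

definition finitely_generated_module ::
  "('a, 'm) ring_scheme \<Rightarrow> ('a, 'b, 'n) module_scheme \<Rightarrow> bool" where
  "finitely_generated_module R M \<longleftrightarrow>
     (\<exists>A\<subseteq>carrier M. finite A \<and>
        (\<forall>x\<in>carrier M. \<exists>s\<in>A \<rightarrow> carrier R. x = (\<Oplus>\<^bsub>M\<^esub>a\<in>A. s a \<odot>\<^bsub>M\<^esub> a)))"

text \<open>
  The $R$-algebra $R^{1/q}$, $q = p^e$, for $R$ reduced of characteristic $p$.  An element $x$ of
  the carrier stands for $x^{1/q}$; the bijection $x \mapsto x^{1/q}$ respects sums and products,
  and $s \in R \subseteq R^{1/q}$ is $(s^q)^{1/q}$, so $s$ acts on $x^{1/q}$ by
  $s \cdot x^{1/q} = (s^q x)^{1/q}$.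
\<close>
definition frobenius_root :: "nat \<Rightarrow> nat \<Rightarrow> ('a, 'm) ring_scheme \<Rightarrow> ('a, 'a) module" where
  "frobenius_root p e R =
     \<lparr>carrier = carrier R, monoid.mult = monoid.mult R, one = \<one>\<^bsub>R\<^esub>, ring.zero = \<zero>\<^bsub>R\<^esub>, ring.add = ring.add R,
      module.smult = (\<lambda>s x. s [^]\<^bsub>R\<^esub> (p ^ e) \<otimes>\<^bsub>R\<^esub> x)\<rparr>"

definition F_finite :: "nat \<Rightarrow> ('a, 'm) ring_scheme \<Rightarrow> bool" where
  "F_finite p R \<longleftrightarrow> finitely_generated_module R (frobenius_root p 1 R)"

text \<open>The map in the last conjunct is the $R$-linear map $R \to R^{1/p^e}$ with
  $1 \mapsto c^{1/p^e}$.\<close>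
definition strongly_F_regular :: "nat \<Rightarrow> ('a, 'm) ring_scheme \<Rightarrow> bool" where
  "strongly_F_regular p R \<longleftrightarrow>
     cring R \<and> noetherian_ring R \<and> reduced_ring R \<and>
     Factorial_Ring.prime p \<and> has_characteristic R p \<and> F_finite p R \<and>
     (\<forall>c\<in>carrier R. (\<forall>P\<in>minimal_primes R {\<zero>\<^bsub>R\<^esub>}. c \<notin> P) \<longrightarrow>
        (\<exists>e>0. linear_map_splits R (self_module R) (frobenius_root p e R)
                 (\<lambda>s. s \<odot>\<^bsub>frobenius_root p e R\<^esub> c)))"


section \<open>Symbolic powers and the symbolic Rees algebra\<close>

text \<open>
  The intersection of the contractions $I^n R_P \cap R$ over the minimal primes $P$ of $I$;
  membership of $f$ in such a contraction is written out as: $s f \in I^n$ for some $s \notin P$.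
  The minimal primes are those of $I$ itself, so for prime $I$ only $P = I$ occurs.
\<close>
definition symbolic_power :: "('a, 'm) ring_scheme \<Rightarrow> 'a set \<Rightarrow> nat \<Rightarrow> 'a set" where
  "symbolic_power R I n =
     {f \<in> carrier R. \<forall>P\<in>minimal_primes R I. \<exists>s\<in>carrier R - P. s \<otimes>\<^bsub>R\<^esub> f \<in> I [^]\<^bsub>ideals_set R\<^esub> n}"

lemma minimal_primes_primeideal:
  assumes "primeideal I R"
  shows "minimal_primes R I = {I}"
  using assms unfolding minimal_primes_def by blast

lemma symbolic_power_primeideal:
  assumes "primeideal I R"
  shows "symbolic_power R I n =
    {f \<in> carrier R. \<exists>s\<in>carrier R - I. s \<otimes>\<^bsub>R\<^esub> f \<in> I [^]\<^bsub>ideals_set R\<^esub> n}"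
  unfolding symbolic_power_def minimal_primes_primeideal[OF assms] by simp

definition symbolic_Rees_algebra :: "('a, 'm) ring_scheme \<Rightarrow> 'a set \<Rightarrow> ('a, nat \<Rightarrow> 'a) up_ring" where
  "symbolic_Rees_algebra R I = (UP R)
     \<lparr>carrier := {F \<in> carrier (UP R). \<forall>n. up_ring.coeff (UP R) F n \<in> symbolic_power R I n}\<rparr>"


section \<open>Ladders\<close>

text \<open>
  A set of entries of $X$ is represented by the set of their positions, with rows and columns
  numbered from 1.  Hence row 0 and column 0 are out of range, and truncated subtraction is harmless
  in \<open>i - 1\<close> below.  The upper-outside corners are $(b_h, a_h)$ for $1 \le h \le u$ and the
  lower-outside corners are $(d_h, c_h)$ for $1 \le h \le v$; all $u + v$ corners are distinct.
\<close>
locale two_sided_ladder =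
  fixes k l :: nat and L :: "(nat \<times> nat) set"
    and u :: nat and b a :: "nat \<Rightarrow> nat"
    and v :: nat and d c :: "nat \<Rightarrow> nat"
  assumes entries: "L \<subseteq> {1..k} \<times> {1..l}"
    and ladder: "\<lbrakk>(i, j) \<in> L; (i', j') \<in> L; i \<le> i'; j' \<le> j; i \<le> r; r \<le> i'; j' \<le> w; w \<le> j\<rbrakk>
          \<Longrightarrow> (r, w) \<in> L"
    and upper_corners:
          "(\<lambda>h. (b h, a h)) ` {1..u} = {(i, j) \<in> L. (i - 1, j) \<notin> L \<and> (i, j + 1) \<notin> L}"
    and upper_order: "1 \<le> u" "b 1 = 1" "strict_mono_on {1..u} b" "strict_mono_on {1..u} a" "a u = l"
    and lower_corners: "(\<lambda>h. (d h, c h)) ` {1..v} \<subseteq> L"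
          "{(i, j) \<in> L. (i + 1, j) \<notin> L \<and> (i, j - 1) \<notin> L} \<subseteq> (\<lambda>h. (d h, c h)) ` {1..v}"
          "h \<in> {1..v} \<Longrightarrow> (d h + 1, c h) \<notin> L \<or> (d h, c h - 1) \<notin> L"
    and lower_order: "1 \<le> v" "mono_on {1..v} d" "d v = k" "c 1 = 1" "mono_on {1..v} c"
    and corners_distinct: "inj_on (\<lambda>h. (b h, a h)) {1..u}" "inj_on (\<lambda>h. (d h, c h)) {1..v}"
          "(\<lambda>h. (b h, a h)) ` {1..u} \<inter> (\<lambda>h. (d h, c h)) ` {1..v} = {}"

text \<open>The part of the ladder, in a matrix with \<open>l\<close> columns, that belongs to the lower-outside
  corner in row \<open>dj\<close> and column \<open>cj\<close>.\<close>
definition subladder :: "nat \<Rightarrow> (nat \<times> nat) set \<Rightarrow> nat \<Rightarrow> nat \<Rightarrow> (nat \<times> nat) set" where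
  "subladder l L dj cj = L \<inter> {1..dj} \<times> {cj..l}"


section \<open>Mixed ladder determinantal ideals\<close>

text \<open>Polynomials over \<open>'k\<close> in indeterminates $x_{i,j}$, as finitely supported functions on
  monomials.\<close>
type_synonym 'k matrix_poly = "((nat \<times> nat) \<Rightarrow>\<^sub>0 nat) \<Rightarrow>\<^sub>0 'k"

definition indet :: "nat \<Rightarrow> nat \<Rightarrow> 'k::field matrix_poly" where
  "indet i j = Poly_Mapping.single (Poly_Mapping.single (i, j) 1) 1"

definition ladder_ring :: "(nat \<times> nat) set \<Rightarrow> 'k::field matrix_poly ring" where
  "ladder_ring L = ring_of_type_algebra
     \<lparr>carrier := {f. \<forall>m\<in>Poly_Mapping.keys f. Poly_Mapping.keys m \<subseteq> L}\<rparr>"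

text \<open>Row and column sets of the \<open>t\<close>-minors with all entries in \<open>L'\<close>.\<close>
definition minor_indices :: "nat \<Rightarrow> (nat \<times> nat) set \<Rightarrow> (nat set \<times> nat set) set" where
  "minor_indices t L' = {(A, B). finite A \<and> finite B \<and> card A = t \<and> card B = t \<and> A \<times> B \<subseteq> L'}"

definition matrix_minor :: "nat set \<Rightarrow> nat set \<Rightarrow> 'k::field matrix_poly" where
  "matrix_minor A B = Determinant.det (mat (card A) (card B)
     (\<lambda>(i, j). indet (sorted_list_of_set A ! i) (sorted_list_of_set B ! j)))"

definition determinantal_ideal ::
  "(nat \<times> nat) set \<Rightarrow> nat \<Rightarrow> (nat \<times> nat) set \<Rightarrow> 'k::field matrix_poly set" where
  "determinantal_ideal L t L' =
     genideal (ladder_ring L) {matrix_minor A B |A B. (A, B) \<in> minor_indices t L'}"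

definition mixed_ladder_ideal ::
  "nat \<Rightarrow> (nat \<times> nat) set \<Rightarrow> nat \<Rightarrow> (nat \<Rightarrow> nat) \<Rightarrow> (nat \<Rightarrow> nat) \<Rightarrow> (nat \<Rightarrow> nat) \<Rightarrow> 'k::field matrix_poly set"
where
  "mixed_ladder_ideal l L v d c t =
     (\<Oplus>\<^bsub>ideals_set (ladder_ring L)\<^esub>h\<in>{1..v}. determinantal_ideal L (t h) (subladder l L (d h) (c h)))"

end

theory Submission
  imports Defs "HOL-Library.Product_Lexorder"
begin

text \<open>
  Let $\tau(x)$ be the least $t_h$ such that $x$ lies in $L_h$.  Then $I_{\mathbf t}(L)$ is the kernel
  of the map $x_{i,j} \mapsto \sum_{r < \tau(i,j)} U_{r,i} V_{r,j}$.  Leading monomials are taken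
  for an antidiagonal weight.  Call a set $F$ of positions a face if each $x \in F$ starts only
  chains in $F$, running strictly to the north-east, of length less than $\tau(x)$.  The heart of
  the proof is that $m$ is the leading monomial of an element of $I^{(n)}$ if and only if the degree
  of $m$ outside every face is at least $n$.

  Necessity follows by deforming the map above with new indeterminates $Y_{i,j}$ and comparing orders
  in $Y$.  For sufficiency, Farkas' lemma turns the degree condition into a fractional packing of $m$
  by chains.  The minor of a long chain lies in a high symbolic power by Chio condensation.  Let
  $h$ be the height and $q = p^e$.  Up to a constant independent of $q$ in the exponent,
  $m^q \prod_{x \in L} x^{q-1}$ is the leading monomial of an element of $I^{(qn + h(q-1))}$, which a
  trace of Frobenius maps to an element of $I^{(n)}$ with leading monomial $m$.

  Hence the initial algebra of the symbolic Rees algebra is the algebra of a monoid cut out by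
  finitely many inequalities.  Dickson's lemma gives Noetherianity and $F$-finiteness.  For the
  splitting at $c$ with leading monomial $m T^n$ and large $q$ there is
  $g \in I^{((h-1)(q-1)-n)}$ whose leading monomial is $\prod_{x \in L} x^{q-1}$ divided by $m$.
  The Frobenius trace of $g F$ preserves the symbolic Rees algebra and maps $c$ to a unit.
\<close>

subsection \<open>Polynomials as finitely supported functions on monomials\<close>

text \<open>The obstacle is that packings by chains are only fractional: products of minors realise
  large powers of a monomial up to a bounded loss, not the monomial itself. The trace absorbs the
  loss because it has a slack of q: it maps I^(N) into I^(b) once N > q(b - 1) + h(q - 1), which is
  q less than qb + h(q - 1). This is a pigeonhole count: at its generic point I is generated by h
  elements, and a monomial of degree N in them contains q-th powers of total degree b. The h
  generators come from a face of largest size; each position outside it is eliminated by a minor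
  linear in that position. For necessity, every face gets its own weight on U, V, Y: potentials of
  rows and columns, one pair for each r, make a UV-term lead the image of x_{i,j} inside the face
  and Y_{i,j} outside, always with the weight of x_{i,j}. Distinct monomials keep distinct leading
  images, so top terms cannot cancel. In the splitting, the product over L has degree at least h(q -
  1) outside every face, dividing by m costs at most q - 1, and the slack q pays for the missing q -
  1.\<close>

abbreviation "lookup \<equiv> Poly_Mapping.lookup"
abbreviation "keys \<equiv> Poly_Mapping.keys"
abbreviation "single \<equiv> Poly_Mapping.single"

type_synonym ('x, 'k) mpol = "('x \<Rightarrow>\<^sub>0 nat) \<Rightarrow>\<^sub>0 'k"

lemma poly_mapping_sum_single:
  fixes f :: "'a \<Rightarrow>\<^sub>0 'b::comm_monoid_add"
  shows "f = (\<Sum>m\<in>keys f. single m (lookup f m))"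
proof (rule poly_mapping_eqI)
  fix k
  have "lookup (\<Sum>m\<in>keys f. single m (lookup f m)) k = (\<Sum>m\<in>keys f. if m = k then lookup f m else 0)"
    unfolding lookup_sum by (rule sum.cong) (auto simp: lookup_single when_def)
  also have "\<dots> = lookup f k"
    by (auto simp: sum.delta' in_keys_iff sum.delta)
  finally show "lookup f k = lookup (\<Sum>m\<in>keys f. single m (lookup f m)) k" by simp
qed

lemma poly_mapping_add_induct [case_names zero single add]:
  fixes f :: "'a \<Rightarrow>\<^sub>0 'b::comm_monoid_add"
  assumes "P 0" and "\<And>m c. m \<in> keys f \<Longrightarrow> P (single m c)" and "\<And>g h. P g \<Longrightarrow> P h \<Longrightarrow> P (g + h)"
  shows "P f"
proof -
  have "A \<subseteq> keys f \<Longrightarrow> P (\<Sum>m\<in>A. single m (lookup f m))" for A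
    by (induction A rule: infinite_finite_induct) (auto intro: assms)
  from this[of "keys f"] show ?thesis
    using poly_mapping_sum_single[of f] by simp
qed

lemma lookup_single_mult:
  fixes f :: "'a::{cancel_comm_monoid_add} \<Rightarrow>\<^sub>0 'b::comm_semiring_1"
  shows "lookup (single m c * f) (m + e) = c * lookup f e"
proof (induction f rule: poly_mapping_add_induct)
  case (single m' c')
  then show ?case by (simp add: mult_single lookup_single when_def)
qed (simp_all add: distrib_left lookup_add)

lemma lookup_single_mult_notin:
  fixes f :: "'a::{cancel_comm_monoid_add} \<Rightarrow>\<^sub>0 'b::comm_semiring_1"
  assumes "\<And>e'. e \<noteq> m + e'"
  shows "lookup (single m c * f) e = 0"
proof (induction f rule: poly_mapping_add_induct)
  case (single m' c')
  then show ?case using assms by (auto simp add: mult_single lookup_single when_def)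
qed (simp_all add: distrib_left lookup_add)

lemma keys_minus: "keys (f - g) \<subseteq> keys f \<union> keys (g :: 'a \<Rightarrow>\<^sub>0 'b::ab_group_add)"
  by (auto simp: in_keys_iff lookup_minus)

lemma keys_sum_subset: "keys (sum F I) \<subseteq> (\<Union>i\<in>I. keys (F i))"
  for F :: "'i \<Rightarrow> 'a \<Rightarrow>\<^sub>0 'b::comm_monoid_add"
proof (induction I rule: infinite_finite_induct)
  case (insert x I)
  then show ?case using keys_add[of "F x" "sum F I"] by auto
qed auto

lemma keys_add_nat: "keys (m + m' :: 'x \<Rightarrow>\<^sub>0 nat) = keys m \<union> keys m'"
  by (auto simp: in_keys_iff lookup_add)

text \<open>Subsets of one type, so that polynomial rings in different sets of indeterminates
  (\<open>L\<close>, a face, \<open>after x\<close>) share their arithmetic and are compared by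
  inclusion.\<close>

definition polys_in :: "'x set \<Rightarrow> ('x, 'k::comm_ring_1) mpol set" where
  "polys_in V = {f. \<forall>m\<in>keys f. keys m \<subseteq> V}"

definition pvar :: "'x \<Rightarrow> ('x, 'k::comm_ring_1) mpol" where
  "pvar x = single (single x 1) 1"

definition pconst :: "'k \<Rightarrow> ('x, 'k::comm_ring_1) mpol" where
  "pconst c = single 0 c"

lemma pconst_simps [simp]:
  "pconst 0 = 0" "pconst 1 = 1" "pconst (a + b) = pconst a + pconst b"
  "pconst (a * b) = pconst a * pconst b" "pconst (- a) = - pconst a" "pconst (a - b) = pconst a - pconst b"
  by (simp_all add: pconst_def single_add mult_single single_uminus single_diff)

lemma polys_in_single: "keys m \<subseteq> V \<Longrightarrow> single m c \<in> polys_in V"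
  by (auto simp: polys_in_def)

lemma polys_in_0 [simp, intro]: "0 \<in> polys_in V"
  and polys_in_1 [simp, intro]: "1 \<in> polys_in V"
  and polys_in_const [simp, intro]: "pconst c \<in> polys_in V"
  by (auto simp: polys_in_def pconst_def)

lemma polys_in_var [simp, intro]: "x \<in> V \<Longrightarrow> pvar x \<in> polys_in V"
  by (auto simp: polys_in_def pvar_def)

lemma polys_in_add [intro]: "f \<in> polys_in V \<Longrightarrow> g \<in> polys_in V \<Longrightarrow> f + g \<in> polys_in V"
  using keys_add[of f g] unfolding polys_in_def by blast

lemma polys_in_uminus [intro]: "f \<in> polys_in V \<Longrightarrow> - f \<in> polys_in V"
  unfolding polys_in_def by simp

lemma polys_in_minus [intro]: "f \<in> polys_in V \<Longrightarrow> g \<in> polys_in V \<Longrightarrow> f - g \<in> polys_in V"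
  using keys_minus[of f g] unfolding polys_in_def by blast

lemma polys_in_mult [intro]: "f \<in> polys_in V \<Longrightarrow> g \<in> polys_in V \<Longrightarrow> f * g \<in> polys_in V"
  using keys_mult[of f g] unfolding polys_in_def by (fastforce simp: keys_add_nat)

lemma polys_in_power [intro]: "f \<in> polys_in V \<Longrightarrow> f ^ n \<in> polys_in V"
  by (induction n) auto

lemma polys_in_sum [intro]: "(\<And>i. i \<in> I \<Longrightarrow> F i \<in> polys_in V) \<Longrightarrow> sum F I \<in> polys_in V"
  by (induction I rule: infinite_finite_induct) auto

lemma polys_in_prod [intro]: "(\<And>i. i \<in> I \<Longrightarrow> F i \<in> polys_in V) \<Longrightarrow> prod F I \<in> polys_in V"
  by (induction I rule: infinite_finite_induct) auto

lemma polys_in_mono: "V \<subseteq> W \<Longrightarrow> polys_in V \<subseteq> polys_in W"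
  unfolding polys_in_def by blast

lemma single_monomial_eq_prod:
  assumes "finite A" "keys m \<subseteq> A"
  shows "single m c = pconst c * (\<Prod>x\<in>A. pvar x ^ lookup m x)"
proof -
  have pw: "pvar x ^ n = (single (single x n) 1 :: ('a, 'b) mpol)" for x :: 'a and n
    by (induction n) (simp_all add: pvar_def mult_single flip: single_add)
  have "(\<Prod>x\<in>A. pvar x ^ lookup m x) = (single (\<Sum>x\<in>A. single x (lookup m x)) 1 :: ('a, 'b) mpol)"
    using assms(1) by (induction A) (simp_all add: pw mult_single)
  also have "(\<Sum>x\<in>A. single x (lookup m x)) = (\<Sum>x\<in>keys m. single x (lookup m x))"
    using assms by (intro sum.mono_neutral_right) (auto simp: in_keys_iff)
  also have "\<dots> = m" by (simp flip: poly_mapping_sum_single)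
  finally show ?thesis by (simp add: pconst_def mult_single)
qed

lemma polys_in_induct [consumes 1, case_names const var add mult]:
  assumes "f \<in> polys_in V"
    and c: "\<And>c. P (pconst c)" and v: "\<And>x. x \<in> V \<Longrightarrow> P (pvar x)"
    and a: "\<And>f g. f \<in> polys_in V \<Longrightarrow> g \<in> polys_in V \<Longrightarrow> P f \<Longrightarrow> P g \<Longrightarrow> P (f + g)"
    and m: "\<And>f g. f \<in> polys_in V \<Longrightarrow> g \<in> polys_in V \<Longrightarrow> P f \<Longrightarrow> P g \<Longrightarrow> P (f * g)"
  shows "P f"
proof -
  have P1: "P 1" using c[of 1] by simp
  have "f \<in> polys_in V \<and> P f"
  proof (induction f rule: poly_mapping_add_induct)
    case zero
    then show ?case using c[of 0] by simp
  next
    case (single m' c')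
    have mV: "keys m' \<subseteq> V" using single assms(1) by (auto simp: polys_in_def)
    have pw: "P (pvar x ^ n)" if "x \<in> V" for x n
      using that by (induction n) (auto intro!: m v P1)
    have "P (\<Prod>x\<in>A. pvar x ^ lookup m' x)" if "A \<subseteq> V" for A
      using that by (induction A rule: infinite_finite_induct) (auto intro!: m pw P1)
    then have "P (single m' c')"
      using single_monomial_eq_prod[of "keys m'" m' c'] mV by (auto intro!: m c polys_in_prod)
    then show ?case using mV polys_in_single by blast
  qed (auto intro!: a)
  then show ?thesis by simp
qed

subsection \<open>Substitution\<close>

definition monom_subst :: "('x \<Rightarrow> 'r::comm_ring_1) \<Rightarrow> ('x \<Rightarrow>\<^sub>0 nat) \<Rightarrow> 'r" where
  "monom_subst s m = (\<Prod>x\<in>keys m. s x ^ lookup m x)"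

lemma monom_subst_superset:
  "finite A \<Longrightarrow> keys m \<subseteq> A \<Longrightarrow> monom_subst s m = (\<Prod>x\<in>A. s x ^ lookup m x)"
  unfolding monom_subst_def by (rule prod.mono_neutral_left) (auto simp: in_keys_iff)

lemma monom_subst_0 [simp]: "monom_subst s 0 = 1"
  by (simp add: monom_subst_def)

lemma monom_subst_add: "monom_subst s (m + m') = monom_subst s m * monom_subst s m'"
proof -
  have "monom_subst s e = (\<Prod>x\<in>keys m \<union> keys m'. s x ^ lookup e x)" if "keys e \<subseteq> keys m \<union> keys m'" for e
    using that by (intro monom_subst_superset) auto
  then show ?thesis
    by (simp add: keys_add_nat lookup_add power_add prod.distrib)
qed

lemma monom_subst_var [simp]: "monom_subst s (single x n) = s x ^ n"
  by (simp add: monom_subst_def)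

definition poly_subst :: "('x \<Rightarrow> ('y, 'k) mpol) \<Rightarrow> ('x, 'k::comm_ring_1) mpol \<Rightarrow> ('y, 'k) mpol" where
  "poly_subst s f = (\<Sum>m\<in>keys f. pconst (lookup f m) * monom_subst s m)"

lemma poly_subst_superset:
  "finite A \<Longrightarrow> keys f \<subseteq> A \<Longrightarrow> poly_subst s f = (\<Sum>m\<in>A. pconst (lookup f m) * monom_subst s m)"
  unfolding poly_subst_def by (rule sum.mono_neutral_left) (auto simp: in_keys_iff)

lemma poly_subst_0 [simp]: "poly_subst s 0 = 0"
  by (simp add: poly_subst_def)

lemma poly_subst_single: "poly_subst s (single m c) = pconst c * monom_subst s m"
  by (simp add: poly_subst_def)

lemma poly_subst_add: "poly_subst s (f + g) = poly_subst s f + poly_subst s g"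
proof -
  have "poly_subst s e = (\<Sum>m\<in>keys f \<union> keys g. pconst (lookup e m) * monom_subst s m)"
    if "keys e \<subseteq> keys f \<union> keys g" for e
    using that by (intro poly_subst_superset) auto
  then show ?thesis
    using keys_add[of f g] by (simp add: lookup_add distrib_right sum.distrib)
qed

lemma poly_subst_mult: "poly_subst s (f * g) = poly_subst s f * poly_subst s g"
proof (induction f rule: poly_mapping_add_induct)
  case (single m c)
  show ?case
    by (induction g rule: poly_mapping_add_induct)
      (simp_all add: poly_subst_single mult_single monom_subst_add poly_subst_add distrib_left)
qed (simp_all add: distrib_right poly_subst_add)

lemma poly_subst_const [simp]: "poly_subst s (pconst c) = pconst c"
  by (simp add: pconst_def poly_subst_single[unfolded pconst_def])

lemma poly_subst_var [simp]: "poly_subst s (pvar x) = s x"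
  by (simp add: pvar_def poly_subst_single)

lemma poly_subst_1 [simp]: "poly_subst s 1 = 1"
  using poly_subst_const[of s 1] by simp

lemma poly_subst_uminus: "poly_subst s (- f) = - poly_subst s f"
  using poly_subst_add[of s f "- f"] by (simp add: add_eq_0_iff2)

lemma poly_subst_minus: "poly_subst s (f - g) = poly_subst s f - poly_subst s g"
  using poly_subst_add[of s f "- g"] by (simp add: poly_subst_uminus)

lemma poly_subst_sum: "poly_subst s (sum F I) = (\<Sum>i\<in>I. poly_subst s (F i))"
  by (induction I rule: infinite_finite_induct) (simp_all add: poly_subst_add)

lemma poly_subst_prod: "poly_subst s (prod F I) = (\<Prod>i\<in>I. poly_subst s (F i))"
  by (induction I rule: infinite_finite_induct) (simp_all add: poly_subst_mult)

subsection \<open>Weights and leading terms\<close>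

text \<open>The weights are integers because the potentials that later serve as weights of U and V
  may be negative.\<close>

definition wt :: "('x \<Rightarrow> int) \<Rightarrow> ('x \<Rightarrow>\<^sub>0 nat) \<Rightarrow> int" where
  "wt W m = (\<Sum>x\<in>keys m. int (lookup m x) * W x)"

lemma wt_superset: "finite A \<Longrightarrow> keys m \<subseteq> A \<Longrightarrow> wt W m = (\<Sum>x\<in>A. int (lookup m x) * W x)"
  unfolding wt_def by (rule sum.mono_neutral_left) (auto simp: in_keys_iff)

lemma wt_0 [simp]: "wt W 0 = 0"
  by (simp add: wt_def)

lemma wt_single [simp]: "wt W (single x n) = int n * W x"
  by (simp add: wt_def)

lemma wt_add: "wt W (m + m') = wt W m + wt W m'"
proof -
  have "wt W e = (\<Sum>x\<in>keys m \<union> keys m'. int (lookup e x) * W x)" if "keys e \<subseteq> keys m \<union> keys m'" for e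
    using that by (intro wt_superset) auto
  then show ?thesis
    by (simp add: keys_add_nat lookup_add distrib_right sum.distrib)
qed

lemma wt_sum: "wt W (sum e A) = (\<Sum>x\<in>A. wt W (e x))"
  by (induction A rule: infinite_finite_induct) (simp_all add: wt_add)

definition wt_less :: "('x \<Rightarrow> int) \<Rightarrow> int \<Rightarrow> ('x, 'k::zero) mpol \<Rightarrow> bool" where
  "wt_less W a f \<longleftrightarrow> (\<forall>e\<in>keys f. wt W e < a)"

text \<open>A weight is not a monomial order, since distinct monomials may tie. The predicate says
  that \<open>m\<close> has no rival at the top. This is stable under products for every weight, so
  no tie-breaking rule has to be fixed.\<close>

definition leading :: "('x \<Rightarrow> int) \<Rightarrow> ('x \<Rightarrow>\<^sub>0 nat) \<Rightarrow> 'k \<Rightarrow> ('x, 'k::comm_ring_1) mpol \<Rightarrow> bool" where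
  "leading W m c f \<longleftrightarrow> wt_less W (wt W m) (f - single m c)"

lemma wt_less_0 [simp]: "wt_less W a 0"
  by (simp add: wt_less_def)

lemma wt_less_add: "wt_less W a f \<Longrightarrow> wt_less W a g \<Longrightarrow> wt_less W a (f + g)"
  using keys_add[of f g] unfolding wt_less_def by blast

lemma wt_less_uminus [simp]: "wt_less W a (- f) \<longleftrightarrow> wt_less W a (f :: ('x, 'k::comm_ring_1) mpol)"
  by (simp add: wt_less_def)

lemma wt_less_minus: "wt_less W a f \<Longrightarrow> wt_less W a g \<Longrightarrow> wt_less W a (f - g :: ('x, 'k::comm_ring_1) mpol)"
  using wt_less_add[of W a f "- g"] by simp

lemma wt_less_sum: "(\<And>i. i \<in> I \<Longrightarrow> wt_less W a (F i)) \<Longrightarrow> wt_less W a (sum F I)"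
  by (induction I rule: infinite_finite_induct) (auto intro: wt_less_add)

lemma wt_less_mult: "wt_less W a f \<Longrightarrow> wt_less W b g \<Longrightarrow> wt_less W (a + b) (f * g :: ('x, 'k::comm_ring_1) mpol)"
  unfolding wt_less_def by (auto dest!: subsetD[OF keys_mult] simp: wt_add intro!: add_strict_mono)

lemma wt_less_single_mult:
  "wt_less W b g \<Longrightarrow> a \<ge> wt W m + b \<Longrightarrow> wt_less W a (single m c * g :: ('x, 'k::comm_ring_1) mpol)"
  unfolding wt_less_def by (auto dest!: subsetD[OF keys_mult] simp: wt_add split: if_splits)

lemma leading_single [simp]: "leading W m c (single m c)"
  by (simp add: leading_def)

lemma leading_mult:
  assumes "leading W m c f" "leading W m' c' f'"
  shows "leading W (m + m') (c * c') (f * f')"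
proof -
  define g g' where "g = f - single m c" and "g' = f' - single m' c'"
  have "f * f' - single (m + m') (c * c') = single m c * g' + (single m' c' * g + g * g')"
    by (simp add: g_def g'_def algebra_simps mult_single[symmetric])
  moreover have "wt_less W (wt W (m + m')) (single m c * g')" "wt_less W (wt W (m + m')) (single m' c' * g)"
    "wt_less W (wt W (m + m')) (g * g')"
    using assms unfolding leading_def g_def[symmetric] g'_def[symmetric] wt_add
    by (auto intro: wt_less_single_mult wt_less_mult)
  ultimately show ?thesis
    by (simp add: leading_def wt_less_add)
qed

lemma leading_one [simp]: "leading W 0 1 1"
  using leading_single[of W 0 1] by simp

lemma leading_power: "leading W m c f \<Longrightarrow> leading W (\<Sum>i<n. m) (c ^ n) (f ^ n)"
  by (induction n) (auto simp: ac_simps intro: leading_mult)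

lemma leading_prod:
  "(\<And>i. i \<in> I \<Longrightarrow> leading W (e i) (c i) (F i)) \<Longrightarrow> leading W (sum e I) (prod c I) (prod F I)"
  by (induction I rule: infinite_finite_induct) (auto intro!: leading_mult)

lemma leading_add_less:
  "leading W m c f \<Longrightarrow> wt_less W (wt W m) g \<Longrightarrow> leading W m c (f + g)"
  using wt_less_add[of W "wt W m" "f - single m c" g] by (simp add: leading_def algebra_simps)

lemma leading_lookup: "leading W m c f \<Longrightarrow> lookup f m = c"
  unfolding leading_def wt_less_def
  by (metis in_keys_iff less_irrefl lookup_minus lookup_single_eq right_minus_eq)

lemma leading_keys:
  assumes "leading W m c f" "e \<in> keys f" shows "e = m \<or> wt W e < wt W m"
proof (rule disjCI)
  assume "\<not> wt W e < wt W m"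
  then have "e \<notin> keys (f - single m c)" using assms(1) by (auto simp: leading_def wt_less_def)
  then show "e = m" using assms(2) by (auto simp: in_keys_iff lookup_minus lookup_single when_def split: if_splits)
qed

lemma leading_const_mult: "leading W m c f \<Longrightarrow> leading W m (a * c) (pconst a * f)"
  using leading_mult[of W 0 a "pconst a" m c f] by (simp add: pconst_def)

subsection \<open>Antichains in the north-east order\<close>

definition ne :: "nat \<times> nat \<Rightarrow> nat \<times> nat \<Rightarrow> bool" where
  "ne x y \<longleftrightarrow> fst y < fst x \<and> snd x < snd y"

lemma ne_trans: "ne x y \<Longrightarrow> ne y z \<Longrightarrow> ne x z"
  by (auto simp: ne_def)

definition ne_antichain :: "(nat \<times> nat) set \<Rightarrow> bool" where
  "ne_antichain G \<longleftrightarrow> (\<forall>x\<in>G. \<forall>y\<in>G. \<not> ne x y)"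

text \<open>The weights form a strictly Monge matrix, and \<open>G\<close> is to be exactly the set
  of tight positions of a dual solution. Positions are inserted in lexicographic order. If the row
  or the column of the new last position is already met, tightness forces the one new potential, and
  the Monge inequality keeps the sums strictly below the weights elsewhere. Both cannot be met,
  since that would give a comparable pair.\<close>

lemma antichain_potentials:
  fixes C :: int
  defines "w \<equiv> (\<lambda>i j. C - 2 * (int i * int j))"
  assumes "finite G" "ne_antichain G"
  shows "\<exists>u v. \<forall>i\<in>fst ` G. \<forall>j\<in>snd ` G. u i + v j \<le> w i j \<and> (u i + v j = w i j \<longleftrightarrow> (i, j) \<in> G)"
  using assms(2,3)
proof (induction G rule: finite_linorder_max_induct)
  case empty
  then show ?case by simp
next
  case (insert g G)
  obtain a b where g: "g = (a, b)" by force
  \<comment> \<open>The gap is 2(i' - i)(j' - j). The factor 2 in the weight makes it at least 2,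
    which leaves room for an integer strictly between the two bounds in case
    \<open>A\<close>.\<close>
  have monge: "w i j + w i' j' + 2 \<le> w i j' + w i' j" if "i < i'" "j < j'" for i i' j j'
  proof -
    have "1 * 1 \<le> (int i' - int i) * (int j' - int j)"
      using that by (intro mult_mono) auto
    then show ?thesis unfolding w_def by (simp add: algebra_simps)
  qed
  from insert have "ne_antichain G" by (auto simp: ne_antichain_def)
  with insert.IH obtain u v where uv:
    "\<And>i j. i \<in> fst ` G \<Longrightarrow> j \<in> snd ` G \<Longrightarrow> u i + v j \<le> w i j \<and> (u i + v j = w i j \<longleftrightarrow> (i, j) \<in> G)" by blast
  have lt: "i < a \<or> i = a \<and> j < b" if "(i, j) \<in> G" for i j
    using insert.hyps(2) that unfolding g by fastforce
  have fG: "i \<in> fst ` G" and sG: "j \<in> snd ` G" if "(i, j) \<in> G" for i j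
    using that by (auto intro: rev_image_eqI)
  have anti: "\<not> ne x y" if "x \<in> insert g G" "y \<in> insert g G" for x y
    using insert.prems that unfolding ne_antichain_def by blast
  have jle: "j \<le> b" if "(i, j) \<in> G" for i j
    using lt[OF that] anti[of g "(i, j)"] that by (auto simp: ne_def g)
  have iF: "i \<le> a" if "i \<in> fst ` G" for i using that by (auto dest: lt)
  have jF: "j \<le> b" if "j \<in> snd ` G" for j using that by (auto dest: jle)
  have gnot: "(a, b) \<notin> G" using lt[of a b] by auto
  consider (D) "a \<in> fst ` G" "b \<in> snd ` G" | (C) "a \<in> fst ` G" "b \<notin> snd ` G"
    | (B) "a \<notin> fst ` G" "b \<in> snd ` G" | (A) "a \<notin> fst ` G" "b \<notin> snd ` G" by blast
  then show ?case
  proof cases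
    case D
    then obtain i j where ij: "(a, j) \<in> G" "(i, b) \<in> G" by auto
    then have "j < b" "i < a" using gnot lt[of a j] lt[of i b] by auto
    then have "ne (a, j) (i, b)" by (auto simp: ne_def)
    then show ?thesis using anti[of "(a, j)" "(i, b)"] ij by blast
  next
    case C
    then obtain j where j: "(a, j) \<in> G" by force
    then have jb: "j < b" using lt[of a j] by simp
    define v' where "v' = v(b := w a b - u a)"
    have uj: "u a + v j = w a j" using uv[OF fG[OF j] sG[OF j]] j by blast
    have new: "u i + v' b \<le> w i b \<and> (u i + v' b = w i b \<longleftrightarrow> (i, b) \<in> insert g G)" if "i \<in> fst ` G" for i
    proof (cases "i = a")
      case True then show ?thesis by (simp add: v'_def g)
    next
      case False
      then have ia: "i < a" using iF[OF that] by simp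
      have "u i + v j \<le> w i j" using uv[OF that sG[OF j]] by blast
      moreover have "(i, b) \<notin> insert g G" using C False sG by (auto simp: g)
      ultimately show ?thesis using monge[OF ia jb] uj by (auto simp: v'_def)
    qed
    have old: "v' j' = v j'" if "j' \<in> snd ` G" for j' using that C by (auto simp: v'_def)
    have row: "fst ` insert g G = fst ` G" using C g by auto
    show ?thesis
    proof (intro exI ballI)
      fix i j' assume i: "i \<in> fst ` insert g G" and j': "j' \<in> snd ` insert g G"
      show "u i + v' j' \<le> w i j' \<and> (u i + v' j' = w i j' \<longleftrightarrow> (i, j') \<in> insert g G)"
      proof (cases "j' = b")
        case True then show ?thesis using new[of i] i unfolding row by blast
      next
        case False
        then have "j' \<in> snd ` G" using j' g by auto
        then show ?thesis using uv[of i j'] i old[of j'] False unfolding row by (auto simp: g)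
      qed
    qed
  next
    case B
    then obtain i where i: "(i, b) \<in> G" by force
    then have ia: "i < a" using lt[of i b] by auto
    define u' where "u' = u(a := w a b - v b)"
    have ui: "u i + v b = w i b" using uv[OF fG[OF i] sG[OF i]] i by blast
    have new: "u' a + v j \<le> w a j \<and> (u' a + v j = w a j \<longleftrightarrow> (a, j) \<in> insert g G)" if "j \<in> snd ` G" for j
    proof (cases "j = b")
      case True then show ?thesis by (simp add: u'_def g)
    next
      case False
      then have jb: "j < b" using jF[OF that] by simp
      have "u i + v j \<le> w i j" using uv[OF fG[OF i] that] by blast
      moreover have "(a, j) \<notin> insert g G" using B False fG by (auto simp: g)
      ultimately show ?thesis using monge[OF ia jb] ui by (auto simp: u'_def)
    qed
    have old: "u' i' = u i'" if "i' \<in> fst ` G" for i' using that B by (auto simp: u'_def)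
    have col: "snd ` insert g G = snd ` G" using B g by auto
    show ?thesis
    proof (intro exI ballI)
      fix i' j assume i: "i' \<in> fst ` insert g G" and j: "j \<in> snd ` insert g G"
      show "u' i' + v j \<le> w i' j \<and> (u' i' + v j = w i' j \<longleftrightarrow> (i', j) \<in> insert g G)"
      proof (cases "i' = a")
        case True then show ?thesis using new[of j] j unfolding col by blast
      next
        case False
        then have "i' \<in> fst ` G" using i g by auto
        then show ?thesis using uv[of i' j] j old[of i'] False unfolding col by (auto simp: g)
      qed
    qed
  next
    \<comment> \<open>Row and column are both new, so tightness fixes only the sum of the two new
      potentials. The row potential \<open>e\<close> has to exceed a bound coming from every old row
      and stay under one coming from every old column.\<close>
    case A
    have "\<exists>e. (\<forall>i\<in>fst ` G. u i - w i b + w a b < e) \<and> (\<forall>j\<in>snd ` G. e < w a j - v j)"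
    proof (cases "G = {}")
      case True then show ?thesis by simp
    next
      case False
      define e where "e = Max ((\<lambda>i. u i - w i b + w a b) ` (fst ` G)) + 1"
      have fin: "finite ((\<lambda>i. u i - w i b + w a b) ` (fst ` G))" "(\<lambda>i. u i - w i b + w a b) ` (fst ` G) \<noteq> {}"
        using insert.hyps(1) False by auto
      have "u i - w i b + w a b < e" if "i \<in> fst ` G" for i
        using Max_ge[OF fin(1) imageI[OF that]] unfolding e_def by linarith
      moreover have "e < w a j - v j" if "j \<in> snd ` G" for j
      proof -
        obtain i where i: "i \<in> fst ` G" and e: "e = u i - w i b + w a b + 1"
          using Max_in[OF fin] unfolding e_def by auto
        have "u i + v j \<le> w i j" using uv[OF i that] by simp
        moreover have "i < a" "j < b"
          using iF[OF i] jF[OF that] i that A by (metis le_neq_implies_less)+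
        ultimately show ?thesis using monge[of i a j b] unfolding e by linarith
      qed
      ultimately show ?thesis by blast
    qed
    then obtain e where e: "\<And>i. i \<in> fst ` G \<Longrightarrow> u i - w i b + w a b < e"
      "\<And>j. j \<in> snd ` G \<Longrightarrow> e < w a j - v j" by blast
    define u' v' where "u' = u(a := e)" and "v' = v(b := w a b - e)"
    show ?thesis
    proof (intro exI ballI)
      fix i j assume i: "i \<in> fst ` insert g G" and j: "j \<in> snd ` insert g G"
      have i': "i \<noteq> a \<Longrightarrow> i \<in> fst ` G" and j': "j \<noteq> b \<Longrightarrow> j \<in> snd ` G" using i j g by auto
      have nin: "i = a \<Longrightarrow> (i, j) \<notin> G" "j = b \<Longrightarrow> (i, j) \<notin> G" using A fG sG by blast+
      show "u' i + v' j \<le> w i j \<and> (u' i + v' j = w i j \<longleftrightarrow> (i, j) \<in> insert g G)"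
      proof (cases "i = a"; cases "j = b")
        assume "i = a" "j = b" then show ?thesis by (simp add: u'_def v'_def g)
      next
        assume c: "i = a" "j \<noteq> b"
        then show ?thesis using e(2)[of j] j' nin by (simp add: u'_def v'_def g)
      next
        assume c: "i \<noteq> a" "j = b"
        then show ?thesis using e(1)[of i] i' nin by (simp add: u'_def v'_def g)
      next
        assume c: "i \<noteq> a" "j \<noteq> b"
        then show ?thesis using uv[OF i' j'] by (simp add: u'_def v'_def g)
      qed
    qed
  qed
qed

text \<open>Rows and columns that do not meet \<open>G\<close> get a potential below every weight.\<close>
lemma antichain_potentials_total:
  fixes C :: int
  assumes "finite R" "G \<subseteq> R" "ne_antichain G" "\<And>i j. (i, j) \<in> R \<Longrightarrow> 2 * (int i * int j) \<le> C"
  obtains u v where "\<And>i j. (i, j) \<in> R \<Longrightarrow> u i + v j \<le> C - 2 * (int i * int j)"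
    "\<And>i j. (i, j) \<in> R \<Longrightarrow> u i + v j = C - 2 * (int i * int j) \<longleftrightarrow> (i, j) \<in> G"
proof -
  have finG: "finite G" using assms finite_subset by blast
  obtain u v where uv: "\<And>i j. i \<in> fst ` G \<Longrightarrow> j \<in> snd ` G \<Longrightarrow>
      u i + v j \<le> C - 2 * (int i * int j) \<and> (u i + v j = C - 2 * (int i * int j) \<longleftrightarrow> (i, j) \<in> G)"
    using antichain_potentials[OF finG assms(3), of C] by blast
  \<comment> \<open>Any potential plus \<open>- B\<close> is negative, whereas the weights on
    \<open>R\<close> are nonnegative.\<close>
  define B where "B = 1 + (\<Sum>i\<in>fst ` G. \<bar>u i\<bar>) + (\<Sum>j\<in>snd ` G. \<bar>v j\<bar>)"
  have Bu: "\<bar>u i\<bar> < B" if "i \<in> fst ` G" for i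
  proof -
    have "\<bar>u i\<bar> \<le> (\<Sum>i\<in>fst ` G. \<bar>u i\<bar>)" using that finG by (intro member_le_sum) auto
    then show ?thesis unfolding B_def using sum_nonneg[of "snd ` G" "\<lambda>j. \<bar>v j\<bar>"] by linarith
  qed
  have Bv: "\<bar>v j\<bar> < B" if "j \<in> snd ` G" for j
  proof -
    have "\<bar>v j\<bar> \<le> (\<Sum>j\<in>snd ` G. \<bar>v j\<bar>)" using that finG by (intro member_le_sum) auto
    then show ?thesis unfolding B_def using sum_nonneg[of "fst ` G" "\<lambda>j. \<bar>u j\<bar>"] by linarith
  qed
  have B0: "B > 0" unfolding B_def by (simp add: sum_nonneg add_pos_nonneg)
  define u' where "u' i = (if i \<in> fst ` G then u i else - B)" for i
  define v' where "v' j = (if j \<in> snd ` G then v j else - B)" for j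
  have key: "u' i + v' j \<le> C - 2 * (int i * int j) \<and> (u' i + v' j = C - 2 * (int i * int j) \<longleftrightarrow> (i, j) \<in> G)"
    if "(i, j) \<in> R" for i j
  proof (cases "i \<in> fst ` G \<and> j \<in> snd ` G")
    case True then show ?thesis using uv by (simp add: u'_def v'_def)
  next
    case False
    then have "(i, j) \<notin> G" by (auto intro: rev_image_eqI)
    moreover have "u' i < B" using Bu[of i] B0 by (cases "i \<in> fst ` G") (simp_all add: u'_def)
    moreover have "v' j < B" using Bv[of j] B0 by (cases "j \<in> snd ` G") (simp_all add: v'_def)
    moreover have "u' i = - B \<or> v' j = - B" using False by (auto simp: u'_def v'_def)
    ultimately have "(i, j) \<notin> G" "u' i + v' j < 0" by auto
    then show ?thesis using assms(4)[OF that] by auto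
  qed
  show ?thesis by (rule that[of u' v']) (use key in blast)+
qed

text \<open>As edges between rows and columns, the positions of an antichain form a forest, so row
  and column sums determine the values. Otherwise the lexicographically least position with a
  nonzero value would share its row with one such position and its column with another, and these
  two would be comparable.\<close>

lemma antichain_sums_determine:
  fixes D :: "nat \<times> nat \<Rightarrow> int"
  assumes "finite G" "ne_antichain G"
    and rows: "\<And>i. (\<Sum>j\<in>{j. (i, j) \<in> G}. D (i, j)) = 0"
    and cols: "\<And>j. (\<Sum>i\<in>{i. (i, j) \<in> G}. D (i, j)) = 0"
    and "x \<in> G"
  shows "D x = 0"
proof (rule ccontr)
  assume "D x \<noteq> 0"
  define H where "H = {y\<in>G. D y \<noteq> 0}"
  have H: "finite H" "H \<noteq> {}" using assms(1,5) \<open>D x \<noteq> 0\<close> unfolding H_def by (simp, blast)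
  obtain i j where m: "(i, j) = Min H" by (metis surj_pair)
  then have ij: "(i, j) \<in> H" using Min_in[OF H] by simp
  have low: "i < i' \<or> i = i' \<and> j \<le> j'" if "(i', j') \<in> H" for i' j'
    using Min_le[OF H(1) that] m by (metis le_less less_eq_prod_simp prod.inject)
  have "\<exists>j'. j' \<noteq> j \<and> (i, j') \<in> H"
  proof (rule ccontr)
    assume "\<not> ?thesis"
    then have "(\<Sum>j'\<in>{j. (i, j) \<in> G}. D (i, j')) = (\<Sum>j'\<in>{j}. D (i, j'))"
      using ij assms(1) finite_vimageI[OF assms(1), of "\<lambda>j. (i, j)"]
      by (intro sum.mono_neutral_right) (auto simp: H_def inj_on_def vimage_def)
    then show False using rows[of i] ij by (simp add: H_def)
  qed
  then obtain j' where j': "j' \<noteq> j" "(i, j') \<in> H" by blast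
  have "\<exists>i'. i' \<noteq> i \<and> (i', j) \<in> H"
  proof (rule ccontr)
    assume "\<not> ?thesis"
    then have "(\<Sum>i'\<in>{i. (i, j) \<in> G}. D (i', j)) = (\<Sum>i'\<in>{i}. D (i', j))"
      using ij assms(1) finite_vimageI[OF assms(1), of "\<lambda>i. (i, j)"]
      by (intro sum.mono_neutral_right) (auto simp: H_def inj_on_def vimage_def)
    then show False using cols[of j] ij by (simp add: H_def)
  qed
  then obtain i' where i': "i' \<noteq> i" "(i', j) \<in> H" by blast
  have "ne (i', j) (i, j')"
    using low[OF i'(2)] low[OF j'(2)] i' j' by (auto simp: ne_def)
  then show False using i' j' assms(2) by (auto simp: H_def ne_antichain_def)
qed

subsection \<open>Ladders with a rank function\<close>

text \<open>The last two assumptions make the set of positions with \<open>r < tau x\<close> meet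
  every rectangle inside \<open>L\<close> in a product of a row set and a column set. This is what
  lets the generic matrix factor on rectangles in \<open>minor_in_Q\<close>.\<close>

locale rank_ladder =
  fixes nr nc :: nat and L :: "(nat \<times> nat) set" and tau :: "nat \<times> nat \<Rightarrow> nat"
  assumes L_subset: "L \<subseteq> {1..nr} \<times> {1..nc}"
    and ladder: "\<lbrakk>(i, j) \<in> L; (i', j') \<in> L; i \<le> i'; j' \<le> j; i \<le> r; r \<le> i'; j' \<le> w; w \<le> j\<rbrakk>
      \<Longrightarrow> (r, w) \<in> L"
    and tau_pos: "x \<in> L \<Longrightarrow> 1 \<le> tau x"
    and tau_mono: "\<lbrakk>(i, j) \<in> L; (i', j') \<in> L; i' \<le> i; j \<le> j'\<rbrakk> \<Longrightarrow> tau (i', j') \<le> tau (i, j)"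
    and tau_rect: "\<lbrakk>(i, j) \<in> L; (i, j') \<in> L; (i', j) \<in> L; (i', j') \<in> L; i < i'; j < j'\<rbrakk>
      \<Longrightarrow> min (tau (i, j)) (tau (i', j')) \<le> tau (i, j')"
begin

lemma finite_L: "finite L"
  using L_subset finite_subset by blast

text \<open>With this weight the leading monomial of a minor is its antidiagonal.\<close>
definition antidiag_wt :: "nat \<times> nat \<Rightarrow> int" where
  "antidiag_wt x = 2 * (int nr * int nc + 1) - 2 * (int (fst x) * int (snd x))"

lemma prod_le: "(i, j) \<in> L \<Longrightarrow> int i * int j \<le> int nr * int nc"
  using L_subset by (auto simp del: of_nat_mult intro!: mult_mono)

text \<open>The additive constant in the weight does not change which term of a minor leads, as all
  terms have the same degree. It makes the weights positive, so that only finitely many monomials in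
  \<open>L\<close> lie below a given weight.\<close>

lemma antidiag_wt_pos: "x \<in> L \<Longrightarrow> antidiag_wt x \<ge> 2"
  using prod_le[of "fst x" "snd x"] by (simp add: antidiag_wt_def)

text \<open>Generic matrices whose rank on the rectangles of \<open>L\<close> is bounded by \<open>tau\<close>, and their
  generic deformations; the indeterminates are $U_{r,i}$, $V_{r,j}$ and $Y_{i,j}$.\<close>
definition generic_entry :: "nat \<times> nat \<Rightarrow> (nat \<times> nat \<times> nat, 'k::field) mpol" where
  "generic_entry x = (\<Sum>r\<in>{1..<tau x}. pvar (0, r, fst x) * pvar (1, r, snd x))"

definition deformed_entry :: "nat \<times> nat \<Rightarrow> (nat \<times> nat \<times> nat, 'k::field) mpol" where
  "deformed_entry x = generic_entry x + pvar (2, x)"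

text \<open>Taken as a kernel, the ideal is prime at once, because the target is a domain. That
  minors generate it is shown separately, in \<open>Q_subset_if_minors\<close>.\<close>

definition Q :: "'k::field matrix_poly set" where
  "Q = {f \<in> polys_in L. poly_subst generic_entry f = 0}"

text \<open>The level of a position is the index r of the summand U_{r,i} V_{r,j} that will lead the
  image of x_{i,j}. Positions of equal level form an antichain, to which
  \<open>antichain_potentials_total\<close> applies.\<close>

definition levels :: "(nat \<times> nat) set \<Rightarrow> (nat \<times> nat \<Rightarrow> nat) \<Rightarrow> bool" where
  "levels F lam \<longleftrightarrow> (\<forall>x\<in>F. 1 \<le> lam x \<and> lam x < tau x \<and> (\<forall>y\<in>F. ne x y \<longrightarrow> lam y < lam x))"

definition face :: "(nat \<times> nat) set \<Rightarrow> bool" where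
  "face F \<longleftrightarrow> F \<subseteq> L \<and> (\<exists>lam. levels F lam)"

definition odeg :: "(nat \<times> nat) set \<Rightarrow> (nat \<times> nat \<Rightarrow>\<^sub>0 nat) \<Rightarrow> nat" where
  "odeg F m = (\<Sum>x\<in>L - F. lookup m x)"

definition Ydeg :: "(nat \<times> nat \<times> nat \<Rightarrow>\<^sub>0 nat) \<Rightarrow> int" where
  "Ydeg = wt (\<lambda>t. if fst t = 2 then 1 else 0)"

text \<open>Unlike in \<open>leading\<close>, ties are allowed here: an arbitrary polynomial may
  have several terms of top weight.\<close>

definition top_monom :: "(nat \<times> nat \<Rightarrow>\<^sub>0 nat) \<Rightarrow> 'k::field matrix_poly \<Rightarrow> bool" where
  "top_monom m f \<longleftrightarrow> m \<in> keys f \<and> (\<forall>e\<in>keys f. wt antidiag_wt e \<le> wt antidiag_wt m)"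

text \<open>A weight on U, V, Y is chosen for which the image of x has a leading monomial
  \<open>ex x\<close> of the same weight as x: a product U V on the face, a single Y outside.
  Leading images of distinct monomials are distinct, so the image of \<open>m\<close> survives in
  the image of \<open>f\<close>, and its degree in Y counts the factors of \<open>m\<close> outside
  the face.\<close>

lemma deformed_top_monom:
  fixes f :: "'k::field matrix_poly"
  assumes F: "face F" and f: "f \<in> polys_in L" and m: "top_monom m f"
  shows "\<exists>e \<in> keys (poly_subst deformed_entry f). Ydeg e = int (odeg F m)"
proof -
  from F obtain lam where FL: "F \<subseteq> L" and lam: "levels F lam" by (auto simp: face_def)
  define G where "G r = {x\<in>F. lam x = r}" for r
  define R where "R r = {x\<in>L. r < tau x}" for r
  have GR: "G r \<subseteq> R r" for r using lam FL by (auto simp: G_def R_def levels_def)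
  have antiG: "ne_antichain (G r)" for r
    unfolding ne_antichain_def
  proof (intro ballI notI)
    fix x y assume xy: "x \<in> G r" "y \<in> G r" "ne x y"
    then have "lam y < lam x" using lam unfolding levels_def G_def by blast
    then show False using xy by (simp add: G_def)
  qed
  have finR: "finite (R r)" for r using finite_L by (simp add: R_def)
  have finG: "finite (G r)" for r using finite_subset[OF GR finR] .
  have "\<exists>u v. (\<forall>i j. (i, j) \<in> R r \<longrightarrow> u i + v j \<le> antidiag_wt (i, j)) \<and>
      (\<forall>i j. (i, j) \<in> R r \<longrightarrow> (u i + v j = antidiag_wt (i, j) \<longleftrightarrow> (i, j) \<in> G r))" for r
  proof (rule antichain_potentials_total[OF finR GR antiG])
    show "2 * (int i * int j) \<le> 2 * (int nr * int nc + 1)" if "(i, j) \<in> R r" for i j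
      using that prod_le[of i j] by (simp add: R_def)
  qed (auto simp: antidiag_wt_def)
  then obtain u v where uv:
    "\<And>r i j. (i, j) \<in> R r \<Longrightarrow> u r i + v r j \<le> antidiag_wt (i, j)"
    "\<And>r i j. (i, j) \<in> R r \<Longrightarrow> (u r i + v r j = antidiag_wt (i, j) \<longleftrightarrow> (i, j) \<in> G r)"
    by metis
  \<comment> \<open>On the face Y loses by 1 to the tight product of the chosen level. Off the face
    no product is tight, so Y wins with the full weight.\<close>
  define W :: "nat \<times> nat \<times> nat \<Rightarrow> int" where
    "W t = (if fst t = 0 then u (fst (snd t)) (snd (snd t))
            else if fst t = 1 then v (fst (snd t)) (snd (snd t))
            else if snd t \<in> F then antidiag_wt (snd t) - 1 else antidiag_wt (snd t))" for t
  define ex :: "nat \<times> nat \<Rightarrow> (nat \<times> nat \<times> nat \<Rightarrow>\<^sub>0 nat)" where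
    "ex x = (if x \<in> F then single (0, lam x, fst x) 1 + single (1, lam x, snd x) 1 else single (2, x) 1)" for x
  let ?UV = "\<lambda>r x. pvar (0, r, fst x) * pvar (1, r, snd x) :: (nat \<times> nat \<times> nat, 'k) mpol"
  have UV: "?UV r x = single (single (0, r, fst x) 1 + single (1, r, snd x) 1) 1" for r x
    by (simp add: pvar_def mult_single)
  have wtUV: "wt W (single (0, r, fst x) 1 + single (1, r, snd x) 1) = u r (fst x) + v r (snd x)" for r x
    by (simp add: wt_add W_def)
  have wtx: "wt W (ex x) = antidiag_wt x" if "x \<in> L" for x
  proof (cases "x \<in> F")
    case True
    then have "x \<in> G (lam x)" by (simp add: G_def)
    then have "u (lam x) (fst x) + v (lam x) (snd x) = antidiag_wt x"
      using uv(2)[of "fst x" "snd x" "lam x"] GR by auto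
    then show ?thesis using True wtUV[of "lam x" x] by (simp add: ex_def)
  next
    case False then show ?thesis by (simp add: ex_def W_def)
  qed
  have lessUV: "wt_less W (antidiag_wt x) (?UV r x)" if "x \<in> L" "r < tau x" "x \<notin> G r" for r x
  proof -
    have "u r (fst x) + v r (snd x) < antidiag_wt x"
      using that uv[of "fst x" "snd x" r] by (auto simp: R_def order.strict_iff_order)
    then show ?thesis unfolding UV wt_less_def using wtUV[of r x] by simp
  qed
  have lead: "leading W (ex x) 1 (deformed_entry x :: (_, 'k) mpol)" if x: "x \<in> L" for x
  proof (cases "x \<in> F")
    case True
    then have lx: "lam x \<in> {1..<tau x}" using lam by (auto simp: levels_def)
    have "(deformed_entry x :: (_, 'k) mpol) = ?UV (lam x) x +
        ((\<Sum>r\<in>{1..<tau x} - {lam x}. ?UV r x) + pvar (2, x))"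
      unfolding deformed_entry_def generic_entry_def
      by (subst sum.remove[OF _ lx]) (simp_all add: algebra_simps)
    moreover have "wt_less W (antidiag_wt x) ((\<Sum>r\<in>{1..<tau x} - {lam x}. ?UV r x) + pvar (2, x))"
    proof (intro wt_less_add wt_less_sum lessUV x)
      show "wt_less W (antidiag_wt x) (pvar (2, x) :: (_, 'k) mpol)"
        using True by (simp add: wt_less_def pvar_def W_def)
    qed (auto simp: G_def)
    moreover have "?UV (lam x) x = single (ex x) 1" using True by (simp only: UV ex_def if_True)
    ultimately show ?thesis
      using wtx[OF x] by (simp add: leading_add_less)
  next
    case False
    have "(deformed_entry x :: (_, 'k) mpol) = single (ex x) 1 + (\<Sum>r\<in>{1..<tau x}. ?UV r x)"
      using False by (simp add: deformed_entry_def generic_entry_def ex_def pvar_def)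
    moreover have "wt_less W (antidiag_wt x) (\<Sum>r\<in>{1..<tau x}. ?UV r x)"
      using False by (intro wt_less_sum lessUV x) (auto simp: G_def)
    ultimately show ?thesis
      using wtx[OF x] by (simp add: leading_add_less)
  qed
  define E where "E e = (\<Sum>x\<in>L. \<Sum>i<lookup e x. ex x)" for e :: "nat \<times> nat \<Rightarrow>\<^sub>0 nat"
  have keysL: "keys e \<subseteq> L" if "e \<in> keys f" for e using f that by (auto simp: polys_in_def)
  have leadE: "leading W (E e) 1 (monom_subst deformed_entry e :: (_, 'k) mpol)" if "keys e \<subseteq> L" for e
  proof -
    have "leading W (\<Sum>x\<in>L. \<Sum>i<lookup e x. ex x) (\<Prod>x\<in>L. 1 ^ lookup e x)
        (\<Prod>x\<in>L. (deformed_entry x :: (_, 'k) mpol) ^ lookup e x)"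
      by (intro leading_prod leading_power lead)
    then show ?thesis by (simp add: E_def monom_subst_superset[OF finite_L that])
  qed
  have wtE: "wt W (E e) = wt antidiag_wt e" if "keys e \<subseteq> L" for e
    by (simp add: E_def wt_sum wtx wt_superset[OF finite_L that])
  have lookE: "lookup (E e) t = (\<Sum>x\<in>L. lookup e x * lookup (ex x) t)" for e t
    by (simp add: E_def lookup_sum)
  have exY: "lookup (ex y) (2, x) = (if y = x \<and> y \<notin> F then 1 else 0)" for x y
    by (cases "y \<in> F") (simp_all add: ex_def lookup_add lookup_single when_def)
  have exU: "lookup (ex y) (0, r, i) = (if y \<in> G r \<and> fst y = i then 1 else 0)" for r i y
    by (cases "y \<in> F") (simp_all add: ex_def lookup_add lookup_single when_def G_def)
  have exV: "lookup (ex y) (1, r, j) = (if y \<in> G r \<and> snd y = j then 1 else 0)" for r j y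
    by (cases "y \<in> F") (simp_all add: ex_def lookup_add lookup_single when_def G_def)
  have pick: "(\<Sum>y\<in>L. lookup e y * (if P y then 1 else 0)) = (\<Sum>y\<in>{y\<in>L. P y}. lookup e y)" for e :: "nat \<times> nat \<Rightarrow>\<^sub>0 nat" and P
    using finite_L by (simp add: sum.inter_filter if_distrib cong: if_cong)
  have lookY: "lookup (E e) (2, x) = lookup e x" if "x \<in> L - F" for e x
  proof -
    have "{y\<in>L. y = x \<and> y \<notin> F} = {x}" using that by auto
    then show ?thesis unfolding lookE exY pick by simp
  qed
  have lookU: "lookup (E e) (0, r, i) = (\<Sum>j\<in>{j. (i, j) \<in> G r}. lookup e (i, j))" for e r i
    unfolding lookE exU pick
    by (rule sum.reindex_bij_witness[of _ "\<lambda>j. (i, j)" snd]) (use GR in \<open>auto simp: R_def\<close>)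
  have lookV: "lookup (E e) (1, r, j) = (\<Sum>i\<in>{i. (i, j) \<in> G r}. lookup e (i, j))" for e r j
    unfolding lookE exV pick
    by (rule sum.reindex_bij_witness[of _ "\<lambda>i. (i, j)" fst]) (use GR in \<open>auto simp: R_def\<close>)
  \<comment> \<open>Off \<open>F\<close> the exponent can be read off from Y. On each level of
    \<open>F\<close> only row and column sums are visible, and these suffice because the level is an
    antichain.\<close>
  have inj: "e = e'" if "keys e \<subseteq> L" "keys e' \<subseteq> L" "E e = E e'" for e e'
  proof (rule poly_mapping_eqI)
    fix x
    consider "x \<notin> L" | "x \<in> L - F" | "x \<in> F" by blast
    then show "lookup e x = lookup e' x"
    proof cases
      case 1 then show ?thesis using that by (metis in_keys_iff subset_iff)
    next
      case 2 then show ?thesis using lookY[of x e] lookY[of x e'] that by simp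
    next
      case 3
      define D where "D y = int (lookup e y) - int (lookup e' y)" for y
      have "D x = 0"
      proof (rule antichain_sums_determine[OF finG antiG])
        show "x \<in> G (lam x)" using 3 by (simp add: G_def)
        show "(\<Sum>j\<in>{j. (i, j) \<in> G (lam x)}. D (i, j)) = 0" for i
          using arg_cong[OF lookU[of e "lam x" i], of int] arg_cong[OF lookU[of e' "lam x" i], of int]
          by (simp add: D_def sum_subtractf that(3))
        show "(\<Sum>i\<in>{i. (i, j) \<in> G (lam x)}. D (i, j)) = 0" for j
          using arg_cong[OF lookV[of e "lam x" j], of int] arg_cong[OF lookV[of e' "lam x" j], of int]
          by (simp add: D_def sum_subtractf that(3))
      qed
      then show ?thesis by (simp add: D_def)
    qed
  qed
  have mk: "m \<in> keys f" and mtop: "\<And>e. e \<in> keys f \<Longrightarrow> wt antidiag_wt e \<le> wt antidiag_wt m"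
    using m by (auto simp: top_monom_def)
  \<comment> \<open>A term of \<open>f\<close> other than \<open>m\<close> cannot produce
    \<open>E m\<close>: its image is led by a different monomial and has no other term of weight as
    large as that of \<open>E m\<close>.\<close>
  have other: "lookup (pconst (lookup f e) * monom_subst deformed_entry e :: (_, 'k) mpol) (E m) =
      (if e = m then lookup f m else 0)" if e: "e \<in> keys f" for e
  proof -
    have ms: "lookup (pconst (lookup f e) * monom_subst deformed_entry e :: (_, 'k) mpol) (E m)
        = lookup f e * lookup (monom_subst deformed_entry e) (E m)"
      using lookup_single_mult[of 0 "lookup f e" "monom_subst deformed_entry e" "E m"] by (simp add: pconst_def)
    show ?thesis
    proof (cases "e = m")
      case True
      then show ?thesis using ms leading_lookup[OF leadE[OF keysL[OF mk]]] by simp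
    next
      case False
      have "E m \<notin> keys (monom_subst deformed_entry e :: (_, 'k) mpol)"
      proof
        assume "E m \<in> keys (monom_subst deformed_entry e :: (_, 'k) mpol)"
        from leading_keys[OF leadE[OF keysL[OF e]] this] show False
          using inj[OF keysL[OF mk] keysL[OF e]] False mtop[OF e] wtE[OF keysL[OF e]] wtE[OF keysL[OF mk]]
          by auto
      qed
      then show ?thesis using ms False by (simp add: in_keys_iff)
    qed
  qed
  have "lookup (poly_subst deformed_entry f :: (_, 'k) mpol) (E m) = lookup f m"
    unfolding poly_subst_def lookup_sum using other mk by (simp cong: sum.cong)
  then have "E m \<in> keys (poly_subst deformed_entry f :: (_, 'k) mpol)" using mk by (simp add: in_keys_iff)
  moreover have "Ydeg (E m) = int (odeg F m)"
  proof -
    have "Ydeg (ex x) = (if x \<in> F then 0 else 1)" for x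
      by (simp add: Ydeg_def ex_def wt_add)
    then have "Ydeg (E m) = (\<Sum>x\<in>L. if x \<in> F then 0 else int (lookup m x))"
      unfolding E_def Ydeg_def wt_sum by (intro sum.cong) auto
    also have "\<dots> = (\<Sum>x\<in>L - F. int (lookup m x))"
      using finite_L by (intro sum.mono_neutral_cong_right) auto
    finally show ?thesis by (simp add: odeg_def)
  qed
  ultimately show ?thesis by blast
qed

end

subsection \<open>Minors\<close>

lemma least_nonfixed_inversion:
  fixes s :: nat
  assumes p: "p permutes {0..<s}" and "p \<noteq> id"
  obtains i j where "i < j" "j < s" "p j < p i"
proof -
  define i where "i = (LEAST i. p i \<noteq> i)"
  have ex: "\<exists>i. p i \<noteq> i" using assms(2) by auto
  have i: "p i \<noteq> i" unfolding i_def by (rule LeastI_ex[OF ex])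
  have below: "p k = k" if "k < i" for k using not_less_Least[of k "\<lambda>i. p i \<noteq> i"] that by (auto simp: i_def)
  obtain j where j: "p j = i" using permutes_surj[OF p] by (metis surjD)
  have inj: "inj p" using permutes_inj[OF p] .
  have "p i > i" using below[of "p i"] i inj by (metis injD nat_neq_iff)
  moreover have "j > i" using below[of j] i j by (metis nat_neq_iff)
  moreover have "j < s" using j i p unfolding permutes_def by (metis \<open>i < j\<close> atLeastLessThan_iff less_irrefl zero_le)
  ultimately show ?thesis using that[of i j] j by simp
qed

text \<open>A permutation other than the identity has an inversion, and undoing it by a
  transposition strictly lowers the sum. So the minimum is attained at the identity only.\<close>

lemma rearrangement_strict:
  fixes f g :: "nat \<Rightarrow> nat"
  assumes f: "\<And>i j. i < j \<Longrightarrow> j < s \<Longrightarrow> f j < f i" and g: "\<And>i j. i < j \<Longrightarrow> j < s \<Longrightarrow> g i < g j"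
    and p: "p permutes {0..<s}" "p \<noteq> id"
  shows "(\<Sum>i<s. f i * g i) < (\<Sum>i<s. f i * g (p i))"
proof -
  define val where "val q = (\<Sum>i<s. f i * g (q i))" for q
  have improve: "\<exists>q'. q' permutes {0..<s} \<and> val q' < val q" if q: "q permutes {0..<s}" "q \<noteq> id" for q
  proof -
    obtain i j where ij: "i < j" "j < s" "q j < q i" using least_nonfixed_inversion[OF q] by blast
    define q' where "q' = q \<circ> Transposition.transpose i j"
    have q': "q' permutes {0..<s}"
      unfolding q'_def using ij by (intro permutes_compose permutes_swap_id q) auto
    have qi: "q i < s" using permutes_in_image[OF q(1), of i] ij by auto
    have split: "val r = f i * g (r i) + f j * g (r j) + (\<Sum>k\<in>{..<s} - {i, j}. f k * g (r k))" for r
    proof -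
      have "{..<s} = insert i (insert j ({..<s} - {i, j}))" using ij by auto
      then have "val r = (\<Sum>k\<in>insert i (insert j ({..<s} - {i, j})). f k * g (r k))"
        unfolding val_def by (simp only:)
      then show ?thesis using ij by simp
    qed
    have "(\<Sum>k\<in>{..<s} - {i, j}. f k * g (q' k)) = (\<Sum>k\<in>{..<s} - {i, j}. f k * g (q k))"
      by (rule sum.cong) (auto simp: q'_def transpose_def)
    moreover have "f i * g (q' i) + f j * g (q' j) < f i * g (q i) + f j * g (q j)"
    proof -
      have "f j < f i" "g (q j) < g (q i)" using f[OF ij(1,2)] g[OF ij(3) qi] by auto
      then obtain a b where "f i = f j + Suc a" "g (q i) = g (q j) + Suc b"
        by (metis less_imp_Suc_add add_Suc_right)
      then show ?thesis by (simp add: q'_def algebra_simps)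
    qed
    ultimately have "val q' < val q" unfolding split by simp
    then show ?thesis using q' by blast
  qed
  have fin: "finite {q. q permutes {0..<s}}" by (simp add: finite_permutations)
  have "id permutes {0..<s}" by (rule permutes_id)
  define q0 where "q0 = arg_min_on val {q. q permutes {0..<s}}"
  have q0: "q0 permutes {0..<s}" "\<And>q. q permutes {0..<s} \<Longrightarrow> val q0 \<le> val q"
    using arg_min_if_finite[OF fin, of val] \<open>id permutes {0..<s}\<close> unfolding q0_def
    by (blast, metis (mono_tags, lifting) empty_iff mem_Collect_eq not_less)
  have "q0 = id" using improve[OF q0(1)] q0(2) by (metis not_le)
  moreover have "val q0 < val p"
    using improve[OF p] q0(2) by (metis le_less_trans)
  ultimately show ?thesis by (simp add: val_def)
qed

text \<open>Rows and columns are listed by functions, in any order and possibly with repetitions: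
  chains list rows decreasingly, and \<open>dm_in_symb\<close> asks about all listings.\<close>

definition minor :: "(nat \<Rightarrow> nat) \<Rightarrow> (nat \<Rightarrow> nat) \<Rightarrow> nat \<Rightarrow> 'k::field matrix_poly" where
  "minor f g s = Determinant.det (mat s s (\<lambda>(i, j). pvar (f i, g j)))"

lemma minor_expand:
  "(minor f g s :: 'k::field matrix_poly) = (\<Sum>p\<in>{p. p permutes {0..<s}}.
     of_int (sign p) * single (\<Sum>i<s. single (f i, g (p i)) 1) 1)"
proof -
  have *: "(\<Prod>i\<in>I. pvar (f i, g (p i))) = (single (\<Sum>i\<in>I. single (f i, g (p i)) 1) 1 :: 'k matrix_poly)"
    if "finite I" for I p
    using that by (induction I) (simp_all add: pvar_def mult_single)
  have "(minor f g s :: 'k matrix_poly) = (\<Sum>p\<in>{p. p permutes {0..<s}}. of_int (sign p) *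
      (\<Prod>i = 0..<s. mat s s (\<lambda>(i, j). pvar (f i, g j)) $$ (i, p i)))"
    unfolding minor_def by (rule det_def') simp
  also have "\<dots> = (\<Sum>p\<in>{p. p permutes {0..<s}}. of_int (sign p) * (\<Prod>i<s. pvar (f i, g (p i))))"
  proof (rule sum.cong[OF refl])
    fix p assume "p \<in> {p. p permutes {0..<s}}"
    then have "p i < s" if "i < s" for i using that permutes_in_image[of p "{0..<s}" i] by auto
    then show "of_int (sign p) * (\<Prod>i = 0..<s. mat s s (\<lambda>(i, j). pvar (f i, g j)) $$ (i, p i)) =
      of_int (sign p) * (\<Prod>i<s. (pvar (f i, g (p i)) :: 'k matrix_poly))"
      by (auto intro!: arg_cong2[of _ _ _ _ "(*)"] prod.cong simp: atLeast0LessThan)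
  qed
  finally show ?thesis by (simp add: *)
qed

lemma minor_in_polys:
  assumes "\<And>i j. i < s \<Longrightarrow> j < s \<Longrightarrow> (f i, g j) \<in> V"
  shows "(minor f g s :: 'k::field matrix_poly) \<in> polys_in V"
  unfolding minor_expand
proof (intro polys_in_sum polys_in_mult polys_in_single)
  fix p assume "p \<in> {p. p permutes {0..<s}}"
  then have "p i < s" if "i < s" for i using that permutes_in_image[of p "{0..<s}" i] by auto
  then have "(\<Union>i<s. keys (single (f i, g (p i)) (1::nat))) \<subseteq> V" using assms by auto
  then show "keys (\<Sum>i<s. single (f i, g (p i)) (1::nat)) \<subseteq> V"
    using keys_sum_subset[of "\<lambda>i. single (f i, g (p i)) (1::nat)" "{..<s}"] by (rule order_trans[rotated])
  show "(of_int (sign p) :: 'k matrix_poly) \<in> polys_in V"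
    by (cases "evenperm p") (auto simp: sign_def)
qed

lemma minor_permute_rows:
  assumes "p permutes {0..<s}"
  shows "(minor (f \<circ> p) g s :: 'k::field matrix_poly) = of_int (sign p) * minor f g s"
proof -
  have "p i < s" if "i < s" for i using that permutes_in_image[OF assms, of i] by auto
  then have eq: "mat s s (\<lambda>(i, j). mat s s (\<lambda>(i, j). pvar (f i, g j)) $$ (p i, j))
      = (mat s s (\<lambda>(i, j). pvar ((f \<circ> p) i, g j)) :: 'k matrix_poly mat)"
    by (intro eq_matI) auto
  show ?thesis
    unfolding minor_def eq[symmetric] by (rule det_permute_rows[OF _ assms]) simp
qed

lemma matrix_minor_eq_minor:
  assumes "card A = s" "card B = s"
  shows "matrix_minor A B = minor ((!) (sorted_list_of_set A)) ((!) (sorted_list_of_set B)) s"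
  using assms by (simp add: matrix_minor_def minor_def indet_def pvar_def)

lemma strict_mono_image_nth:
  assumes "\<And>i j. i < j \<Longrightarrow> j < s \<Longrightarrow> g i < (g j :: nat)" "i < s"
  shows "sorted_list_of_set (g ` {..<s}) ! i = g i"
proof -
  have inj: "inj_on g {..<s}"
    using assms(1) by (intro inj_onI) (metis lessThan_iff nat_neq_iff)
  have "map g [0..<s] = sorted_list_of_set (g ` {..<s})"
    using sorted_list_of_set.idem_if_sorted_distinct[of "map g [0..<s]"] assms(1) inj
    by (auto simp: distinct_map atLeast0LessThan sorted_wrt_iff_nth_less less_imp_le intro!: sorted_wrt_mono_rel)
  then show ?thesis using assms(2) by (metis diff_zero length_upt nth_map nth_upt add_0)
qed

lemma minor_eq_matrix_minor:
  assumes f: "\<And>i j. i < j \<Longrightarrow> j < s \<Longrightarrow> f j < f i" and g: "\<And>i j. i < j \<Longrightarrow> j < s \<Longrightarrow> g i < g j"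
  shows "(minor f g s :: 'k::field matrix_poly) = matrix_minor (f ` {..<s}) (g ` {..<s}) \<or>
    (minor f g s :: 'k matrix_poly) = - matrix_minor (f ` {..<s}) (g ` {..<s})"
proof -
  define rv where "rv i = (if i < s then s - 1 - i else i)" for i
  have rv: "rv permutes {0..<s}"
  proof (rule bij_imp_permutes)
    show "bij_betw rv {0..<s} {0..<s}"
      by (rule bij_betw_byWitness[where f' = rv]) (auto simp: rv_def)
  qed (auto simp: rv_def)
  define f' where "f' = f \<circ> rv"
  have f'mono: "f' i < f' j" if "i < j" "j < s" for i j
    using f[of "rv j" "rv i"] that by (auto simp: f'_def rv_def)
  have im: "f' ` {..<s} = f ` {..<s}"
    using permutes_image[OF rv] unfolding f'_def image_comp[symmetric] by (simp add: atLeast0LessThan)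
  have inj: "inj_on g {..<s}" "inj_on f' {..<s}"
    using g f'mono by (auto intro!: inj_onI) (metis nat_neq_iff)+
  have "matrix_minor (f ` {..<s}) (g ` {..<s}) = (minor f' g s :: 'k matrix_poly)"
  proof -
    have "matrix_minor (f' ` {..<s}) (g ` {..<s}) =
        (minor ((!) (sorted_list_of_set (f' ` {..<s}))) ((!) (sorted_list_of_set (g ` {..<s}))) s :: 'k matrix_poly)"
      using inj by (intro matrix_minor_eq_minor) (simp_all add: card_image)
    also have "\<dots> = minor f' g s"
      unfolding minor_def
      by (intro arg_cong[of _ _ Determinant.det] eq_matI)
        (auto simp: strict_mono_image_nth[of s f', OF f'mono] strict_mono_image_nth[of s g, OF g])
    finally show ?thesis by (simp add: im)
  qed
  also have "\<dots> = of_int (sign rv) * minor f g s"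
    unfolding f'_def by (rule minor_permute_rows[OF rv])
  finally show ?thesis by (cases "evenperm rv") (simp_all add: sign_def)
qed

lemma poly_subst_minor:
  "poly_subst h (minor f g s) = Determinant.det (mat s s (\<lambda>(i, j). h (f i, g j)))"
proof -
  have sub: "poly_subst h (of_int z) = of_int z" for z :: int
    by (cases z rule: int_cases2)
      (simp_all add: poly_subst_uminus poly_subst_const[of h "of_nat _", unfolded pconst_def, simplified])
  have "poly_subst h (minor f g s) = (\<Sum>p\<in>{p. p permutes {0..<s}}.
      of_int (sign p) * (\<Prod>i = 0..<s. poly_subst h (mat s s (\<lambda>(i, j). pvar (f i, g j)) $$ (i, p i))))"
    unfolding minor_def by (subst det_def'[of _ s]) (simp_all add: poly_subst_sum poly_subst_mult poly_subst_prod sub)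
  also have "\<dots> = (\<Sum>p\<in>{p. p permutes {0..<s}}.
      of_int (sign p) * (\<Prod>i = 0..<s. mat s s (\<lambda>(i, j). h (f i, g j)) $$ (i, p i)))"
  proof (intro sum.cong refl arg_cong2[of _ _ _ _ "(*)"] prod.cong)
    fix p i assume "p \<in> {p. p permutes {0..<s}}" "i \<in> {0..<s}"
    then have "i < s" "p i < s" using permutes_in_image[of p "{0..<s}" i] by auto
    then show "poly_subst h (mat s s (\<lambda>(i, j). pvar (f i, g j)) $$ (i, p i)) = mat s s (\<lambda>(i, j). h (f i, g j)) $$ (i, p i)"
      by simp
  qed
  also have "\<dots> = Determinant.det (mat s s (\<lambda>(i, j). h (f i, g j)))"
    by (rule det_def'[symmetric]) simp
  finally show ?thesis .
qed

context rank_ladder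
begin

text \<open>With rows decreasing and columns increasing, the identity minimises the sum of the
  products of row and column numbers, hence maximises the weight.\<close>

lemma leading_minor:
  assumes f: "\<And>i j. i < j \<Longrightarrow> j < s \<Longrightarrow> f j < f i" and g: "\<And>i j. i < j \<Longrightarrow> j < s \<Longrightarrow> g i < g j"
  shows "leading antidiag_wt (\<Sum>i<s. single (f i, g i) 1) 1 (minor f g s :: 'k::field matrix_poly)"
proof -
  let ?P = "{p. p permutes {0..<s}}"
  let ?t = "\<lambda>p. of_int (sign p) * single (\<Sum>i<s. single (f i, g (p i)) 1) 1 :: 'k matrix_poly"
  have id: "id \<in> ?P" and fin: "finite ?P" by (simp_all add: permutes_id finite_permutations)
  have "minor f g s = ?t id + sum ?t (?P - {id})"
    unfolding minor_expand by (rule sum.remove[OF fin id])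
  moreover have "wt_less antidiag_wt (wt antidiag_wt (\<Sum>i<s. single (f i, g i) 1)) (?t p)" if p: "p \<in> ?P - {id}" for p
  proof -
    have "(\<Sum>i<s. f i * g i) < (\<Sum>i<s. f i * g (p i))"
      using rearrangement_strict[of s f g p, OF f g] p by simp
    then have "(\<Sum>i<s. int (f i) * int (g i)) < (\<Sum>i<s. int (f i) * int (g (p i)))"
      by (simp flip: of_nat_mult of_nat_sum)
    then have "wt antidiag_wt (\<Sum>i<s. single (f i, g (p i)) 1) < wt antidiag_wt (\<Sum>i<s. single (f i, g i) 1)"
      unfolding wt_sum by (simp add: antidiag_wt_def sum_subtractf flip: sum_distrib_left del: of_nat_sum)
    then have "wt_less antidiag_wt (wt antidiag_wt (\<Sum>i<s. single (f i, g i) 1)) (single (\<Sum>i<s. single (f i, g (p i)) 1) 1 :: 'k matrix_poly)"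
      by (simp add: wt_less_def)
    then show ?thesis by (cases "evenperm p") (simp_all add: sign_def)
  qed
  then have "wt_less antidiag_wt (wt antidiag_wt (\<Sum>i<s. single (f i, g i) 1)) (sum ?t (?P - {id}))"
    by (rule wt_less_sum)
  ultimately show ?thesis by (simp add: leading_add_less)
qed

text \<open>On a rectangle the generic matrix factors through a space of dimension s - 1. The number
  of summands varies from entry to entry, but the entries that contain the summand with index r form
  a product of rows and columns, so each factor is a matrix with some entries set to zero.\<close>

lemma minor_in_Q:
  assumes L: "\<And>i j. i < s \<Longrightarrow> j < s \<Longrightarrow> (f i, g j) \<in> L"
    and tau: "\<And>i j. i < s \<Longrightarrow> j < s \<Longrightarrow> tau (f i, g j) \<le> s" and s: "s > 0"
  shows "(minor f g s :: 'k::field matrix_poly) \<in> Q"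
proof -
  define a where "a r i \<longleftrightarrow> (\<exists>j<s. r < tau (f i, g j))" for r i
  define b where "b r j \<longleftrightarrow> (\<exists>i<s. r < tau (f i, g j))" for r j
  have rect: "r < tau (f i, g j) \<longleftrightarrow> a r i \<and> b r j" if ij: "i < s" "j < s" for r i j
  proof
    assume "a r i \<and> b r j"
    then obtain i' j' where ij': "i' < s" "j' < s" "r < tau (f i, g j')" "r < tau (f i', g j)"
      by (auto simp: a_def b_def)
    consider "f i' \<le> f i" | "g j \<le> g j'" | "f i < f i'" "g j' < g j" by linarith
    then show "r < tau (f i, g j)"
    proof cases
      case 1 then show ?thesis using tau_mono[of "f i" "g j" "f i'" "g j"] L ij ij' by force
    next
      case 2 then show ?thesis using tau_mono[of "f i" "g j" "f i" "g j'"] L ij ij' by force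
    next
      case 3 then show ?thesis using tau_rect[of "f i" "g j'" "g j" "f i'"] L ij ij' by force
    qed
  qed (use ij in \<open>auto simp: a_def b_def\<close>)
  \<comment> \<open>The summation starts at r = 1, so the column with index 0 is zero. It pads the
    factor to a square matrix and makes its determinant vanish.\<close>
  define A where "A = mat s s (\<lambda>(i, r). if r \<noteq> 0 \<and> a r i then pvar (0, r, f i) else (0 :: (nat \<times> nat \<times> nat, 'k) mpol))"
  define B where "B = mat s s (\<lambda>(r, j). if b r j then pvar (1, r, g j) else (0 :: (nat \<times> nat \<times> nat, 'k) mpol))"
  have carr: "A \<in> carrier_mat s s" "B \<in> carrier_mat s s" by (simp_all add: A_def B_def)
  have "mat s s (\<lambda>(i, j). generic_entry (f i, g j)) = A * B"
  proof (rule eq_matI)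
    fix i j assume "i < dim_row (A * B)" "j < dim_col (A * B)"
    then have ij: "i < s" "j < s" by (simp_all add: A_def B_def)
    have "(A * B) $$ (i, j) = (\<Sum>r = 0..<s. A $$ (i, r) * B $$ (r, j))"
      using ij by (simp add: A_def B_def scalar_prod_def)
    also have "\<dots> = (\<Sum>r = 0..<s. if r \<noteq> 0 \<and> r < tau (f i, g j) then pvar (0, r, f i) * pvar (1, r, g j) else 0)"
      using ij by (intro sum.cong) (auto simp: A_def B_def rect)
    also have "\<dots> = (\<Sum>r\<in>{1..<tau (f i, g j)}. pvar (0, r, f i) * pvar (1, r, g j))"
      using tau[OF ij] by (intro sum.mono_neutral_cong_right) auto
    finally show "mat s s (\<lambda>(i, j). generic_entry (f i, g j)) $$ (i, j) = (A * B) $$ (i, j)"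
      using ij by (simp add: generic_entry_def)
  qed (simp_all add: A_def B_def)
  moreover have "Determinant.det A = 0"
  proof -
    have "Determinant.det A = (\<Sum>i<s. A $$ (i, 0) * cofactor A i 0)"
      by (rule laplace_expansion_column[OF carr(1) s])
    also have "\<dots> = 0" using s by (intro sum.neutral) (simp add: A_def)
    finally show ?thesis .
  qed
  ultimately have "poly_subst generic_entry (minor f g s :: 'k matrix_poly) = 0"
    by (simp add: poly_subst_minor det_mult[OF carr])
  then show ?thesis using L by (simp add: Q_def minor_in_polys)
qed

end

subsection \<open>Powers and symbolic powers of a prime ideal\<close>

text \<open>Closure under sums only. When \<open>G\<close> absorbs multiplication by the ring, this
  is the ideal generated by \<open>G\<close>.\<close>

inductive_set asum :: "'a::comm_monoid_add set \<Rightarrow> 'a set" for G where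
  asum_0: "0 \<in> asum G"
| asum_gen: "g \<in> G \<Longrightarrow> g \<in> asum G"
| asum_add: "x \<in> asum G \<Longrightarrow> y \<in> asum G \<Longrightarrow> x + y \<in> asum G"

lemma asum_mult:
  fixes s :: "'a::comm_ring_1"
  assumes "x \<in> asum G" "\<And>g. g \<in> G \<Longrightarrow> s * g \<in> asum H"
  shows "s * x \<in> asum H"
  using assms by induction (auto simp: distrib_left intro: asum.intros)

locale prime_in =
  fixes S Q :: "'a::idom set"
  assumes S_0 [simp]: "0 \<in> S" and S_1 [simp]: "1 \<in> S"
    and S_add [intro]: "a \<in> S \<Longrightarrow> b \<in> S \<Longrightarrow> a + b \<in> S" and S_uminus [intro]: "a \<in> S \<Longrightarrow> - a \<in> S"
    and S_mult [intro]: "a \<in> S \<Longrightarrow> b \<in> S \<Longrightarrow> a * b \<in> S"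
    and Q_subset: "Q \<subseteq> S" and Q_0 [simp]: "0 \<in> Q" and Q_1 [simp]: "1 \<notin> Q"
    and Q_add [intro]: "a \<in> Q \<Longrightarrow> b \<in> Q \<Longrightarrow> a + b \<in> Q"
    and Q_mult [intro]: "a \<in> S \<Longrightarrow> b \<in> Q \<Longrightarrow> a * b \<in> Q"
    and Q_prime: "a \<in> S \<Longrightarrow> b \<in> S \<Longrightarrow> a * b \<in> Q \<Longrightarrow> a \<in> Q \<or> b \<in> Q"
begin

fun ipow :: "nat \<Rightarrow> 'a set" where
  "ipow 0 = S"
| "ipow (Suc n) = asum {a * b |a b. a \<in> ipow n \<and> b \<in> Q}"

definition symb :: "nat \<Rightarrow> 'a set" where
  "symb n = {f \<in> S. \<exists>s\<in>S - Q. s * f \<in> ipow n}"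

lemma S_minus [intro]: "a \<in> S \<Longrightarrow> b \<in> S \<Longrightarrow> a - b \<in> S"
  using S_add[of a "- b"] by auto

lemma S_power [intro]: "a \<in> S \<Longrightarrow> a ^ n \<in> S"
  by (induction n) auto

lemma S_sum [intro]: "(\<And>i. i \<in> I \<Longrightarrow> F i \<in> S) \<Longrightarrow> sum F I \<in> S"
  by (induction I rule: infinite_finite_induct) auto

lemma S_prod [intro]: "(\<And>i. i \<in> I \<Longrightarrow> F i \<in> S) \<Longrightarrow> prod F I \<in> S"
  by (induction I rule: infinite_finite_induct) auto

lemma S_of_int [simp, intro]: "of_int z \<in> S"
proof -
  have "of_nat n \<in> S" for n by (induction n) auto
  then show ?thesis by (cases z rule: int_cases2) auto
qed

lemma compl_mult: "a \<in> S - Q \<Longrightarrow> b \<in> S - Q \<Longrightarrow> a * b \<in> S - Q"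
  using Q_prime by auto

lemma compl_power: "a \<in> S - Q \<Longrightarrow> a ^ n \<in> S - Q"
  by (induction n) (auto dest: Q_prime)

lemma ipow_0 [simp]: "0 \<in> ipow n"
  by (cases n) (auto intro: asum.intros)

lemma ipow_add: "a \<in> ipow n \<Longrightarrow> b \<in> ipow n \<Longrightarrow> a + b \<in> ipow n"
  by (cases n) (auto intro: asum.intros)

lemma ipow_sum: "(\<And>i. i \<in> I \<Longrightarrow> F i \<in> ipow n) \<Longrightarrow> sum F I \<in> ipow n"
  by (induction I rule: infinite_finite_induct) (auto intro: ipow_add)

lemma ipow_subset: "ipow n \<subseteq> S"
proof (induction n)
  case (Suc n)
  have "x \<in> S" if "x \<in> asum {a * b |a b. a \<in> ipow n \<and> b \<in> Q}" for x
    using that by induction (use Suc Q_subset in auto)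
  then show ?case by auto
qed simp

lemma ipow_smult: "s \<in> S \<Longrightarrow> a \<in> ipow n \<Longrightarrow> s * a \<in> ipow n"
proof (induction n arbitrary: a)
  case (Suc n)
  have "s * (a * b) \<in> asum {a * b |a b. a \<in> ipow n \<and> b \<in> Q}" if "a \<in> ipow n" "b \<in> Q" for a b
  proof (rule asum_gen)
    have "s * (a * b) = (s * a) * b" by (simp add: mult.assoc)
    then show "s * (a * b) \<in> {a * b |a b. a \<in> ipow n \<and> b \<in> Q}" using Suc that by blast
  qed
  then have "s * g \<in> asum {a * b |a b. a \<in> ipow n \<and> b \<in> Q}" if "g \<in> {a * b |a b. a \<in> ipow n \<and> b \<in> Q}" for g
    using that by blast
  with Suc.prems show ?case using asum_mult[of a "{a * b |a b. a \<in> ipow n \<and> b \<in> Q}" s] by simp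
qed auto

lemma ipow_Suc_mult: "a \<in> ipow n \<Longrightarrow> b \<in> Q \<Longrightarrow> a * b \<in> ipow (Suc n)"
  by (auto intro!: asum_gen)

lemma ipow_mult: "a \<in> ipow n \<Longrightarrow> b \<in> ipow m \<Longrightarrow> a * b \<in> ipow (n + m)"
proof (induction m arbitrary: b)
  case 0
  then show ?case using ipow_smult[of b a n] by (simp add: mult.commute)
next
  case (Suc m)
  from Suc.prems(2) have "b \<in> asum {a * b |a b. a \<in> ipow m \<and> b \<in> Q}" by simp
  then show ?case
  proof induction
    case (asum_gen g)
    then obtain c q where "g = c * q" "c \<in> ipow m" "q \<in> Q" by auto
    then show ?case using ipow_Suc_mult[OF Suc.IH[OF Suc.prems(1)], of c q] by (simp add: mult.assoc)
  qed (auto simp del: ipow.simps simp: distrib_left intro: ipow_add)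
qed

lemma ipow_Suc_subset: "ipow (Suc n) \<subseteq> ipow n"
proof
  fix x assume "x \<in> ipow (Suc n)"
  then have "x \<in> asum {a * b |a b. a \<in> ipow n \<and> b \<in> Q}" by simp
  then show "x \<in> ipow n"
  proof induction
    case (asum_gen g)
    then obtain a b where "g = a * b" "a \<in> ipow n" "b \<in> S" using Q_subset by blast
    then show ?case using ipow_smult[of b a n] by (simp add: mult.commute)
  qed (auto intro: ipow_add)
qed

lemma ipow_antimono: "m \<le> n \<Longrightarrow> ipow n \<subseteq> ipow m"
  by (induction n rule: dec_induct) (use ipow_Suc_subset in blast)+

lemma Q_ipow1: "b \<in> Q \<Longrightarrow> b \<in> ipow 1"
  using ipow_Suc_mult[of 1 0 b] by simp

lemma ipow_prod: "finite I \<Longrightarrow> (\<And>i. i \<in> I \<Longrightarrow> F i \<in> ipow (n i)) \<Longrightarrow> prod F I \<in> ipow (sum n I)"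
  by (induction I rule: finite_induct) (auto simp del: ipow.simps simp: ipow.simps(1) intro: ipow_mult)

lemma ipow_power: "a \<in> ipow n \<Longrightarrow> a ^ k \<in> ipow (k * n)"
  by (induction k) (auto simp: ipow_mult)

lemma symb_subset: "symb n \<subseteq> S"
  by (auto simp: symb_def)

lemma ipow_symb: "ipow n \<subseteq> symb n"
  using ipow_subset by (force simp: symb_def intro: bexI[of _ 1])

lemma symb_0: "symb 0 = S"
  using ipow_symb[of 0] symb_subset[of 0] by auto

lemma symb_add: "a \<in> symb n \<Longrightarrow> b \<in> symb n \<Longrightarrow> a + b \<in> symb n"
proof -
  assume "a \<in> symb n" "b \<in> symb n"
  then obtain s t where *: "a \<in> S" "b \<in> S" "s \<in> S - Q" "t \<in> S - Q" "s * a \<in> ipow n" "t * b \<in> ipow n"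
    by (auto simp: symb_def)
  have "(s * t) * (a + b) = t * (s * a) + s * (t * b)" by (simp add: algebra_simps)
  also have "\<dots> \<in> ipow n"
    using ipow_add[OF ipow_smult[of t "s * a" n] ipow_smult[of s "t * b" n]] * by simp
  finally show ?thesis using * compl_mult[of s t] by (auto simp: symb_def)
qed

lemma symb_mult: "a \<in> symb n \<Longrightarrow> b \<in> symb m \<Longrightarrow> a * b \<in> symb (n + m)"
proof -
  assume "a \<in> symb n" "b \<in> symb m"
  then obtain s t where *: "a \<in> S" "b \<in> S" "s \<in> S - Q" "t \<in> S - Q" "s * a \<in> ipow n" "t * b \<in> ipow m"
    by (auto simp: symb_def)
  have "(s * t) * (a * b) = (s * a) * (t * b)" by (simp add: algebra_simps)
  also have "\<dots> \<in> ipow (n + m)" using * by (intro ipow_mult)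
  finally show ?thesis using * compl_mult[of s t] by (auto simp: symb_def)
qed

lemma symb_smult: "a \<in> S \<Longrightarrow> b \<in> symb m \<Longrightarrow> a * b \<in> symb m"
  using symb_mult[of a 0 b m] by (simp add: symb_0)

lemma symb_uminus: "b \<in> symb m \<Longrightarrow> - b \<in> symb m"
  using symb_smult[OF S_uminus[OF S_1], of b m] by simp

lemma symb_antimono: "m \<le> n \<Longrightarrow> symb n \<subseteq> symb m"
  using ipow_antimono[of m n] by (auto simp: symb_def)

lemma symb_0_mem [simp]: "0 \<in> symb n"
  using ipow_symb[of n] by auto

lemma symb_sum: "(\<And>i. i \<in> I \<Longrightarrow> F i \<in> symb n) \<Longrightarrow> sum F I \<in> symb n"
  by (induction I rule: infinite_finite_induct) (auto intro: symb_add)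

lemma symb_prod: "finite I \<Longrightarrow> (\<And>i. i \<in> I \<Longrightarrow> F i \<in> symb (n i)) \<Longrightarrow> prod F I \<in> symb (sum n I)"
  by (induction I rule: finite_induct) (auto simp: symb_0 intro: symb_mult)

lemma symb_power: "a \<in> symb n \<Longrightarrow> a ^ k \<in> symb (k * n)"
  by (induction k) (auto simp: symb_0 symb_mult)

lemma symb_cancel: "s \<in> S - Q \<Longrightarrow> a \<in> S \<Longrightarrow> s * a \<in> symb n \<Longrightarrow> a \<in> symb n"
proof -
  assume *: "s \<in> S - Q" "a \<in> S" "s * a \<in> symb n"
  then obtain t where "t \<in> S - Q" "t * (s * a) \<in> ipow n" by (auto simp: symb_def)
  then have "t * s \<in> S - Q" "(t * s) * a \<in> ipow n" using * compl_mult[of t s] by (auto simp: mult.assoc)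
  then show ?thesis using *(2) unfolding symb_def by blast
qed

section \<open>Minors of a matrix and symbolic powers\<close>

definition dm :: "('i \<Rightarrow> 'j \<Rightarrow> 'a) \<Rightarrow> (nat \<Rightarrow> 'i) \<Rightarrow> (nat \<Rightarrow> 'j) \<Rightarrow> nat \<Rightarrow> 'a" where
  "dm N f g m = Determinant.det (mat m m (\<lambda>(i, j). N (f i) (g j)))"

lemma dm_expand:
  "dm N f g m = (\<Sum>p\<in>{p. p permutes {0..<m}}. of_int (sign p) * (\<Prod>i<m. N (f i) (g (p i))))"
proof -
  have "dm N f g m = (\<Sum>p\<in>{p. p permutes {0..<m}}. of_int (sign p) *
      (\<Prod>i = 0..<m. mat m m (\<lambda>(i, j). N (f i) (g j)) $$ (i, p i)))"
    unfolding dm_def by (rule det_def') simp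
  also have "\<dots> = (\<Sum>p\<in>{p. p permutes {0..<m}}. of_int (sign p) * (\<Prod>i<m. N (f i) (g (p i))))"
  proof (rule sum.cong[OF refl])
    fix p assume "p \<in> {p. p permutes {0..<m}}"
    then have "p i < m" if "i < m" for i using that permutes_in_image[of p "{0..<m}" i] by auto
    then show "of_int (sign p) * (\<Prod>i = 0..<m. mat m m (\<lambda>(i, j). N (f i) (g j)) $$ (i, p i)) =
      of_int (sign p) * (\<Prod>i<m. N (f i) (g (p i)))"
      by (auto intro!: arg_cong2[of _ _ _ _ "(*)"] prod.cong simp: atLeast0LessThan)
  qed
  finally show ?thesis .
qed

lemma dm_in_S: "(\<And>i j. i < m \<Longrightarrow> j < m \<Longrightarrow> N (f i) (g j) \<in> S) \<Longrightarrow> dm N f g m \<in> S"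
  unfolding dm_expand
proof (intro S_sum S_mult S_of_int S_prod)
  fix p i assume *: "\<And>i j. i < m \<Longrightarrow> j < m \<Longrightarrow> N (f i) (g j) \<in> S" "p \<in> {p. p permutes {0..<m}}" "i \<in> {..<m}"
  then show "N (f i) (g (p i)) \<in> S" using permutes_in_image[of p "{0..<m}" i] by auto
qed

lemma dm_in_ipow: "(\<And>i j. i < m \<Longrightarrow> j < m \<Longrightarrow> N (f i) (g j) \<in> Q) \<Longrightarrow> dm N f g m \<in> ipow m"
  unfolding dm_expand
proof (intro ipow_sum ipow_smult S_of_int)
  fix p assume *: "\<And>i j. i < m \<Longrightarrow> j < m \<Longrightarrow> N (f i) (g j) \<in> Q" "p \<in> {p. p permutes {0..<m}}"
  have "N (f i) (g (p i)) \<in> ipow 1" if "i \<in> {..<m}" for i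
    using * that permutes_in_image[of p "{0..<m}" i] by (intro Q_ipow1) auto
  then show "(\<Prod>i<m. N (f i) (g (p i))) \<in> ipow m"
    using ipow_prod[of "{..<m}" "\<lambda>i. N (f i) (g (p i))" "\<lambda>_. 1"] by simp
qed

lemma dm_swap_rows:
  assumes "i < m" "j < m"
  shows "dm N (f \<circ> Transposition.transpose i j) g m \<in> {dm N f g m, - dm N f g m}"
proof -
  let ?t = "Transposition.transpose i j"
  have p: "?t permutes {0..<m}" using assms by (intro permutes_swap_id) auto
  have "?t k < m" if "k < m" for k using that permutes_in_image[OF p, of k] by auto
  then have eq: "mat m m (\<lambda>(i, j). mat m m (\<lambda>(i, j). N (f i) (g j)) $$ (?t i, j)) =
      mat m m (\<lambda>(i, j). N ((f \<circ> ?t) i) (g j))"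
    by (intro eq_matI) auto
  have "dm N (f \<circ> ?t) g m = of_int (sign ?t) * dm N f g m"
    unfolding dm_def eq[symmetric] by (rule det_permute_rows[OF _ p]) simp
  then show ?thesis by (cases "evenperm ?t") (simp_all add: sign_def)
qed

lemma dm_transpose: "dm N f g m = dm (\<lambda>j i. N i j) g f m"
proof -
  have "mat m m (\<lambda>(i, j). N (f j) (g i)) = (mat m m (\<lambda>(i, j). N (f i) (g j)))\<^sup>T"
    by (intro eq_matI) auto
  then show ?thesis unfolding dm_def using Determinant.det_transpose[of "mat m m (\<lambda>(i, j). N (f i) (g j))" m] by simp
qed

text \<open>Chio condensation, obtained by clearing the first row of the left factor.\<close>
lemma chio:
  fixes N :: "'i \<Rightarrow> 'j \<Rightarrow> 'a"
  assumes a_def: "a = N (f 0) (g 0)"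
  shows "dm N f g (Suc m) * a ^ m =
    a * dm (\<lambda>i j. a * N i j - N i (g 0) * N (f 0) j) (f \<circ> Suc) (g \<circ> Suc) m"
proof -
  define M where "M = mat (Suc m) (Suc m) (\<lambda>(i, j). N (f i) (g j))"
  define P where "P = mat (Suc m) (Suc m) (\<lambda>(i, j). if i = 0 then (if j = 0 then 1 else - N (f 0) (g j))
      else if i = j then a else 0)"
  define T where "T = mat (Suc m) (Suc m) (\<lambda>(i, j). if j = 0 then N (f i) (g 0)
      else a * N (f i) (g j) - N (f i) (g 0) * N (f 0) (g j))"
  have carr: "M \<in> carrier_mat (Suc m) (Suc m)" "P \<in> carrier_mat (Suc m) (Suc m)" "T \<in> carrier_mat (Suc m) (Suc m)"
    by (simp_all add: M_def P_def T_def)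
  have "Determinant.det P = prod_list (diag_mat P)"
    by (rule det_upper_triangular[OF _ carr(2)]) (auto simp: upper_triangular_def P_def)
  also have "\<dots> = (\<Prod>i = 0..<Suc m. if i = 0 then 1 else a)"
    unfolding diag_mat_def prod.list_conv_set_nth by (intro prod.cong) (auto simp: P_def simp del: upt_Suc)
  also have "\<dots> = a ^ m" by (subst prod.atLeast0_lessThan_Suc_shift) simp
  finally have detP: "Determinant.det P = a ^ m" .
  have "M * P = T"
  proof (rule eq_matI)
    fix i j assume "i < dim_row T" "j < dim_col T"
    then have ij: "i < Suc m" "j < Suc m" by (simp_all add: T_def)
    then have "(M * P) $$ (i, j) = (\<Sum>r = 0..<Suc m. M $$ (i, r) * P $$ (r, j))"
      by (simp add: scalar_prod_def M_def P_def)
    also have "\<dots> = (\<Sum>r\<in>{0, j}. M $$ (i, r) * P $$ (r, j))"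
      using ij by (intro sum.mono_neutral_right) (auto simp: P_def)
    finally show "(M * P) $$ (i, j) = T $$ (i, j)"
      using ij by (cases "j = 0") (auto simp: algebra_simps M_def P_def T_def)
  qed (simp_all add: M_def P_def T_def)
  moreover have "Determinant.det T = a * Determinant.det (mat_delete T 0 0)"
  proof -
    have "Determinant.det T = (\<Sum>j<Suc m. T $$ (0, j) * cofactor T 0 j)"
      by (rule laplace_expansion_row[OF carr(3)]) simp
    also have "\<dots> = (\<Sum>j\<in>{0}. T $$ (0, j) * cofactor T 0 j)"
      by (intro sum.mono_neutral_right) (auto simp: T_def a_def)
    also have "\<dots> = a * Determinant.det (mat_delete T 0 0)"
      by (simp add: T_def a_def cofactor_def)
    finally show ?thesis .
  qed
  moreover have "mat_delete T 0 0 =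
      mat m m (\<lambda>(i, j). a * N (f (Suc i)) (g (Suc j)) - N (f (Suc i)) (g 0) * N (f 0) (g (Suc j)))"
    by (rule eq_matI) (simp_all add: mat_delete_def T_def)
  ultimately show ?thesis
    using det_mult[OF carr(1,2)] detP by (simp add: dm_def M_def)
qed

text \<open>A matrix of rank at most r modulo the prime has its m-minors in the symbolic power of
  exponent m - r. If all entries lie in \<open>Q\<close>, expansion gives the ordinary power.
  Otherwise some entry is a unit at \<open>Q\<close>; condensation at this entry lowers both the
  rank and the size by one, and powers of the entry cancel because they lie outside
  \<open>Q\<close>.\<close>

lemma dm_in_symb:
  assumes "\<And>i j. i \<in> A \<Longrightarrow> j \<in> B \<Longrightarrow> N i j \<in> S"
    and "\<And>f g. (\<And>i. i < Suc r \<Longrightarrow> f i \<in> A) \<Longrightarrow> (\<And>i. i < Suc r \<Longrightarrow> g i \<in> B) \<Longrightarrow> dm N f g (Suc r) \<in> Q"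
    and "\<And>i. i < m \<Longrightarrow> f i \<in> A" "\<And>i. i < m \<Longrightarrow> g i \<in> B"
  shows "dm N f g m \<in> symb (m - r)"
  using assms
proof (induction r arbitrary: N m f g)
  case 0
  have "N i j \<in> Q" if "i \<in> A" "j \<in> B" for i j
    using 0(2)[of "\<lambda>_. i" "\<lambda>_. j"] that by (simp add: dm_def det_single)
  then have "dm N f g m \<in> ipow m" using 0(3,4) by (intro dm_in_ipow) auto
  then show ?case using ipow_symb by auto
next
  case (Suc r)
  show ?case
  proof (cases "\<forall>i<m. \<forall>j<m. N (f i) (g j) \<in> Q")
    case True
    then have "dm N f g m \<in> ipow m" by (intro dm_in_ipow) auto
    then show ?thesis using ipow_symb symb_antimono[of "m - Suc r" m] by auto
  next
    case False
    then obtain i0 j0 where ij: "i0 < m" "j0 < m" and nQ: "N (f i0) (g j0) \<notin> Q" by auto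
    then obtain m' where m: "m = Suc m'" by (cases m) auto
    \<comment> \<open>The pivot is moved to the corner by one row swap and one column swap, which
      change the minor only by a sign.\<close>
    define f1 g1 where "f1 = f \<circ> Transposition.transpose 0 i0" and "g1 = g \<circ> Transposition.transpose 0 j0"
    define a where "a = N (f1 0) (g1 0)"
    define N' where "N' = (\<lambda>i j. a * N i j - N i (g1 0) * N (f1 0) j)"
    have a: "a \<in> S - Q" using nQ ij Suc.prems(1,3,4) by (simp add: a_def f1_def g1_def)
    have f1: "f1 i \<in> A" "g1 i \<in> B" if "i < m" for i
      using that Suc.prems(3,4) ij by (auto simp: f1_def g1_def transpose_def)
    have fg0: "f1 0 \<in> A" "g1 0 \<in> B" using f1[of 0] m by auto
    have N'S: "N' i j \<in> S" if "i \<in> A" "j \<in> B" for i j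
      using that a fg0 Suc.prems(1) by (auto simp: N'_def)
    have "dm N' h k (Suc r) \<in> Q" if h: "\<And>i. i < Suc r \<Longrightarrow> h i \<in> A" and k: "\<And>i. i < Suc r \<Longrightarrow> k i \<in> B" for h k
    proof -
      \<comment> \<open>Bordering a minor of \<open>N'\<close> with the pivot row and column gives a
        minor of \<open>N\<close> that is one larger, so condensation read backwards transfers the
        rank hypothesis.\<close>
      define h' k' where "h' = case_nat (f1 0) h" and "k' = case_nat (g1 0) k"
      have "a * dm N' h k (Suc r) = dm N h' k' (Suc (Suc r)) * a ^ Suc r"
        using chio[of a N h' k' "Suc r"] by (simp only: h'_def k'_def N'_def a_def comp_def nat.case)
      moreover have "dm N h' k' (Suc (Suc r)) \<in> Q"
        using h k fg0 by (intro Suc.prems(2)) (auto simp: h'_def k'_def split: nat.split)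
      ultimately have "a * dm N' h k (Suc r) \<in> Q"
        using Q_mult[of "a ^ Suc r", OF S_power] a by (simp only: mult.commute[of _ "a ^ Suc r"] Diff_iff)
      moreover have "dm N' h k (Suc r) \<in> S" using h k by (intro dm_in_S N'S)
      ultimately show ?thesis using Q_prime[of a] a by auto
    qed
    then have "dm N' (f1 \<circ> Suc) (g1 \<circ> Suc) m' \<in> symb (m' - r)"
      using f1 m N'S by (intro Suc.IH) (simp_all del: comp_apply, simp_all)
    then have "a * dm N' (f1 \<circ> Suc) (g1 \<circ> Suc) m' \<in> symb (m' - r)"
      using a by (intro symb_smult) auto
    then have "a ^ m' * dm N f1 g1 m \<in> symb (m' - r)"
      using chio[of a N f1 g1 m', OF a_def] by (simp only: m N'_def mult.commute[of "a ^ m'"])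
    moreover have "dm N f1 g1 m \<in> S"
      by (rule dm_in_S) (rule Suc.prems(1)[OF f1(1) f1(2)])
    ultimately have "dm N f1 g1 m \<in> symb (m' - r)"
      using symb_cancel[OF compl_power[OF a]] by blast
    moreover have "dm N f1 g m \<in> {dm N f1 g1 m, - dm N f1 g1 m}"
      using dm_swap_rows[OF _ ij(2), of 0 "\<lambda>j i. N i j" g f1] ij
      by (auto simp: g1_def dm_transpose[of N f1])
    moreover have "dm N f g m \<in> {dm N f1 g m, - dm N f1 g m}"
      using dm_swap_rows[OF _ ij(1), of 0 N f g] ij by (auto simp: f1_def)
    ultimately show ?thesis using symb_uminus m by auto
  qed
qed

end

subsection \<open>The ideal of a ladder\<close>

definition poly_part :: "('m \<Rightarrow> bool) \<Rightarrow> ('m \<Rightarrow>\<^sub>0 'k) \<Rightarrow> ('m \<Rightarrow>\<^sub>0 'k::ab_group_add)" where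
  "poly_part P f = (\<Sum>m\<in>{m\<in>keys f. P m}. single m (lookup f m))"

lemma lookup_poly_part: "lookup (poly_part P f) m = (if P m then lookup f m else 0)"
proof -
  have "lookup (poly_part P f) m = (\<Sum>e\<in>{m\<in>keys f. P m}. if e = m then lookup f e else 0)"
    unfolding poly_part_def lookup_sum by (rule sum.cong) (auto simp: lookup_single when_def)
  then show ?thesis by (auto simp: in_keys_iff)
qed

lemma keys_poly_part: "keys (poly_part P f) = {m\<in>keys f. P m}"
  by (auto simp: in_keys_iff lookup_poly_part split: if_splits)

definition Yord :: "int \<Rightarrow> (nat \<times> nat \<times> nat, 'k::comm_ring_1) mpol \<Rightarrow> bool" where
  "Yord n g \<longleftrightarrow> (\<forall>e\<in>keys g. n \<le> rank_ladder.Ydeg e)"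

section \<open>Order in the deformation indeterminates\<close>

context rank_ladder
begin

lemma Ydeg_nonneg: "0 \<le> Ydeg e"
  by (auto simp: Ydeg_def wt_def intro!: sum_nonneg)

lemma Ydeg_add: "Ydeg (e + e') = Ydeg e + Ydeg e'"
  by (simp add: Ydeg_def wt_add)

lemma Yord_0 [simp]: "Yord n 0" by (simp add: Yord_def)

lemma Yord_any [simp]: "n \<le> 0 \<Longrightarrow> Yord n g"
  unfolding Yord_def using Ydeg_nonneg order_trans by blast

lemma Yord_add: "Yord n f \<Longrightarrow> Yord n g \<Longrightarrow> Yord n (f + g)"
  using keys_add[of f g] unfolding Yord_def by blast

lemma Yord_minus: "Yord n f \<Longrightarrow> Yord n g \<Longrightarrow> Yord n (f - g)"
  using keys_minus[of f g] unfolding Yord_def by blast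

lemma Yord_mult: "Yord n f \<Longrightarrow> Yord m g \<Longrightarrow> Yord (n + m) (f * g)"
  unfolding Yord_def by (auto dest!: subsetD[OF keys_mult] simp: Ydeg_add intro!: add_mono)

text \<open>The order in Y is a valuation: the product of the parts of lowest degree in Y does not
  vanish. A factor of order 0 therefore leaves the order unchanged, which is how denominators of
  symbolic powers are removed in \<open>symb_Yord\<close>.\<close>

lemma Yord_prime:
  fixes g h :: "(nat \<times> nat \<times> nat, 'k::field) mpol"
  assumes "\<not> Yord 1 g" and "\<not> Yord n h"
  shows "\<not> Yord n (g * h)"
proof -
  define b where "b = Min (Ydeg ` keys h)"
  have "h \<noteq> 0" using assms(2) by auto
  then have ne: "Ydeg ` keys h \<noteq> {}" by (auto simp: in_keys_iff poly_mapping_eq_iff fun_eq_iff)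
  have bmin: "b \<le> Ydeg e" if "e \<in> keys h" for e using that by (simp add: b_def)
  obtain eb where eb: "eb \<in> keys h" "Ydeg eb = b" using Min_in[OF _ ne] unfolding b_def by auto
  have bn: "b < n" using assms(2) bmin by (force simp: Yord_def)
  obtain e0 where e0: "e0 \<in> keys g" "Ydeg e0 = 0"
    using assms(1) Ydeg_nonneg unfolding Yord_def by (metis int_one_le_iff_zero_less le_less not_le)
  define g0 where "g0 = poly_part (\<lambda>e. Ydeg e = 0) g"
  define h0 where "h0 = poly_part (\<lambda>e. Ydeg e = b) h"
  have "lookup g0 e0 \<noteq> 0" "lookup h0 eb \<noteq> 0"
    using e0 eb by (auto simp: g0_def h0_def lookup_poly_part in_keys_iff)
  then have "g0 * h0 \<noteq> 0" by auto
  then obtain e where e: "e \<in> keys (g0 * h0)" by (auto simp: in_keys_iff poly_mapping_eq_iff fun_eq_iff)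
  then have Ye: "Ydeg e = b"
    by (auto dest!: subsetD[OF keys_mult] simp: Ydeg_add g0_def h0_def keys_poly_part)
  have g': "Yord 1 (g - g0)"
    unfolding Yord_def using Ydeg_nonneg
    by (auto simp: g0_def in_keys_iff lookup_minus lookup_poly_part split: if_splits) (metis int_one_le_iff_zero_less le_less)
  have h': "Yord (b + 1) (h - h0)"
    unfolding Yord_def using bmin
    by (auto simp: h0_def in_keys_iff lookup_minus lookup_poly_part split: if_splits) (metis zless_add1_eq le_less not_le)
  have hb: "Yord b h" using bmin by (simp add: Yord_def)
  have "g * h - g0 * h0 = (g - g0) * h + g0 * (h - h0)" by (simp add: algebra_simps)
  also have "Yord (b + 1) \<dots>"
    using Yord_mult[OF g' hb] Yord_mult[OF Yord_any[of 0 g0] h'] by (simp add: add.commute Yord_add)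
  finally have "e \<notin> keys (g * h - g0 * h0)" using Ye by (auto simp: Yord_def)
  then have "e \<in> keys (g * h)" using e by (auto simp: in_keys_iff lookup_minus)
  then show ?thesis using Ye bn unfolding Yord_def by (metis not_le)
qed

lemma deformed_minus_generic: "Yord 1 (poly_subst deformed_entry f - poly_subst generic_entry f)"
proof -
  have "f \<in> polys_in UNIV" by (simp add: polys_in_def)
  then show ?thesis
  proof (induction rule: polys_in_induct)
    case (var x)
    have "Ydeg (single (2, x) 1) = 1" by (simp add: Ydeg_def)
    then show ?case unfolding poly_subst_var deformed_entry_def by (simp add: Yord_def pvar_def)
  next
    case (add f g)
    then show ?case using Yord_add by (fastforce simp: poly_subst_add algebra_simps)
  next
    case (mult f g)
    let ?d = "poly_subst deformed_entry :: _ \<Rightarrow> (_, 'a) mpol" and ?g = "poly_subst generic_entry :: _ \<Rightarrow> (_, 'a) mpol"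
    have "?d (f * g) - ?g (f * g) = (?d f - ?g f) * ?d g + (?d g - ?g g) * ?g f"
      by (simp add: poly_subst_mult algebra_simps)
    moreover have "Yord (1 + 0) ((?d f - ?g f) * ?d g)" "Yord (1 + 0) ((?d g - ?g g) * ?g f)"
      by (intro Yord_mult mult Yord_any order_refl)+
    ultimately show ?case using Yord_add by fastforce
  qed simp
qed

lemma generic_Ydeg: "e \<in> keys (poly_subst generic_entry f) \<Longrightarrow> Ydeg e = 0"
proof -
  have "\<forall>e\<in>keys (poly_subst generic_entry f). Ydeg e = 0"
    if "f \<in> polys_in UNIV" for f :: "(nat \<times> nat, 'a) mpol"
    using that
  proof (induction rule: polys_in_induct)
    case (const c) then show ?case unfolding poly_subst_const by (auto simp: pconst_def Ydeg_def)
  next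
    case (var x)
    have *: "(pvar (0, r, fst x) * pvar (1, r, snd x) :: (_, 'a) mpol) =
      single (single (0, r, fst x) 1 + single (1, r, snd x) 1) 1" for r
      by (simp add: pvar_def mult_single)
    have "e \<in> (\<Union>r\<in>{1..<tau x}. keys (single (single (0, r, fst x) 1 + single (1, r, snd x) 1) (1::'a)))"
      if "e \<in> keys (poly_subst generic_entry (pvar x) :: (_, 'a) mpol)" for e
      using that unfolding poly_subst_var generic_entry_def *
      using keys_sum_subset[of "\<lambda>r. single (single (0, r, fst x) 1 + single (1, r, snd x) 1) (1::'a)" "{1..<tau x}"]
      by (rule rev_subsetD)
    then show ?case by (fastforce simp: Ydeg_def wt_add)
  next
    case (add f g)
    then show ?case using keys_add[of "poly_subst generic_entry f" "poly_subst generic_entry g"]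
      by (auto simp: poly_subst_add)
  next
    case (mult f g)
    then show ?case by (auto simp: poly_subst_mult Ydeg_add dest!: subsetD[OF keys_mult])
  qed
  then show "e \<in> keys (poly_subst generic_entry f) \<Longrightarrow> Ydeg e = 0"
    by (auto simp: polys_in_def)
qed

text \<open>The part of the deformation free of Y is the generic substitution, so \<open>Q\<close>
  is the contraction of the ideal generated by all Y. Its powers, and by the valuation property also
  its symbolic powers, go into powers of that ideal.\<close>

lemma Q_iff_Yord:
  fixes f :: "'k::field matrix_poly"
  assumes "f \<in> polys_in L"
  shows "f \<in> Q \<longleftrightarrow> Yord 1 (poly_subst deformed_entry f :: (_, 'k) mpol)"
proof
  assume "f \<in> Q"
  then show "Yord 1 (poly_subst deformed_entry f :: (_, 'k) mpol)"
    using deformed_minus_generic[of f] by (simp add: Q_def)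
next
  assume *: "Yord 1 (poly_subst deformed_entry f :: (_, 'k) mpol)"
  have "Yord 1 (poly_subst generic_entry f :: (_, 'k) mpol)"
    using Yord_minus[OF * deformed_minus_generic[of f]] by simp
  then have "keys (poly_subst generic_entry f :: (_, 'k) mpol) = {}"
    using generic_Ydeg unfolding Yord_def by fastforce
  then show "f \<in> Q" using assms by (simp add: Q_def)
qed

lemma prime_in_Q: "prime_in (polys_in L) (Q :: 'k::field matrix_poly set)"
  by unfold_locales (auto simp: Q_def poly_subst_add poly_subst_mult)

abbreviation symQ :: "nat \<Rightarrow> 'k::field matrix_poly set" where
  "symQ \<equiv> prime_in.symb (polys_in L) Q"

lemma ipow_Yord:
  "f \<in> prime_in.ipow (polys_in L) Q n \<Longrightarrow> Yord (int n) (poly_subst deformed_entry (f :: 'k::field matrix_poly) :: (_, 'k) mpol)"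
proof (induction n arbitrary: f)
  case (Suc n)
  then have "f \<in> asum {a * b |a b. a \<in> prime_in.ipow (polys_in L) Q n \<and> b \<in> Q}"
    by (simp add: prime_in.ipow.simps[OF prime_in_Q])
  then show ?case
  proof induction
    case (asum_gen g)
    then obtain a b where "g = a * b" "a \<in> prime_in.ipow (polys_in L) Q n" "b \<in> Q" by auto
    then show ?case
      using Yord_mult[OF Suc.IH[of a], of 1 "poly_subst deformed_entry b"] Q_iff_Yord[of b]
      by (auto simp: Q_def poly_subst_mult add.commute)
  qed (auto simp: poly_subst_add intro: Yord_add)
qed simp

lemma symb_Yord:
  fixes f :: "'k::field matrix_poly"
  assumes "f \<in> symQ n"
  shows "Yord (int n) (poly_subst deformed_entry f :: (_, 'k) mpol)"
proof -
  obtain s where s: "s \<in> polys_in L - Q" "s * f \<in> prime_in.ipow (polys_in L) Q n"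
    using assms by (auto simp: prime_in.symb_def[OF prime_in_Q])
  then have "\<not> Yord 1 (poly_subst deformed_entry s :: (_, 'k) mpol)" using Q_iff_Yord by auto
  then show ?thesis using Yord_prime ipow_Yord[OF s(2)] by (auto simp: poly_subst_mult)
qed

lemma symb_odeg:
  fixes f :: "'k::field matrix_poly"
  assumes "f \<in> symQ n" "face F" "top_monom m f"
  shows "n \<le> odeg F m"
proof -
  have "f \<in> polys_in L" using assms(1) prime_in.symb_subset[OF prime_in_Q] by blast
  then show ?thesis
    using deformed_top_monom[OF assms(2) _ assms(3)] symb_Yord[OF assms(1)] by (auto simp: Yord_def)
qed

text \<open>A chain is listed from its south-west end, so that the antidiagonal of its minor becomes a
  main diagonal.\<close>
definition chain :: "(nat \<Rightarrow> nat \<times> nat) \<Rightarrow> nat \<Rightarrow> bool" where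
  "chain c s \<longleftrightarrow> (\<forall>i<s. c i \<in> L) \<and> (\<forall>i j. i < j \<longrightarrow> j < s \<longrightarrow> ne (c i) (c j))"

definition cminor :: "(nat \<Rightarrow> nat \<times> nat) \<Rightarrow> nat \<Rightarrow> 'k::field matrix_poly" where
  "cminor c s = minor (fst \<circ> c) (snd \<circ> c) s"

definition cmon :: "(nat \<Rightarrow> nat \<times> nat) \<Rightarrow> nat \<Rightarrow> (nat \<times> nat \<Rightarrow>\<^sub>0 nat)" where
  "cmon c s = (\<Sum>i<s. single (c i) 1)"

lemma chain_rect:
  assumes "chain c s" "i < s" "j < s"
  shows "(fst (c i), snd (c j)) \<in> L" "fst (c i) \<le> fst (c 0)" "snd (c 0) \<le> snd (c j)"
proof -
  have ord: "fst (c j) \<le> fst (c i) \<and> snd (c i) \<le> snd (c j)" if "i \<le> j" "j < s" for i j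
    using assms(1) that unfolding chain_def ne_def by (metis le_less order_refl)
  show "fst (c i) \<le> fst (c 0)" "snd (c 0) \<le> snd (c j)" using ord assms by simp_all
  show "(fst (c i), snd (c j)) \<in> L"
    using ladder[of "fst (c (s - 1))" "snd (c (s - 1))" "fst (c 0)" "snd (c 0)" "fst (c i)" "snd (c j)"]
      ord[of 0 i] ord[of i "s - 1"] ord[of 0 j] ord[of j "s - 1"] assms
    by (auto simp: chain_def)
qed

lemma leading_cminor: "chain c s \<Longrightarrow> leading antidiag_wt (cmon c s) 1 (cminor c s :: 'k::field matrix_poly)"
  using leading_minor[of s "fst \<circ> c" "snd \<circ> c"] by (simp add: cminor_def cmon_def chain_def ne_def)

text \<open>The first position of a chain is the south-west corner of its rectangle, where
  \<open>tau\<close> is largest. Hence all minors of size \<open>tau (c 0)\<close> on the rectangle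
  lie in \<open>Q\<close>, and \<open>dm_in_symb\<close> applies.\<close>

lemma cminor_in_symb:
  assumes c: "chain c s" and s: "tau (c 0) \<le> s" "s > 0"
  shows "(cminor c s :: 'k::field matrix_poly) \<in> symQ (s - (tau (c 0) - 1))"
proof -
  let ?N = "\<lambda>i j. pvar (i, j) :: 'k matrix_poly"
  let ?A = "(fst \<circ> c) ` {..<s}" and ?B = "(snd \<circ> c) ` {..<s}"
  have c0: "c 0 \<in> L" using c s by (auto simp: chain_def)
  have AB: "(i, j) \<in> L \<and> tau (i, j) \<le> tau (c 0)" if "i \<in> ?A" "j \<in> ?B" for i j
  proof -
    have "(i, j) \<in> L" "i \<le> fst (c 0)" "snd (c 0) \<le> j" using that chain_rect[OF c] by auto
    then show ?thesis using tau_mono[of "fst (c 0)" "snd (c 0)" i j] c0 by auto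
  qed
  have "prime_in.dm ?N (fst \<circ> c) (snd \<circ> c) s \<in> symQ (s - (tau (c 0) - 1))"
  proof (rule prime_in.dm_in_symb[OF prime_in_Q, of ?A ?B])
    fix f g :: "nat \<Rightarrow> nat"
    assume "\<And>i. i < Suc (tau (c 0) - 1) \<Longrightarrow> f i \<in> ?A" "\<And>i. i < Suc (tau (c 0) - 1) \<Longrightarrow> g i \<in> ?B"
    then have "(minor f g (tau (c 0)) :: 'k matrix_poly) \<in> Q"
      using AB tau_pos[OF c0] by (intro minor_in_Q) auto
    then show "prime_in.dm ?N f g (Suc (tau (c 0) - 1)) \<in> Q"
      using tau_pos[OF c0] by (simp add: prime_in.dm_def[OF prime_in_Q] minor_def)
  qed (use AB in auto)
  then show ?thesis by (simp add: prime_in.dm_def[OF prime_in_Q] cminor_def minor_def)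
qed

lemma cminor_in_Q:
  assumes c: "chain c s" and s: "tau (c 0) \<le> s" "s > 0"
  shows "(cminor c s :: 'k::field matrix_poly) \<in> Q"
  unfolding cminor_def
proof (rule minor_in_Q)
  fix i j assume "i < s" "j < s"
  then show "((fst \<circ> c) i, (snd \<circ> c) j) \<in> L" "tau ((fst \<circ> c) i, (snd \<circ> c) j) \<le> s"
    using chain_rect[OF c, of i j] tau_mono[of "fst (c 0)" "snd (c 0)" "fst (c i)" "snd (c j)"] c s
    by (auto simp: chain_def)
qed (use s in auto)

lemma chain_length: "chain c s \<Longrightarrow> i < s \<Longrightarrow> fst (c i) + i \<le> fst (c 0)"
proof (induction i)
  case (Suc i)
  then have "ne (c i) (c (Suc i))" by (auto simp: chain_def)
  then show ?case using Suc by (auto simp: ne_def)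
qed simp

lemma chain_Cons:
  assumes "chain c s" "s > 0" "x \<in> L" "ne x (c 0)"
  shows "chain (case_nat x c) (Suc s)"
  unfolding chain_def
proof (intro conjI allI impI)
  fix i j assume ij: "i < j" "j < Suc s"
  then obtain j' where j: "j = Suc j'" "j' < s" by (cases j) auto
  show "ne (case_nat x c i) (case_nat x c j)"
  proof (cases i)
    case 0
    have "ne x (c j')"
    proof (cases "j' = 0")
      case False
      then have "ne (c 0) (c j')" using assms(1) j by (auto simp: chain_def)
      then show ?thesis using assms(4) ne_trans by blast
    qed (use assms in simp)
    then show ?thesis using 0 j by simp
  next
    case (Suc i') then show ?thesis using assms(1) ij j by (auto simp: chain_def)
  qed
qed (use assms in \<open>auto simp: chain_def split: nat.split\<close>)

text \<open>The length of the longest chain in \<open>F\<close> starting at a position is a natural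
  level function. If it is not admissible, some longest chain has length at least \<open>tau\<close>
  of its start; its first \<open>tau\<close> members are returned.\<close>

lemma not_face_chain:
  assumes FL: "F \<subseteq> L" and nf: "\<not> face F"
  obtains c where "chain c (tau (c 0))" "\<And>i. i < tau (c 0) \<Longrightarrow> c i \<in> F" "tau (c 0) > 0"
proof -
  define Ch where "Ch n x \<longleftrightarrow> (\<exists>c. chain c n \<and> (\<forall>i<n. c i \<in> F) \<and> n > 0 \<and> c 0 = x)" for n x
  define lam where "lam x = (GREATEST n. Ch n x)" for x
  have bound: "n \<le> Suc (fst x)" if ch: "Ch n x" for n x
  proof -
    obtain c where c: "chain c n" "n > 0" "c 0 = x" using ch unfolding Ch_def by blast
    then show ?thesis using chain_length[OF c(1), of "n - 1"] by simp
  qed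
  have Ch1: "Ch 1 x" if "x \<in> F" for x
    unfolding Ch_def using that FL by (intro exI[of _ "\<lambda>_. x"]) (auto simp: chain_def)
  have lam: "Ch (lam x) x" if "x \<in> F" for x
    unfolding lam_def by (rule GreatestI_nat[of "\<lambda>n. Ch n x" 1 "Suc (fst x)"]) (use bound Ch1[OF that] in auto)
  have lam_ge: "n \<le> lam x" if "Ch n x" for n x
    unfolding lam_def by (rule Greatest_le_nat[of "\<lambda>n. Ch n x" n "Suc (fst x)"]) (use that bound in auto)
  have "\<exists>x\<in>F. tau x \<le> lam x"
  proof (rule ccontr)
    assume "\<not> ?thesis"
    then have lt: "lam x < tau x" if "x \<in> F" for x using that by auto
    have "levels F lam"
      unfolding levels_def
    proof (intro ballI conjI impI)
      fix x assume x: "x \<in> F"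
      show "1 \<le> lam x" using lam_ge[OF Ch1[OF x]] .
      show "lam x < tau x" using lt[OF x] .
      fix y assume y: "y \<in> F" and xy: "ne x y"
      obtain c where c: "chain c (lam y)" "\<forall>i<lam y. c i \<in> F" "lam y > 0" "c 0 = y"
        using lam[OF y] by (auto simp: Ch_def)
      have "Ch (Suc (lam y)) x"
        unfolding Ch_def using c x xy FL
        by (intro exI[of _ "case_nat x c"]) (auto intro!: chain_Cons split: nat.split)
      then show "lam y < lam x" using lam_ge by fastforce
    qed
    then show False using nf FL by (auto simp: face_def)
  qed
  then obtain x where x: "x \<in> F" "tau x \<le> lam x" by auto
  obtain c where c: "chain c (lam x)" "\<forall>i<lam x. c i \<in> F" "c 0 = x"
    using lam[OF x(1)] by (auto simp: Ch_def)
  have "tau x > 0" using tau_pos[of x] x FL by auto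
  then show ?thesis using that[of c] c x by (auto simp: chain_def)
qed

lemma finite_keys_wt: "m \<in> keys f \<Longrightarrow> f \<in> polys_in L \<Longrightarrow> 0 \<le> wt antidiag_wt m"
  unfolding wt_def polys_in_def using antidiag_wt_pos by (fastforce intro!: sum_nonneg)

text \<open>After deformation an element of \<open>Q\<close> has no term free of Y, so the support
  of its top monomial cannot be a face.\<close>

lemma Q_monomial_chain:
  fixes f :: "'k::field matrix_poly"
  assumes "f \<in> Q" "top_monom m f"
  obtains c where "chain c (tau (c 0))" "\<And>i. i < tau (c 0) \<Longrightarrow> c i \<in> keys m" "tau (c 0) > 0"
proof -
  have f: "f \<in> polys_in L" using assms by (simp add: Q_def)
  then have mL: "keys m \<subseteq> L" using assms(2) by (auto simp: polys_in_def top_monom_def)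
  have nf: "\<not> face (keys m)"
  proof
    assume "face (keys m)"
    from deformed_top_monom[OF this f assms(2)] obtain e
      where "e \<in> keys (poly_subst deformed_entry f :: (_, 'k) mpol)" "Ydeg e = int (odeg (keys m) m)" by blast
    moreover have "odeg (keys m) m = 0" by (simp add: odeg_def in_keys_iff)
    moreover have "Yord 1 (poly_subst deformed_entry f :: (_, 'k) mpol)" using assms(1) f Q_iff_Yord by blast
    ultimately show False by (auto simp: Yord_def)
  qed
  from not_face_chain[OF mL nf] that show ?thesis by blast
qed

lemma lookup_cmon:
  assumes "chain c s"
  shows "lookup (cmon c s) x = (if x \<in> c ` {..<s} then 1 else 0)"
proof -
  have inj: "inj_on c {..<s}"
    using assms by (intro inj_onI) (metis chain_def lessThan_iff ne_def nat_neq_iff less_irrefl)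
  have "lookup (cmon c s) x = (\<Sum>i<s. if c i = x then 1 else 0)"
    unfolding cmon_def lookup_sum by (rule sum.cong) (auto simp: lookup_single when_def)
  also have "\<dots> = (\<Sum>y\<in>c ` {..<s}. if y = x then 1 else 0)"
    by (simp add: sum.reindex[OF inj])
  finally show ?thesis by simp
qed

lemma cmon_dvd:
  assumes "chain c s" "\<And>i. i < s \<Longrightarrow> c i \<in> keys m"
  obtains m' where "m = cmon c s + m'"
proof
  show "m = cmon c s + (m - cmon c s)"
    using assms lookup_cmon[OF assms(1)]
    by (intro poly_mapping_eqI) (auto simp: lookup_add lookup_minus in_keys_iff)
qed

lemma keys_add_subset: "m = a + b \<Longrightarrow> keys m \<subseteq> V \<Longrightarrow> keys b \<subseteq> V" for m :: "'x \<Rightarrow>\<^sub>0 nat"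
  by (auto simp: keys_add_nat)

text \<open>The minors of chains of length \<open>tau\<close> are a Groebner basis, hence generate \<open>Q\<close>.\<close>
theorem Q_subset_if_minors:
  fixes I :: "'k::field matrix_poly set"
  assumes I0: "0 \<in> I" and Iadd: "\<And>f g. f \<in> I \<Longrightarrow> g \<in> I \<Longrightarrow> f + g \<in> I"
    and Imult: "\<And>f g. f \<in> polys_in L \<Longrightarrow> g \<in> I \<Longrightarrow> f * g \<in> I"
    and Iminor: "\<And>c. chain c (tau (c 0)) \<Longrightarrow> tau (c 0) > 0 \<Longrightarrow> cminor c (tau (c 0)) \<in> I"
  shows "Q \<subseteq> I"
proof -
  have "f \<in> I" if "f \<in> Q" "wt_less antidiag_wt (int N) f" for f :: "'k matrix_poly" and N
    using that
  proof (induction N arbitrary: f)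
    case 0
    then have "m \<notin> keys f" for m using finite_keys_wt[of m f] by (auto simp: wt_less_def Q_def)
    then have "keys f = {}" by blast
    then show ?case using I0 by simp
  next
    case (Suc N)
    \<comment> \<open>Top terms may tie, so all terms of weight \<open>N\<close> are cancelled in
      one round, each by its own multiple of a minor.\<close>
    define K where "K = {m\<in>keys f. wt antidiag_wt m = int N}"
    have fin: "finite K" by (simp add: K_def)
    have fS: "f \<in> polys_in L" using Suc.prems by (simp add: Q_def)
    have "\<exists>h\<in>I. h \<in> Q \<and> leading antidiag_wt m 1 h" if m: "m \<in> K" for m
    proof -
      have "top_monom m f" using m Suc.prems(2) by (auto simp: top_monom_def K_def wt_less_def)
      then obtain c where c: "chain c (tau (c 0))" "\<And>i. i < tau (c 0) \<Longrightarrow> c i \<in> keys m" "tau (c 0) > 0"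
        using Q_monomial_chain[OF Suc.prems(1)] by blast
      then obtain m' where m': "m = cmon c (tau (c 0)) + m'" using cmon_dvd by blast
      have "keys m \<subseteq> L" using m fS by (auto simp: K_def polys_in_def)
      then have m'S: "(single m' 1 :: 'k matrix_poly) \<in> polys_in L"
        using keys_add_subset[OF m'] by (intro polys_in_single)
      let ?h = "single m' 1 * cminor c (tau (c 0)) :: 'k matrix_poly"
      have "?h \<in> I" using Imult[OF m'S] Iminor c by blast
      moreover have "?h \<in> Q" using prime_in.Q_mult[OF prime_in_Q m'S] cminor_in_Q c by blast
      moreover have "leading antidiag_wt m 1 ?h"
        using leading_mult[OF leading_single leading_cminor[OF c(1)], of m' 1] m' by (simp add: add.commute)
      ultimately show ?thesis by blast
    qed
    then obtain h where h: "\<And>m. m \<in> K \<Longrightarrow> h m \<in> I" "\<And>m. m \<in> K \<Longrightarrow> h m \<in> Q" "\<And>m. m \<in> K \<Longrightarrow> leading antidiag_wt m 1 (h m)"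
      by metis
    define t where "t = (\<Sum>m\<in>K. pconst (lookup f m) * h m)"
    have tI: "t \<in> I" unfolding t_def using fin h(1)
      by (induction K) (auto intro!: I0 Iadd Imult)
    have tQ: "t \<in> Q" unfolding t_def using fin h(2)
      by (induction K) (auto intro!: prime_in.Q_0[OF prime_in_Q] prime_in.Q_add[OF prime_in_Q] prime_in.Q_mult[OF prime_in_Q])
    have "f - t \<in> Q" using Suc.prems(1) tQ by (auto simp: Q_def poly_subst_minus)
    moreover have "wt_less antidiag_wt (int N) (f - t)"
    proof -
      have "f - t = (f - (\<Sum>m\<in>K. single m (lookup f m))) - (\<Sum>m\<in>K. pconst (lookup f m) * h m - single m (lookup f m))"
        by (simp add: t_def sum_subtractf)
      moreover have "wt_less antidiag_wt (int N) (f - (\<Sum>m\<in>K. single m (lookup f m)))"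
      proof -
        have "(\<Sum>m\<in>K. single m (lookup f m)) = poly_part (\<lambda>m. wt antidiag_wt m = int N) f"
          by (simp add: poly_part_def K_def)
        moreover have "wt antidiag_wt e < int N" if "e \<in> keys (f - poly_part (\<lambda>m. wt antidiag_wt m = int N) f)" for e
        proof -
          have "e \<in> keys f" "wt antidiag_wt e \<noteq> int N"
            using that by (auto simp: in_keys_iff lookup_minus lookup_poly_part split: if_splits)
          then show ?thesis using Suc.prems(2) by (force simp: wt_less_def)
        qed
        ultimately show ?thesis by (simp add: wt_less_def)
      qed
      moreover have "wt_less antidiag_wt (int N) (pconst (lookup f m) * h m - single m (lookup f m))" if "m \<in> K" for m
        using leading_const_mult[OF h(3)[OF that], of "lookup f m"] that by (simp add: leading_def K_def)
      ultimately show ?thesis by (simp only: wt_less_minus wt_less_sum)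
    qed
    ultimately have "f - t \<in> I" by (rule Suc.IH)
    then show ?case using Iadd[OF _ tI] by fastforce
  qed
  moreover have "\<exists>N. wt_less antidiag_wt (int N) f" for f :: "'k matrix_poly"
  proof -
    have "wt_less antidiag_wt (int (\<Sum>m\<in>keys f. nat (wt antidiag_wt m) + 1)) f"
      unfolding wt_less_def
    proof
      fix e assume e: "e \<in> keys f"
      have "nat (wt antidiag_wt e) + 1 \<le> (\<Sum>m\<in>keys f. nat (wt antidiag_wt m) + 1)"
        using e by (intro member_le_sum) auto
      then show "wt antidiag_wt e < int (\<Sum>m\<in>keys f. nat (wt antidiag_wt m) + 1)" by linarith
    qed
    then show ?thesis by blast
  qed
  ultimately show ?thesis by blast
qed

end

subsection \<open>A chart in which the ideal is generated by as many elements as its height\<close>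

lemma det_in_polys:
  assumes "M \<in> carrier_mat s s" "\<And>i j. i < s \<Longrightarrow> j < s \<Longrightarrow> M $$ (i, j) \<in> polys_in V"
  shows "Determinant.det M \<in> polys_in V"
  unfolding det_def'[OF assms(1)]
proof (intro polys_in_sum polys_in_mult polys_in_prod)
  fix p i assume *: "p \<in> {p. p permutes {0..<s}}" "i \<in> {0..<s}"
  then show "M $$ (i, p i) \<in> polys_in V" using permutes_in_image[of p "{0..<s}" i] assms(2) by auto
next
  fix p show "of_int (sign p) \<in> polys_in V"
    by (cases "evenperm p") (auto simp: sign_def)
qed

context rank_ladder
begin

lemma leading_top_monom:
  assumes "leading antidiag_wt m c f" "c \<noteq> 0"
  shows "top_monom m f"
proof -
  have "lookup f m = c" using leading_lookup[OF assms(1)] .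
  then show ?thesis using leading_keys[OF assms(1)] assms(2)
    by (auto simp: top_monom_def in_keys_iff) (metis in_keys_iff less_imp_le order_refl)
qed

lemma ex_top_monom: "f \<noteq> 0 \<Longrightarrow> \<exists>m. top_monom m f"
proof -
  assume "f \<noteq> 0"
  then have ne: "keys f \<noteq> {}" by (auto simp: in_keys_iff poly_mapping_eq_iff fun_eq_iff)
  have fin: "finite (wt antidiag_wt ` keys f)" "wt antidiag_wt ` keys f \<noteq> {}" using ne by auto
  obtain m where m: "m \<in> keys f" "wt antidiag_wt m = Max (wt antidiag_wt ` keys f)" using Max_in[OF fin] by auto
  then have "wt antidiag_wt e \<le> wt antidiag_wt m" if "e \<in> keys f" for e using Max_ge[OF fin(1)] that by simp
  with m show ?thesis by (auto simp: top_monom_def)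
qed

lemma top_monom_not_in_Q:
  fixes f :: "'k::field matrix_poly"
  assumes "face F" "keys m \<subseteq> F" "top_monom m f"
  shows "f \<notin> Q"
proof
  assume Q: "f \<in> Q"
  then have f: "f \<in> polys_in L" by (simp add: Q_def)
  obtain e where "e \<in> keys (poly_subst deformed_entry f :: (_, 'k) mpol)" "Ydeg e = int (odeg F m)"
    using deformed_top_monom[OF assms(1) f assms(3)] by blast
  moreover have "odeg F m = 0"
    unfolding odeg_def using assms(2) by (intro sum.neutral) (auto simp: in_keys_iff)
  moreover have "Yord 1 (poly_subst deformed_entry f :: (_, 'k) mpol)" using Q f Q_iff_Yord by blast
  ultimately show False by (auto simp: Yord_def)
qed

text \<open>In other words, the indeterminates of a face are algebraically independent modulo
  \<open>Q\<close>.\<close>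

lemma face_poly_not_in_Q:
  fixes f :: "'k::field matrix_poly"
  assumes "face F" "f \<in> polys_in F" "f \<noteq> 0"
  shows "f \<notin> Q"
proof -
  obtain m where m: "top_monom m f" using ex_top_monom[OF assms(3)] by blast
  then have "keys m \<subseteq> F" using assms(2) by (auto simp: top_monom_def polys_in_def)
  then show ?thesis using top_monom_not_in_Q[OF assms(1) _ m] by blast
qed

text \<open>The largest size of a face in $\{(i, j), (i - 1, j + 1), \ldots\}$; the greedy choice of such
  faces on all antidiagonals is itself a face.\<close>
primrec face_rank :: "nat \<Rightarrow> nat \<Rightarrow> nat" where
  "face_rank 0 = (\<lambda>j. 0)"
| "face_rank (Suc i) = (\<lambda>j. if (Suc i, j) \<in> L then min (Suc (face_rank i (Suc j))) (tau (Suc i, j) - 1) else 0)"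

definition greedy_face :: "(nat \<times> nat) set" where
  "greedy_face = {x\<in>L. face_rank (fst x - 1) (Suc (snd x)) < tau x - 1}"

lemma L_Suc: "(i, j) \<in> L \<Longrightarrow> \<exists>i'. i = Suc i'"
  using L_subset by (cases i) auto

lemma face_rank_notin: "(i, j) \<notin> L \<Longrightarrow> face_rank i j = 0"
  by (cases i) auto

lemma face_rank_le: "face_rank i j \<le> tau (i, j) - 1"
  by (cases i) auto

text \<open>The greedy choice is made on each antidiagonal separately. This comparison between
  antidiagonals is what makes the ranks a level function on their union.\<close>

lemma face_rank_mono:
  "(i, j) \<in> L \<Longrightarrow> (i', j') \<in> L \<Longrightarrow> i' \<le> i \<Longrightarrow> j \<le> j' \<Longrightarrow> face_rank i' j' \<le> face_rank i j"
proof (induction i arbitrary: i' j j')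
  case (Suc b)
  obtain a where a: "i' = Suc a" using L_Suc Suc.prems by blast
  have t: "tau (i', j') \<le> tau (Suc b, j)" using tau_mono Suc.prems by blast
  have "face_rank a (Suc j') \<le> face_rank b (Suc j)"
  proof (cases "(a, Suc j') \<in> L")
    case True
    then have "(b, Suc j) \<in> L" using ladder[OF True Suc.prems(1), of b "Suc j"] Suc.prems a by simp
    then show ?thesis using Suc.IH True Suc.prems a by simp
  qed (simp add: face_rank_notin)
  then show ?case using t Suc.prems a by auto
qed auto

lemma greedy_face_subset: "greedy_face \<subseteq> L" by (auto simp: greedy_face_def)

lemma face_rank_step:
  assumes "(Suc i, j) \<in> L"
  shows "face_rank (Suc i) j = face_rank i (Suc j) + (if (Suc i, j) \<in> greedy_face then 1 else 0)"
proof -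
  have "face_rank i (Suc j) \<le> tau (Suc i, j) - 1"
  proof (cases "(i, Suc j) \<in> L")
    case True
    then show ?thesis using face_rank_le[of i "Suc j"] tau_mono[OF assms True] by simp
  qed (simp add: face_rank_notin)
  then show ?thesis using assms by (auto simp: greedy_face_def)
qed

lemma levels_greedy_face: "levels greedy_face (\<lambda>x. face_rank (fst x) (snd x))"
  unfolding levels_def
proof (intro ballI conjI impI)
  fix x assume x: "x \<in> greedy_face"
  then obtain i j where ij: "x = (Suc i, j)" "(Suc i, j) \<in> L" using greedy_face_subset L_Suc by (metis subsetD surj_pair)
  then have K: "face_rank (Suc i) j = face_rank i (Suc j) + 1" using face_rank_step x by simp
  then show "1 \<le> face_rank (fst x) (snd x)" using ij by simp
  show "face_rank (fst x) (snd x) < tau x" using face_rank_le[of "Suc i" j] tau_pos[OF ij(2)] ij by simp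
  fix y assume y: "y \<in> greedy_face" and xy: "ne x y"
  then have yL: "(fst y, snd y) \<in> L" and lt: "fst y \<le> i" "Suc j \<le> snd y" using greedy_face_subset ij by (auto simp: ne_def)
  then have "(i, Suc j) \<in> L" using ladder[OF yL ij(2), of i "Suc j"] by simp
  then show "face_rank (fst y) (snd y) < face_rank (fst x) (snd x)" using face_rank_mono[OF _ yL lt] K ij by simp
qed

lemma face_greedy_face: "face greedy_face"
  using greedy_face_subset levels_greedy_face by (auto simp: face_def)

text \<open>\<open>C\<close> counts the positions of \<open>F\<close> on an antidiagonal until it
  leaves \<open>L\<close>. The south-west-most counted position has a level at least this count, so
  the count stays below \<open>tau\<close> and is bounded by \<open>face_rank\<close>. Summing the
  excess of \<open>face_rank\<close> over \<open>C\<close> along antidiagonals compares the two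
  cardinalities.\<close>

lemma card_face_le:
  assumes "face F"
  shows "card (L - greedy_face) \<le> card (L - F)"
proof -
  obtain lam where FL: "F \<subseteq> L" and lam: "levels F lam" using assms by (auto simp: face_def)
  define C where "C = rec_nat (\<lambda>j::nat. 0::nat)
    (\<lambda>i r j. if (Suc i, j) \<in> L then r (Suc j) + (if (Suc i, j) \<in> F then 1 else 0) else 0)"
  have C0: "C 0 j = 0" and CS: "C (Suc i) j = (if (Suc i, j) \<in> L then C i (Suc j) + (if (Suc i, j) \<in> F then 1 else 0) else 0)" for i j
    by (simp_all add: C_def)
  have bound: "C i j = 0 \<or> (\<exists>y\<in>F. fst y \<le> i \<and> j \<le> snd y \<and> C i j \<le> lam y)" for i j
  proof (induction i arbitrary: j)
    case (Suc i)
    consider "C i (Suc j) = 0" | y where "y \<in> F" "fst y \<le> i" "Suc j \<le> snd y" "C i (Suc j) \<le> lam y"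
      using Suc.IH[of "Suc j"] by auto
    then show ?case
    proof cases
      case 1
      then show ?thesis using lam by (auto simp: CS levels_def intro!: bexI[of _ "(Suc i, j)"])
    next
      case 2
      show ?thesis
      proof (cases "(Suc i, j) \<in> F")
        case True
        then have "lam y < lam (Suc i, j)" using lam 2 by (auto simp: levels_def ne_def)
        then have "C (Suc i) j \<le> lam (Suc i, j)" using 2 by (simp add: CS)
        then show ?thesis using True by (intro disjI2 bexI[of _ "(Suc i, j)"]) auto
      next
        case False
        then show ?thesis using 2 by (intro disjI2 bexI[of _ y]) (auto simp: CS)
      qed
    qed
  qed (simp add: C0)
  have CK: "C i j \<le> face_rank i j" for i j
  proof (induction i arbitrary: j)
    case (Suc i)
    show ?case
    proof (cases "(Suc i, j) \<in> L")
      case True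
      have up: "face_rank i (Suc j) \<le> face_rank (Suc i) j" using face_rank_step[OF True] by simp
      show ?thesis
      proof (cases "(Suc i, j) \<in> F")
        case F: True
        have "C (Suc i) j \<le> tau (Suc i, j) - 1"
        proof -
          obtain y where y: "y \<in> F" "fst y \<le> Suc i" "j \<le> snd y" "C (Suc i) j \<le> lam y"
            using bound[of "Suc i" j] F True by (auto simp: CS)
          have "lam y < tau y" using lam y by (auto simp: levels_def)
          moreover have "tau y \<le> tau (Suc i, j)"
            using tau_mono[OF True, of "fst y" "snd y"] y FL by auto
          ultimately show ?thesis using y by simp
        qed
        then show ?thesis using F True Suc.IH[of "Suc j"] by (simp add: CS)
      next
        case False
        then show ?thesis using True Suc.IH[of "Suc j"] up by (simp add: CS)
      qed
    qed (simp add: CS)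
  qed (simp add: C0)
  define D where "D x = face_rank (fst x) (snd x) - C (fst x) (snd x)" for x
  define up where "up x = (fst x - 1, Suc (snd x))" for x :: "nat \<times> nat"
  \<comment> \<open>Moving one step along the antidiagonal changes \<open>D\<close> by the
    difference of the two membership indicators. Since \<open>up\<close> is injective and
    \<open>D\<close> vanishes outside \<open>L\<close>, the shifted sum of \<open>D\<close> is at
    most the sum itself, and only the cardinalities remain.\<close>
  have step: "D (up x) + (if x \<in> greedy_face then 1 else 0) = D x + (if x \<in> F then 1 else 0)" if x: "x \<in> L" for x
  proof -
    obtain i j where ij: "x = (Suc i, j)" using x L_Suc by (metis surj_pair)
    show ?thesis using x CK[of i "Suc j"] CK[of "Suc i" j] face_rank_step[of i j] CS[of i j] unfolding ij
      by (simp add: D_def up_def split: if_splits)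
  qed
  have "(\<Sum>x\<in>L. D (up x)) \<le> (\<Sum>x\<in>L. D x)"
  proof -
    have inj: "inj_on up L"
    proof (rule inj_onI)
      fix x y assume "x \<in> L" "y \<in> L" "up x = up y"
      then obtain i j i' j' where "x = (Suc i, j)" "y = (Suc i', j')" using L_Suc by (metis surj_pair)
      then show "x = y" using \<open>up x = up y\<close> by (simp add: up_def)
    qed
    have "(\<Sum>x\<in>L. D (up x)) = (\<Sum>y\<in>up ` L. D y)" using sum.reindex[OF inj, of D] by simp
    also have "\<dots> = (\<Sum>y\<in>up ` L \<inter> L. D y)"
      using finite_L by (intro sum.mono_neutral_right) (auto simp: D_def face_rank_notin)
    also have "\<dots> \<le> (\<Sum>y\<in>L. D y)" using finite_L by (intro sum_mono2) auto
    finally show ?thesis .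
  qed
  moreover have "(\<Sum>x\<in>L. D (up x)) + (\<Sum>x\<in>L. if x \<in> greedy_face then 1 else 0) = (\<Sum>x\<in>L. D x) + (\<Sum>x\<in>L. if x \<in> F then 1 else 0)"
    unfolding sum.distrib[symmetric] using step by (intro sum.cong) auto
  moreover have "(\<Sum>x\<in>L. if x \<in> greedy_face then 1 else 0) = card greedy_face" "(\<Sum>x\<in>L. if x \<in> F then 1 else 0) = card F"
    using finite_L FL greedy_face_subset by (simp_all add: sum.If_cases Int_absorb1)
  ultimately have "card F \<le> card greedy_face" by linarith
  then show ?thesis using finite_L FL greedy_face_subset by (simp add: card_Diff_subset finite_subset)
qed

lemma chain_Cons':
  assumes "chain c s" "x \<in> L" "\<And>i. i < s \<Longrightarrow> ne x (c i)"
  shows "chain (case_nat x c) (Suc s)"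
  using assms unfolding chain_def by (auto split: nat.split)

lemma face_rank_chain:
  "\<exists>c. chain c (face_rank i j) \<and> (\<forall>s<face_rank i j. c s \<in> greedy_face \<and> fst (c s) \<le> i \<and> j \<le> snd (c s))"
proof (induction i arbitrary: j)
  case (Suc i)
  obtain c where c: "chain c (face_rank i (Suc j))" "\<forall>s<face_rank i (Suc j). c s \<in> greedy_face \<and> fst (c s) \<le> i \<and> Suc j \<le> snd (c s)"
    using Suc.IH by blast
  consider "(Suc i, j) \<notin> L" | "(Suc i, j) \<in> L" "(Suc i, j) \<notin> greedy_face" | "(Suc i, j) \<in> greedy_face" "(Suc i, j) \<in> L"
    using greedy_face_subset by blast
  then show ?case
  proof cases
    case 1 then show ?thesis by (intro exI[of _ c]) (auto simp: chain_def)
  next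
    case 2
    then show ?thesis using face_rank_step[of i j] c by (intro exI[of _ c]) (auto simp del: face_rank.simps)
  next
    case 3
    then have "chain (case_nat (Suc i, j) c) (Suc (face_rank i (Suc j)))"
      using c by (intro chain_Cons') (auto simp: ne_def)
    then show ?thesis using face_rank_step[of i j] c 3
      by (intro exI[of _ "case_nat (Suc i, j) c"]) (auto simp del: face_rank.simps split: nat.split)
  qed
qed (simp add: chain_def)

text \<open>Besides \<open>x\<close> itself, these positions contain all entries of a minor whose
  chain starts at \<open>x\<close>. Such a minor is linear in \<open>x\<close>, which gives an order
  of elimination.\<close>

definition after :: "nat \<times> nat \<Rightarrow> (nat \<times> nat) set" where
  "after x = {y\<in>L. fst y \<le> fst x \<and> snd x \<le> snd y \<and> y \<noteq> x}"

lemma cminor_Cons_expand: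
  assumes c: "chain (case_nat x c) (Suc s)"
  obtains rho where "(cminor (case_nat x c) (Suc s) :: 'k::field matrix_poly) = pvar x * cminor c s + rho"
    "cminor c s \<in> (polys_in (after x) :: 'k matrix_poly set)" "rho \<in> polys_in (after x)"
proof -
  let ?c = "case_nat x c"
  define M where "M = mat (Suc s) (Suc s) (\<lambda>(i, j). pvar (fst (?c i), snd (?c j)) :: 'k matrix_poly)"
  have carr: "M \<in> carrier_mat (Suc s) (Suc s)" by (simp add: M_def)
  have ent: "(fst (?c i), snd (?c j)) \<in> after x" if "i < Suc s" "j < Suc s" "(i, j) \<noteq> (0, 0)" for i j
  proof -
    have "(fst (?c i), snd (?c j)) \<in> L" "fst (?c i) \<le> fst x" "snd x \<le> snd (?c j)"
      using chain_rect[OF c that(1,2)] by auto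
    moreover have "fst (?c i) < fst x \<or> snd x < snd (?c j)"
    proof (cases "i = 0")
      case True
      then have "ne (?c 0) (?c j)" using c that unfolding chain_def by blast
      then show ?thesis by (auto simp: ne_def)
    next
      case False
      then have "ne (?c 0) (?c i)" using c that unfolding chain_def by blast
      then show ?thesis by (auto simp: ne_def)
    qed
    ultimately show ?thesis unfolding after_def by (metis (mono_tags, lifting) CollectI fst_conv snd_conv less_irrefl)
  qed
  define rho where "rho = (\<Sum>j\<in>{1..<Suc s}. M $$ (0, j) * cofactor M 0 j)"
  have "(cminor ?c (Suc s) :: 'k matrix_poly) = Determinant.det M"
    by (simp add: cminor_def minor_def M_def)
  also have "\<dots> = (\<Sum>j<Suc s. M $$ (0, j) * cofactor M 0 j)"
    by (rule laplace_expansion_row[OF carr]) simp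
  also have "{..<Suc s} = insert 0 {1..<Suc s}" by auto
  also have "(\<Sum>j\<in>insert 0 {1..<Suc s}. M $$ (0, j) * cofactor M 0 j) = M $$ (0, 0) * cofactor M 0 0 + rho"
    by (simp add: rho_def)
  also have "M $$ (0, 0) = pvar x" by (simp add: M_def)
  also have "cofactor M 0 0 = cminor c s"
  proof -
    have "mat_delete M 0 0 = mat s s (\<lambda>(i, j). pvar (fst (c i), snd (c j)))"
      by (rule eq_matI) (simp_all add: mat_delete_def M_def)
    then show ?thesis by (simp add: cofactor_def cminor_def minor_def)
  qed
  finally have eq: "(cminor ?c (Suc s) :: 'k matrix_poly) = pvar x * cminor c s + rho" .
  have "(cminor c s :: 'k matrix_poly) \<in> polys_in (after x)"
    unfolding cminor_def
  proof (rule minor_in_polys)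
    fix i j assume "i < s" "j < s"
    then show "((fst \<circ> c) i, (snd \<circ> c) j) \<in> after x" using ent[of "Suc i" "Suc j"] by simp
  qed
  moreover have "rho \<in> polys_in (after x)"
    unfolding rho_def cofactor_def
  proof (intro polys_in_sum polys_in_mult polys_in_power)
    fix j assume j: "j \<in> {1..<Suc s}"
    then show "M $$ (0, j) \<in> polys_in (after x)" using ent[of 0 j] by (auto simp: M_def)
    show "Determinant.det (mat_delete M 0 j) \<in> polys_in (after x)"
    proof (rule det_in_polys[of _ s])
      fix i j' assume ij: "i < s" "j' < s"
      then have "mat_delete M 0 j $$ (i, j') = pvar (fst (?c (Suc i)), snd (?c (if j' < j then j' else Suc j')))"
        by (simp add: mat_delete_def M_def)
      also have "\<dots> \<in> polys_in (after x)" using ij by (intro polys_in_var ent) auto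
      finally show "mat_delete M 0 j $$ (i, j') \<in> polys_in (after x)" .
    qed (simp add: mat_delete_def M_def)
  qed (auto intro: polys_in_uminus)
  ultimately show ?thesis using that eq by blast
qed

text \<open>Outside the greedy face the greedy chain further along the antidiagonal already has
  length \<open>tau x - 1\<close>. Putting \<open>x\<close> in front gives a minor in
  \<open>Q\<close>, linear in \<open>x\<close>. Its coefficient is the minor of the greedy chain,
  which is not in \<open>Q\<close> because its leading monomial is supported on a face.\<close>

lemma chart_element:
  assumes "x \<in> L - greedy_face"
  shows "\<exists>y \<in> Q. \<exists>delta rho. (y :: 'k::field matrix_poly) = pvar x * delta + rho \<and>
    delta \<in> polys_in (after x) \<and> rho \<in> polys_in (after x) \<and> delta \<notin> Q"
proof -
  obtain i j where x: "x = (Suc i, j)" using assms L_Suc by (metis DiffD1 surj_pair)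
  have xL: "x \<in> L" and "tau x > 0" using assms tau_pos[of x] by auto
  have K: "Suc (face_rank i (Suc j)) = tau x"
    using assms face_rank_step[of i j] x \<open>tau x > 0\<close> by (auto simp: greedy_face_def)
  obtain c where c: "chain c (face_rank i (Suc j))" "\<forall>s<face_rank i (Suc j). c s \<in> greedy_face \<and> fst (c s) \<le> i \<and> Suc j \<le> snd (c s)"
    using face_rank_chain by blast
  have ch: "chain (case_nat x c) (Suc (face_rank i (Suc j)))"
    using c xL x by (intro chain_Cons') (auto simp: ne_def)
  obtain rho where rho: "(cminor (case_nat x c) (Suc (face_rank i (Suc j))) :: 'k matrix_poly) =
      pvar x * cminor c (face_rank i (Suc j)) + rho"
    "cminor c (face_rank i (Suc j)) \<in> (polys_in (after x) :: 'k matrix_poly set)" "rho \<in> polys_in (after x)"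
    using cminor_Cons_expand[OF ch] by blast
  have "(cminor (case_nat x c) (Suc (face_rank i (Suc j))) :: 'k matrix_poly) \<in> Q"
    using cminor_in_Q[OF ch] K by simp
  moreover have "(cminor c (face_rank i (Suc j)) :: 'k matrix_poly) \<notin> Q"
  proof (rule top_monom_not_in_Q[OF face_greedy_face])
    show "top_monom (cmon c (face_rank i (Suc j))) (cminor c (face_rank i (Suc j)) :: 'k matrix_poly)"
      using leading_top_monom[OF leading_cminor[OF c(1)]] by simp
    show "keys (cmon c (face_rank i (Suc j))) \<subseteq> greedy_face"
      using c lookup_cmon[OF c(1)] by (auto simp: in_keys_iff split: if_splits)
  qed
  ultimately show ?thesis using rho by blast
qed

text \<open>This is the height of \<open>Q\<close>: the indeterminates of the greedy face are
  independent modulo \<open>Q\<close>, and \<open>chart_element\<close> makes all others rational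
  functions of them.\<close>

definition height_Q :: nat where "height_Q = card (L - greedy_face)"

text \<open>Once nonzero polynomials in the indeterminates of the greedy face are inverted, the
  elements \<open>y x\<close> eliminate all other indeterminates. What remains of an element of
  \<open>Q\<close> is a polynomial on the face lying in \<open>Q\<close>, hence zero.\<close>

lemma chart_local_generators:
  obtains y :: "nat \<times> nat \<Rightarrow> 'k::field matrix_poly" where
    "\<And>x. x \<in> L - greedy_face \<Longrightarrow> y x \<in> Q"
    "\<And>g. g \<in> Q \<Longrightarrow> \<exists>s\<in>polys_in L - Q. s * g \<in> asum {a * y x |a x. a \<in> polys_in L \<and> x \<in> L - greedy_face}"
proof -
  interpret prime_in "polys_in L" "Q :: 'k matrix_poly set" by (rule prime_in_Q)
  obtain y delta rho where y: "\<And>x. x \<in> L - greedy_face \<Longrightarrow> y x \<in> (Q :: 'k matrix_poly set)"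
    "\<And>x. x \<in> L - greedy_face \<Longrightarrow> y x = pvar x * delta x + rho x"
    "\<And>x. x \<in> L - greedy_face \<Longrightarrow> delta x \<in> polys_in (after x)" "\<And>x. x \<in> L - greedy_face \<Longrightarrow> rho x \<in> polys_in (after x)"
    "\<And>x. x \<in> L - greedy_face \<Longrightarrow> delta x \<notin> Q"
    using chart_element by metis
  define Z where "Z = asum {a * y x |a x. a \<in> polys_in L \<and> x \<in> L - greedy_face}"
  have Zgen: "y x \<in> Z" if "x \<in> L - greedy_face" for x
    unfolding Z_def using that by (intro asum_gen CollectI exI[of _ 1] exI[of _ x]) auto
  have Zadd: "a + b \<in> Z" if "a \<in> Z" "b \<in> Z" for a b using that unfolding Z_def by (rule asum_add)
  have Z0: "0 \<in> Z" unfolding Z_def by (rule asum_0)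
  have Zmult: "s * z \<in> Z" if "s \<in> polys_in L" "z \<in> Z" for s z
    using that(2) unfolding Z_def
  proof (rule asum_mult)
    fix g assume "g \<in> {a * y x |a x. a \<in> polys_in L \<and> x \<in> L - greedy_face}"
    then obtain a x where "g = a * y x" "a \<in> polys_in L" "x \<in> L - greedy_face" by blast
    then have "s * g = (s * a) * y x" "s * a \<in> polys_in L" using that by (auto simp: mult.assoc)
    then show "s * g \<in> asum {a * y x |a x. a \<in> polys_in L \<and> x \<in> L - greedy_face}"
      using \<open>x \<in> L - greedy_face\<close> by (intro asum_gen) blast
  qed
  have Zuminus: "- z \<in> Z" if "z \<in> Z" for z using Zmult[of "- 1" z] that by auto
  have ZQ: "Z \<subseteq> Q"
  proof
    fix z assume "z \<in> Z" then show "z \<in> Q" unfolding Z_def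
      by induction (use y(1) in auto)
  qed
  have F0S: "polys_in greedy_face \<subseteq> (polys_in L :: 'k matrix_poly set)" using polys_in_mono[OF greedy_face_subset] .
  have aftS: "polys_in (after x) \<subseteq> (polys_in L :: 'k matrix_poly set)" for x
    by (intro polys_in_mono) (auto simp: after_def)
  \<comment> \<open>Modulo \<open>Z\<close> the polynomial \<open>g\<close> equals the fraction
    \<open>g0 / s\<close> in indeterminates of the face.\<close>
  define good where "good g \<longleftrightarrow> g \<in> polys_in L \<and>
    (\<exists>s\<in>polys_in greedy_face - {0}. \<exists>g0\<in>polys_in greedy_face. s * g - g0 \<in> Z)" for g
  have s_nQ: "s \<in> polys_in L - Q" if "s \<in> polys_in greedy_face - {0}" for s :: "'k matrix_poly"
    using face_poly_not_in_Q[OF face_greedy_face, of s] that subsetD[OF F0S, of s] by auto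
  have one: "1 \<in> polys_in greedy_face - {0 :: 'k matrix_poly}" by auto
  have gconst: "good (pconst c)" for c
    unfolding good_def using one Z0 by (intro conjI bexI[of _ 1] bexI[of _ "pconst c"]) auto
  have gF0: "good (pvar x)" if "x \<in> greedy_face" for x
    unfolding good_def using one Z0 that greedy_face_subset by (intro conjI bexI[of _ 1] bexI[of _ "pvar x"]) auto
  have gadd: "good (f + g)" and gmult: "good (f * g)" if "good f" "good g" for f g
  proof -
    obtain s f0 t g0 where *: "f \<in> polys_in L" "g \<in> polys_in L" "s \<in> polys_in greedy_face - {0}" "t \<in> polys_in greedy_face - {0}"
      "f0 \<in> polys_in greedy_face" "g0 \<in> polys_in greedy_face" "s * f - f0 \<in> Z" "t * g - g0 \<in> Z"
      using \<open>good f\<close> \<open>good g\<close> unfolding good_def by blast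
    have st: "s * t \<in> polys_in greedy_face - {0}" using * by auto
    have "(s * t) * (f + g) - (t * f0 + s * g0) = t * (s * f - f0) + s * (t * g - g0)"
      by (simp add: algebra_simps)
    also have "\<dots> \<in> Z" using * F0S by (intro Zadd Zmult) auto
    finally show "good (f + g)" unfolding good_def using * st
      by (intro conjI bexI[of _ "s * t"] bexI[of _ "t * f0 + s * g0"]) auto
    have "(s * t) * (f * g) - f0 * g0 = (t * g) * (s * f - f0) + f0 * (t * g - g0)"
      by (simp add: algebra_simps)
    also have "\<dots> \<in> Z" using * F0S by (intro Zadd Zmult) auto
    finally show "good (f * g)" unfolding good_def using * st
      by (intro conjI bexI[of _ "s * t"] bexI[of _ "f0 * g0"]) auto
  qed
  have gV: "good f" if "f \<in> polys_in V" "\<And>x. x \<in> V \<Longrightarrow> good (pvar x)" for f V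
    using that(1) by (induction rule: polys_in_induct) (auto intro: gconst gadd gmult that(2))
  have gvar: "good (pvar x)" if "x \<in> L" for x
    using that
  \<comment> \<open>The measure drops on \<open>after x\<close>, so \<open>delta x\<close> and
    \<open>rho x\<close> are already fractions on the face when \<open>x\<close> is
    eliminated.\<close>
  proof (induction "fst x + (nc - snd x)" arbitrary: x rule: less_induct)
    case less
    show ?case
    proof (cases "x \<in> greedy_face")
      case False
      then have x: "x \<in> L - greedy_face" using less.prems by simp
      have aft: "good (pvar y)" if "y \<in> after x" for y
      proof (rule less.hyps)
        have *: "y \<in> L" "fst y \<le> fst x" "snd x \<le> snd y" "y \<noteq> x" using that by (auto simp: after_def)
        then have "snd y \<le> nc" using L_subset by auto
        moreover have "fst y < fst x \<or> snd x < snd y" using * by (metis le_neq_implies_less prod.expand)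
        ultimately show "fst y + (nc - snd y) < fst x + (nc - snd x)" "y \<in> L" using * by auto
      qed
      obtain s1 d0 where d: "s1 \<in> polys_in greedy_face - {0}" "d0 \<in> polys_in greedy_face" "s1 * delta x - d0 \<in> Z"
        using gV[OF y(3)[OF x] aft] unfolding good_def by blast
      obtain s2 r0 where r: "s2 \<in> polys_in greedy_face - {0}" "r0 \<in> polys_in greedy_face" "s2 * rho x - r0 \<in> Z"
        using gV[OF y(4)[OF x] aft] unfolding good_def by blast
      \<comment> \<open>The numerator of \<open>delta x\<close> becomes part of the denominator of
        x. It is nonzero because \<open>delta x\<close> is not in \<open>Q\<close>.\<close>
      have "d0 \<noteq> 0"
      proof
        assume "d0 = 0"
        then have "s1 * delta x \<in> Q" using d ZQ by auto
        then show False using Q_prime[of s1 "delta x"] subsetD[OF aftS y(3)[OF x]] y(5)[OF x] s_nQ[OF d(1)] by auto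
      qed
      then have s: "s2 * d0 \<in> polys_in greedy_face - {0}" using d r by auto
      have "(s2 * d0) * pvar x - (- (s1 * r0)) =
          (s1 * s2) * y x + (- ((s2 * pvar x) * (s1 * delta x - d0)) + - (s1 * (s2 * rho x - r0)))"
        unfolding y(2)[OF x] by (simp add: algebra_simps)
      also have "\<dots> \<in> Z"
        using d r F0S x by (intro Zadd Zuminus Zmult Zgen) auto
      finally show ?thesis unfolding good_def using s d r x
        by (intro conjI bexI[of _ "s2 * d0"] bexI[of _ "- (s1 * r0)"]) (auto intro: polys_in_uminus)
    qed (rule gF0)
  qed
  have "\<exists>s\<in>polys_in L - Q. s * g \<in> Z" if g: "g \<in> Q" for g
  proof -
    have "good g" using gV[of g L] gvar g Q_subset by auto
    then obtain s g0 where s: "s \<in> polys_in greedy_face - {0}" "g0 \<in> polys_in greedy_face" "s * g - g0 \<in> Z"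
      unfolding good_def by blast
    have "g0 = s * g + - (s * g - g0)" by simp
    also have "\<dots> \<in> Q"
      using g s(1) subsetD[OF ZQ Zuminus[OF s(3)]] subsetD[OF F0S, of s] by (intro Q_add Q_mult) auto
    finally have "g0 = 0" using face_poly_not_in_Q[OF face_greedy_face s(2)] by auto
    then show ?thesis using s s_nQ by auto
  qed
  then show ?thesis using that y(1) unfolding Z_def by blast
qed

text \<open>Powers of \<open>Q\<close> are thus spanned, up to denominators, by monomials in
  \<open>height_Q\<close> many elements, which is the form needed for a pigeonhole count of
  exponents.\<close>

lemma chart_powers:
  obtains y :: "nat \<times> nat \<Rightarrow> 'k::field matrix_poly" where
    "\<And>x. x \<in> L - greedy_face \<Longrightarrow> y x \<in> Q"
    "\<And>N g. g \<in> prime_in.ipow (polys_in L) Q N \<Longrightarrow> \<exists>s\<in>polys_in L - Q.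
       s * g \<in> asum {a * (\<Prod>x\<in>L - greedy_face. y x ^ bt x) |a bt. a \<in> polys_in L \<and> (\<Sum>x\<in>L - greedy_face. bt x) = N}"
proof -
  interpret prime_in "polys_in L" "Q :: 'k matrix_poly set" by (rule prime_in_Q)
  obtain y :: "nat \<times> nat \<Rightarrow> 'k matrix_poly" where y: "\<And>x. x \<in> L - greedy_face \<Longrightarrow> y x \<in> Q"
    "\<And>g. g \<in> Q \<Longrightarrow> \<exists>s\<in>polys_in L - Q. s * g \<in> asum {a * y x |a x. a \<in> polys_in L \<and> x \<in> L - greedy_face}"
    using chart_local_generators by blast
  define G where "G N = {a * (\<Prod>x\<in>L - greedy_face. y x ^ bt x) |a bt. a \<in> polys_in L \<and> (\<Sum>x\<in>L - greedy_face. bt x) = N}" for N :: nat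
  have fin: "finite (L - greedy_face)" using finite_L by simp
  have GI: "a * (\<Prod>x\<in>L - greedy_face. y x ^ bt x) \<in> asum (G N)" if "a \<in> polys_in L" "(\<Sum>x\<in>L - greedy_face. bt x) = N" for a bt N
    unfolding G_def using that by (intro asum_gen) blast
  have Gmult: "s * g \<in> asum (G N)" if "s \<in> polys_in L" "g \<in> asum (G N)" for s g N
    using that(2)
  proof (rule asum_mult)
    fix g assume "g \<in> G N"
    then obtain a bt where "g = a * (\<Prod>x\<in>L - greedy_face. y x ^ bt x)" "a \<in> polys_in L" "(\<Sum>x\<in>L - greedy_face. bt x) = N"
      by (auto simp: G_def)
    then have "s * g = (s * a) * (\<Prod>x\<in>L - greedy_face. y x ^ bt x)" "s * a \<in> polys_in L"
      using that by (auto simp: mult.assoc)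
    then show "s * g \<in> asum (G N)" using GI[OF _ \<open>(\<Sum>x\<in>L - greedy_face. bt x) = N\<close>] by metis
  qed
  have Gy: "y x * g \<in> asum (G (Suc N))" if x: "x \<in> L - greedy_face" and "g \<in> asum (G N)" for x g N
    using that(2)
  proof (rule asum_mult)
    fix g assume "g \<in> G N"
    then obtain a bt where g: "g = a * (\<Prod>x\<in>L - greedy_face. y x ^ bt x)" "a \<in> polys_in L" "(\<Sum>x\<in>L - greedy_face. bt x) = N"
      by (auto simp: G_def)
    have "y x * g = a * (\<Prod>z\<in>L - greedy_face. y z ^ (bt(x := Suc (bt x))) z)"
      unfolding g(1) using x by (simp add: prod.remove[OF fin x] mult_ac)
    moreover have "(\<Sum>z\<in>L - greedy_face. (bt(x := Suc (bt x))) z) = Suc N"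
      using g(3) x by (simp add: sum.remove[OF fin x])
    ultimately show "y x * g \<in> asum (G (Suc N))" using GI[OF g(2)] by metis
  qed
  have "\<exists>s\<in>polys_in L - Q. s * g \<in> asum (G N)" if "g \<in> ipow N" for g N
    using that
  proof (induction N arbitrary: g)
    case 0
    have "g = g * (\<Prod>x\<in>L - greedy_face. y x ^ 0)" by simp
    then have "g \<in> G 0" using 0 unfolding G_def by (auto intro!: exI[of _ "\<lambda>_. 0"])
    then show ?case by (intro bexI[of _ 1]) (auto intro: asum_gen)
  next
    case (Suc N)
    then have "g \<in> asum {a * b |a b. a \<in> ipow N \<and> b \<in> Q}" by simp
    then show ?case
    proof induction
      case asum_0 show ?case by (intro bexI[of _ 1]) (auto intro: asum.asum_0)
    next
      case (asum_gen g)
      then obtain a b where ab: "g = a * b" "a \<in> ipow N" "b \<in> Q" by blast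
      obtain s where s: "s \<in> polys_in L - Q" "s * a \<in> asum (G N)" using Suc.IH[OF ab(2)] by blast
      obtain t where t: "t \<in> polys_in L - Q" "t * b \<in> asum {a * y x |a x. a \<in> polys_in L \<and> x \<in> L - greedy_face}"
        using y(2)[OF ab(3)] by blast
      have "(s * a) * (t * b) \<in> asum (G (Suc N))"
        using t(2)
      proof (rule asum_mult)
        fix g assume "g \<in> {a * y x |a x. a \<in> polys_in L \<and> x \<in> L - greedy_face}"
        then obtain a' x where "g = a' * y x" "a' \<in> polys_in L" "x \<in> L - greedy_face" by blast
        then show "(s * a) * g \<in> asum (G (Suc N))"
          using Gy[OF \<open>x \<in> L - greedy_face\<close> Gmult[OF \<open>a' \<in> polys_in L\<close> s(2)]] by (simp add: mult_ac)
      qed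
      then show ?case using compl_mult[OF s(1) t(1)] ab(1)
        by (intro bexI[of _ "s * t"]) (simp_all add: mult_ac)
    next
      case (asum_add g g')
      then obtain s t where st: "s \<in> polys_in L - Q" "s * g \<in> asum (G (Suc N))"
        "t \<in> polys_in L - Q" "t * g' \<in> asum (G (Suc N))" by blast
      have "(s * t) * (g + g') = t * (s * g) + s * (t * g')" by (simp add: algebra_simps)
      also have "\<dots> \<in> asum (G (Suc N))"
        using asum.asum_add[OF Gmult[OF _ st(2), of t] Gmult[OF _ st(4), of s]] st by simp
      finally show ?case using compl_mult[OF st(1,3)] by blast
    qed
  qed
  then show ?thesis using that y(1) unfolding G_def by blast
qed

end

subsection \<open>Traces of Frobenius\<close>

definition scl :: "nat \<Rightarrow> ('x \<Rightarrow>\<^sub>0 nat) \<Rightarrow> ('x \<Rightarrow>\<^sub>0 nat)" where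
  "scl q m = Poly_Mapping.map ((*) q) m"

lemma lookup_scl [simp]: "lookup (scl q m) x = q * lookup m x"
  by (simp add: scl_def map.rep_eq when_def)

lemma scl_add: "scl q (m + m') = scl q m + scl q m'"
  by (intro poly_mapping_eqI) (simp add: lookup_add algebra_simps)

lemma scl_0 [simp]: "scl q 0 = 0"
  by (intro poly_mapping_eqI) simp

lemma scl_Suc: "scl (Suc q) m = m + scl q m"
  by (intro poly_mapping_eqI) (simp add: lookup_add)

lemma scl_inj: "q > 0 \<Longrightarrow> scl q m = scl q m' \<Longrightarrow> m = m'"
  by (intro poly_mapping_eqI) (metis lookup_scl mult_cancel1 less_irrefl)

lemma keys_scl: "q > 0 \<Longrightarrow> keys (scl q m) = keys m"
  by (auto simp: in_keys_iff)

lemma wt_scl: "wt W (scl q m) = int q * wt W m"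
proof -
  have "wt W (scl q m) = (\<Sum>x\<in>keys m. int (lookup (scl q m) x) * W x)"
    by (rule wt_superset) (auto simp: in_keys_iff)
  then show ?thesis by (simp add: wt_def sum_distrib_left mult_ac)
qed

lemma single_power: "single m c ^ q = single (scl q m) (c ^ q)"
  for c :: "'k::comm_ring_1" and m :: "'x \<Rightarrow>\<^sub>0 nat"
proof (induction q)
  case 0
  have "scl 0 m = 0" by (intro poly_mapping_eqI) simp
  then show ?case by simp
qed (simp add: mult_single scl_Suc)

lemma CHAR_mpol: "CHAR(('x, 'k::comm_ring_1) mpol) = CHAR('k)"
proof (rule CHAR_eqI)
  have of_nat: "(of_nat n :: ('x, 'k) mpol) = pconst (of_nat n)" for n
    by (induction n) simp_all
  show "of_nat CHAR('k) = (0 :: ('x, 'k) mpol)" by (simp add: of_nat)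
  fix n assume "of_nat n = (0 :: ('x, 'k) mpol)"
  then have "lookup (of_nat n :: ('x, 'k) mpol) 0 = 0" by simp
  then show "CHAR('k) dvd n" by (simp add: lookup_of_nat of_nat_eq_0_iff_char_dvd)
qed

locale perfect_char =
  fixes p :: nat and ty :: "'k::field itself"
  assumes char_p: "CHAR('k) = p" and p_pos: "p > 0" and perfect: "surj (\<lambda>x::'k. x ^ p)"
begin

lemma prime_p: "Factorial_Ring.prime p"
  using prime_CHAR_semidom[where 'a = 'k] char_p p_pos by simp

lemma frob_add: "(a + b) ^ p ^ e = a ^ p ^ e + (b ^ p ^ e :: 'k)"
  by (rule freshmans_dream') (use prime_p char_p in simp_all)

lemma frob_add_mpol: "(a + b) ^ p ^ e = a ^ p ^ e + (b ^ p ^ e :: ('x, 'k) mpol)"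
  by (rule freshmans_dream') (use prime_p char_p in \<open>simp_all add: CHAR_mpol\<close>)

lemma frob_surj: "\<exists>b::'k. b ^ p ^ e = a"
proof (induction e arbitrary: a)
  case (Suc e)
  obtain c where "c ^ p = a" using perfect by (metis surjD)
  moreover obtain b where "b ^ p ^ e = c" using Suc by blast
  ultimately show ?case by (metis power_Suc2 power_mult)
qed auto

lemma frob_inj: "a ^ p ^ e = b ^ p ^ e \<Longrightarrow> a = (b :: 'k)"
proof -
  assume "a ^ p ^ e = b ^ p ^ e"
  moreover have "((a - b) + b) ^ p ^ e = (a - b) ^ p ^ e + b ^ p ^ e" by (rule frob_add)
  ultimately have "(a - b) ^ p ^ e = 0" by simp
  then show ?thesis by simp
qed

text \<open>Perfectness enters here: roots exist and are unique, so taking them is additive and the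
  trace stays in the same polynomial ring.\<close>

definition rt :: "nat \<Rightarrow> 'k \<Rightarrow> 'k" where
  "rt e a = (SOME b. b ^ p ^ e = a)"

lemma rt_power: "rt e a ^ p ^ e = a"
  unfolding rt_def by (rule someI_ex[OF frob_surj])

lemma rt_eqI: "b ^ p ^ e = a \<Longrightarrow> rt e a = b"
  using rt_power[of e a] frob_inj by metis

lemma rt_0 [simp]: "rt e 0 = 0"
  by (rule rt_eqI) (use p_pos in \<open>simp add: power_0_left\<close>)

lemma rt_1 [simp]: "rt e 1 = 1"
  by (rule rt_eqI) simp

lemma rt_add: "rt e (a + b) = rt e a + rt e b"
  by (rule rt_eqI) (simp add: frob_add rt_power)

lemma rt_mult: "rt e (c ^ p ^ e * a) = c * rt e a"
  by (rule rt_eqI) (simp add: power_mult_distrib rt_power)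

lemma rt_eq_0: "rt e a = 0 \<longleftrightarrow> a = 0"
  using rt_power[of e a] p_pos by (auto simp: power_0_left)

text \<open>Monomials with exponents below $p^e$ form a basis over the $p^e$-th powers.  For such \<open>rho\<close>
  this is the coordinate at \<open>rho\<close>, followed by the inverse of Frobenius.\<close>
definition trace :: "nat \<Rightarrow> ('x \<Rightarrow>\<^sub>0 nat) \<Rightarrow> ('x, 'k) mpol \<Rightarrow> ('x, 'k) mpol" where
  "trace e rho f = Abs_poly_mapping (\<lambda>z. rt e (lookup f (rho + scl (p ^ e) z)))"

lemma q_pos: "p ^ e > 0" using p_pos by simp

lemma lookup_trace: "lookup (trace e rho f) z = rt e (lookup f (rho + scl (p ^ e) z))"
proof -
  have "inj (\<lambda>z. rho + scl (p ^ e) z)" using scl_inj[OF q_pos] by (auto intro!: injI)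
  then have "finite ((\<lambda>z. rho + scl (p ^ e) z) -` keys f)" by (rule finite_vimageI[OF finite_keys])
  moreover have "{z. rt e (lookup f (rho + scl (p ^ e) z)) \<noteq> 0} \<subseteq> (\<lambda>z. rho + scl (p ^ e) z) -` keys f"
    by (auto simp: rt_eq_0 in_keys_iff)
  ultimately have "finite {z. rt e (lookup f (rho + scl (p ^ e) z)) \<noteq> 0}" using finite_subset by blast
  then show ?thesis unfolding trace_def by simp
qed

lemma trace_add: "trace e rho (f + g) = trace e rho f + trace e rho g"
  by (intro poly_mapping_eqI) (simp add: lookup_trace lookup_add rt_add)

lemma trace_0 [simp]: "trace e rho 0 = 0"
  by (intro poly_mapping_eqI) (simp add: lookup_trace)

lemma trace_keys: "z \<in> keys (trace e rho f) \<longleftrightarrow> rho + scl (p ^ e) z \<in> keys f"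
  by (simp add: in_keys_iff lookup_trace rt_eq_0)

text \<open>Since the exponents of \<open>rho\<close> are below p^e, the monomial
  \<open>rho + scl (p ^ e) z\<close> is divisible by \<open>scl (p ^ e) m\<close> only if
  \<open>m\<close> divides \<open>z\<close>. No carry can occur, and p^e-th powers leave the trace
  as their roots.\<close>

lemma trace_mult:
  assumes rho: "\<And>x. lookup rho x < p ^ e"
  shows "trace e rho (s ^ p ^ e * f) = s * trace e rho f"
proof (induction s rule: poly_mapping_add_induct)
  case zero
  have "(0 :: ('a, 'k) mpol) ^ p ^ e = 0" using q_pos[of e] by (simp add: power_0_left)
  then show ?case by simp
next
  case (single m c)
  show ?case
  proof (rule poly_mapping_eqI)
    fix z
    show "lookup (trace e rho (single m c ^ p ^ e * f)) z = lookup (single m c * trace e rho f) z"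
    proof (cases "\<exists>z'. z = m + z'")
      case True
      then obtain z' where z: "z = m + z'" by blast
      have "rho + scl (p ^ e) z = scl (p ^ e) m + (rho + scl (p ^ e) z')"
        by (simp add: z scl_add ac_simps)
      then show ?thesis
        by (simp add: lookup_trace single_power lookup_single_mult rt_mult) (simp add: z lookup_single_mult lookup_trace)
    next
      case False
      then have "\<exists>x. lookup z x < lookup m x"
      proof (rule contrapos_np)
        assume *: "\<not> (\<exists>x. lookup z x < lookup m x)"
        have "z = m + (z - m)"
          by (rule poly_mapping_eqI) (use * in \<open>simp add: lookup_add lookup_minus not_less\<close>)
        then show "\<exists>z'. z = m + z'" by blast
      qed
      then obtain x where x: "Suc (lookup z x) \<le> lookup m x" by (auto simp: Suc_le_eq)
      have "lookup rho x + p ^ e * lookup z x < p ^ e * Suc (lookup z x)" using rho[of x] by simp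
      also have "\<dots> \<le> p ^ e * lookup m x" using x by (intro mult_le_mono) auto
      finally have lt: "lookup (rho + scl (p ^ e) z) x < lookup (scl (p ^ e) m) x" by (simp add: lookup_add)
      have "rho + scl (p ^ e) z \<noteq> scl (p ^ e) m + e'" for e'
        using lt by (metis lookup_add not_add_less1)
      then show ?thesis using False by (simp add: lookup_trace single_power lookup_single_mult_notin)
    qed
  qed
next
  case (add g h)
  then show ?case by (simp add: frob_add_mpol trace_add distrib_right)
qed

lemma trace_polys_in: "f \<in> polys_in V \<Longrightarrow> trace e rho f \<in> polys_in V"
proof -
  assume f: "f \<in> polys_in V"
  have "keys z \<subseteq> V" if "z \<in> keys (trace e rho f)" for z
  proof -
    have "keys (rho + scl (p ^ e) z) \<subseteq> V" using that f by (simp add: trace_keys polys_in_def)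
    then show ?thesis using keys_scl[OF q_pos, of e z] by (simp add: keys_add_nat)
  qed
  then show ?thesis by (simp add: polys_in_def)
qed

lemma trace_leading:
  assumes "leading W (rho + scl (p ^ e) m) 1 f"
  shows "leading W m 1 (trace e rho f)"
  unfolding leading_def wt_less_def
proof
  fix z assume "z \<in> keys (trace e rho f - single m 1)"
  then have z: "rt e (lookup f (rho + scl (p ^ e) z)) - (if z = m then 1 else 0) \<noteq> 0"
    by (simp add: in_keys_iff lookup_minus lookup_trace lookup_single when_def eq_commute[of m])
  have zm: "z \<noteq> m"
  proof
    assume "z = m"
    then show False using z leading_lookup[OF assms] by simp
  qed
  then have "rho + scl (p ^ e) z \<in> keys f" using z by (auto simp: in_keys_iff)
  from leading_keys[OF assms this] zm have "wt W (rho + scl (p ^ e) z) < wt W (rho + scl (p ^ e) m)"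
    using scl_inj[OF q_pos] by auto
  then have "int (p ^ e) * wt W z < int (p ^ e) * wt W m" by (simp add: wt_add wt_scl del: of_nat_power)
  moreover have "int (p ^ e) > 0" using q_pos by (simp del: of_nat_power)
  ultimately show "wt W z < wt W m" using mult_less_cancel_left_pos by blast
qed

end

section \<open>Trace and symbolic powers\<close>

locale perfect_rank_ladder = rank_ladder nr nc L tau + perfect_char p ty
  for nr nc L tau p and ty :: "'k::field itself"
begin

text \<open>The ideal has height \<open>height_Q\<close> at its generic point, so high symbolic powers lie in Frobenius
  powers up to denominators.\<close>
lemma trace_symb:
  fixes f :: "'k matrix_poly"
  assumes f: "f \<in> symQ N" and rho: "\<And>x. lookup rho x < p ^ e"
    and N: "b > 0 \<Longrightarrow> p ^ e * (b - 1) + height_Q * (p ^ e - 1) < N"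
  shows "trace e rho f \<in> symQ b"
proof (cases "b = 0")
  case True
  have "f \<in> polys_in L" using f prime_in.symb_subset[OF prime_in_Q] by blast
  then show ?thesis using True trace_polys_in by (simp add: prime_in.symb_0[OF prime_in_Q])
next
  case b: False
  interpret prime_in "polys_in L" "Q :: 'k matrix_poly set" by (rule prime_in_Q)
  define q where "q = p ^ e"
  have q: "q > 0" unfolding q_def by (rule q_pos)
  obtain y :: "nat \<times> nat \<Rightarrow> 'k matrix_poly" where y: "\<And>x. x \<in> L - greedy_face \<Longrightarrow> y x \<in> Q"
    "\<And>N g. g \<in> ipow N \<Longrightarrow> \<exists>s\<in>polys_in L - Q.
       s * g \<in> asum {a * (\<Prod>x\<in>L - greedy_face. y x ^ bt x) |a bt. a \<in> polys_in L \<and> (\<Sum>x\<in>L - greedy_face. bt x) = N}"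
    using chart_powers by blast
  define G where "G = {a * (\<Prod>x\<in>L - greedy_face. y x ^ bt x) |a bt. a \<in> polys_in L \<and> (\<Sum>x\<in>L - greedy_face. bt x) = N}"
  have fin: "finite (L - greedy_face)" using finite_L by simp
  have gen: "trace e rho (t ^ q * g) \<in> ipow b" if g: "g \<in> G" and t: "t \<in> polys_in L" for g t
  proof -
    obtain a bt where a: "g = a * (\<Prod>x\<in>L - greedy_face. y x ^ bt x)" "a \<in> polys_in L" "(\<Sum>x\<in>L - greedy_face. bt x) = N"
      using g by (auto simp: G_def)
    \<comment> \<open>Exponents are divided by q with remainder; the q-th power leaves the trace,
      and what stays inside only has to be a polynomial in \<open>L\<close>.\<close>
    have split: "y x ^ bt x = (y x ^ (bt x div q)) ^ q * y x ^ (bt x mod q)" for x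
      by (metis div_mult_mod_eq power_add power_mult)
    have tg: "t ^ q * g = (\<Prod>x\<in>L - greedy_face. y x ^ (bt x div q)) ^ q * (t ^ q * (a * (\<Prod>x\<in>L - greedy_face. y x ^ (bt x mod q))))"
      unfolding a(1) prod_power_distrib[symmetric]
      by (subst split) (simp add: prod.distrib mult_ac prod_power_distrib)
    have "trace e rho (t ^ q * g) = (\<Prod>x\<in>L - greedy_face. y x ^ (bt x div q)) *
        (t * trace e rho (a * (\<Prod>x\<in>L - greedy_face. y x ^ (bt x mod q))))"
      unfolding tg by (simp only: trace_mult[OF rho, folded q_def])
    moreover have "(\<Prod>x\<in>L - greedy_face. y x ^ (bt x div q)) \<in> ipow (\<Sum>x\<in>L - greedy_face. bt x div q)"
    proof (rule ipow_prod[OF fin])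
      fix x assume "x \<in> L - greedy_face"
      then show "y x ^ (bt x div q) \<in> ipow (bt x div q)"
        using ipow_power[OF Q_ipow1[OF y(1)], of x "bt x div q"] by simp
    qed
    \<comment> \<open>Each of the \<open>height_Q\<close> remainders is at most q - 1. If the
      quotients summed to at most b - 1, then N would be at most q(b - 1) + h(q - 1).\<close>
    moreover have "b \<le> (\<Sum>x\<in>L - greedy_face. bt x div q)"
    proof (rule ccontr)
      assume "\<not> ?thesis"
      then have le: "(\<Sum>x\<in>L - greedy_face. bt x div q) \<le> b - 1" by simp
      have "N = (\<Sum>x\<in>L - greedy_face. q * (bt x div q) + bt x mod q)" using a(3) by simp
      also have "\<dots> = q * (\<Sum>x\<in>L - greedy_face. bt x div q) + (\<Sum>x\<in>L - greedy_face. bt x mod q)"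
        by (simp only: sum.distrib sum_distrib_left)
      also have "(\<Sum>x\<in>L - greedy_face. bt x mod q) \<le> (\<Sum>x\<in>L - greedy_face. q - 1)"
        using q by (intro sum_mono) (metis Suc_pred' less_Suc_eq_le mod_less_divisor)
      also have "\<dots> = height_Q * (q - 1)" by (simp add: height_Q_def)
      finally have "N \<le> q * (b - 1) + height_Q * (q - 1)"
        using mult_le_mono2[OF le, of q] by linarith
      then show False using N b by (simp add: q_def)
    qed
    moreover have "t * trace e rho (a * (\<Prod>x\<in>L - greedy_face. y x ^ (bt x mod q))) \<in> polys_in L"
      using t a(2) y(1) Q_subset by (intro polys_in_mult trace_polys_in polys_in_prod polys_in_power) auto
    ultimately show ?thesis
      using ipow_smult[of "t * trace e rho (a * (\<Prod>x\<in>L - greedy_face. y x ^ (bt x mod q)))"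
          "\<Prod>x\<in>L - greedy_face. y x ^ (bt x div q)" b]
        subsetD[OF ipow_antimono[of b]] by (simp only: mult.commute)
  qed
  have sum: "trace e rho (t ^ q * g) \<in> ipow b" if "g \<in> asum G" "t \<in> polys_in L" for g t
    using that(1)
  proof induction
    case (asum_add g g')
    show ?case unfolding distrib_left trace_add by (rule ipow_add[OF asum_add.IH])
  qed (use gen that(2) in simp_all)
  obtain s1 where s1: "s1 \<in> polys_in L - Q" "s1 * f \<in> ipow N" using f by (auto simp: symb_def)
  obtain s2 where s2: "s2 \<in> polys_in L - Q" "s2 * (s1 * f) \<in> asum G"
    using y(2)[OF s1(2)] unfolding G_def by blast
  have sS: "s2 * s1 \<in> polys_in L - Q" using compl_mult[OF s2(1) s1(1)] .
  \<comment> \<open>The denominator enters as a q-th power, although one factor would suffice for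
    membership, because only a q-th power can be pulled out of the trace.\<close>
  have mem: "trace e rho ((s2 * s1) ^ q * f) \<in> ipow b"
  proof -
    have "(s2 * s1) ^ q = (s2 * s1) ^ (q - 1) * (s2 * s1)" using q by (metis Suc_pred' power_Suc2)
    then have eq: "(s2 * s1) ^ q * f = (s2 * s1) ^ (q - 1) * (s2 * (s1 * f))" by (simp only: mult.assoc)
    moreover have "u * g \<in> asum G" if "u \<in> polys_in L" "g \<in> asum G" for u g
      using that(2)
    proof (rule asum_mult)
      fix g assume "g \<in> G"
      then obtain a bt where g: "g = a * (\<Prod>x\<in>L - greedy_face. y x ^ bt x)" "a \<in> polys_in L" "(\<Sum>x\<in>L - greedy_face. bt x) = N"
        by (auto simp: G_def)
      then have "u * g = (u * a) * (\<Prod>x\<in>L - greedy_face. y x ^ bt x)" by (simp add: mult.assoc)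
      then show "u * g \<in> asum G" using g that(1) unfolding G_def
        by (intro asum_gen CollectI exI[of _ "u * a"] exI[of _ bt]) auto
    qed
    ultimately have "(s2 * s1) ^ q * f \<in> asum G"
      unfolding eq using s2(2) sS by (metis DiffD1 S_power)
    from sum[OF this, of 1] show ?thesis by simp
  qed
  then have "(s2 * s1) * trace e rho f \<in> ipow b"
    by (simp only: trace_mult[OF rho, folded q_def])
  moreover have "trace e rho f \<in> polys_in L" using f symb_subset trace_polys_in by blast
  ultimately show ?thesis using sS by (auto simp: symb_def simp del: mult.assoc)
qed

end

subsection \<open>Fractional packing of chains\<close>

text \<open>Induction on the number of generators. If the functional \<open>z0\<close> found for the
  old ones is positive on the new generator, everything is projected along that generator onto the
  kernel of \<open>z0\<close>. A solution downstairs lifts with a nonnegative coefficient for the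
  new generator, and a certificate downstairs is corrected by a multiple of
  \<open>z0\<close>.\<close>

lemma farkas:
  fixes a :: "'j \<Rightarrow> 'x \<Rightarrow> real"
  assumes "finite J" "finite I"
  shows "(\<exists>y. (\<forall>j\<in>J. 0 \<le> y j) \<and> (\<forall>x\<in>I. b x = (\<Sum>j\<in>J. y j * a j x))) \<or>
    (\<exists>z. (\<forall>j\<in>J. (\<Sum>x\<in>I. a j x * z x) \<le> 0) \<and> 0 < (\<Sum>x\<in>I. b x * z x))"
  using assms(1)
proof (induction J arbitrary: a b rule: finite_induct)
  case empty
  show ?case
  proof (cases "\<forall>x\<in>I. b x = 0")
    case False
    then obtain x where x: "x \<in> I" "b x \<noteq> 0" by blast
    then have "0 < b x * b x" by (metis not_real_square_gt_zero)
    also have "\<dots> \<le> (\<Sum>x\<in>I. b x * b x)" using x assms(2) by (intro member_le_sum) auto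
    finally show ?thesis by blast
  qed simp
next
  case (insert j J)
  let ?s = "\<lambda>f z. \<Sum>x\<in>I. f x * z x"
  consider (1) y where "\<forall>i\<in>J. 0 \<le> y i" "\<forall>x\<in>I. b x = (\<Sum>i\<in>J. y i * a i x)"
    | (2) z0 where "\<forall>i\<in>J. ?s (a i) z0 \<le> 0" "0 < ?s b z0"
    using insert.IH[of b a] by blast
  then show ?case
  proof cases
    case 1
    have "(\<Sum>i\<in>insert j J. (y(j := 0)) i * a i x) = (\<Sum>i\<in>J. y i * a i x)" for x
      using insert.hyps by (simp, intro sum.cong) auto
    then show ?thesis using 1 by (intro disjI1 exI[of _ "y(j := 0)"]) auto
  next
    case 2
    show ?thesis
    proof (cases "?s (a j) z0 \<le> 0")
      case True
      then show ?thesis using 2 by (intro disjI2 exI[of _ z0]) auto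
    next
      case False
      define al where "al = ?s (a j) z0"
      have al: "al > 0" using False by (simp add: al_def)
      define S where "S i = ?s (a i) z0" for i
      \<comment> \<open>The projection: \<open>a' i\<close> differs from \<open>a i\<close> by a
        multiple of \<open>a j\<close> and is annihilated by \<open>z0\<close>.\<close>
      define a' where "a' i x = a i x - S i / al * a j x" for i x
      define b' where "b' x = b x - ?s b z0 / al * a j x" for x
      consider (3) y where "\<forall>i\<in>J. 0 \<le> y i" "\<forall>x\<in>I. b' x = (\<Sum>i\<in>J. y i * a' i x)"
        | (4) z where "\<forall>i\<in>J. ?s (a' i) z \<le> 0" "0 < ?s b' z"
        using insert.IH[of b' a'] by blast
      then show ?thesis
      proof cases
        case 3
        define t where "t = ?s b z0 / al - (\<Sum>i\<in>J. y i * (S i / al))"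
        have "y i * (S i / al) \<le> 0" if "i \<in> J" for i
          using 2 3 al that by (intro mult_nonneg_nonpos divide_nonpos_pos) (auto simp: S_def)
        then have "(\<Sum>i\<in>J. y i * (S i / al)) \<le> 0" by (rule sum_nonpos)
        moreover have "0 < ?s b z0 / al" using 2 al by simp
        ultimately have t: "t \<ge> 0" unfolding t_def by linarith
        have "b x = (\<Sum>i\<in>insert j J. (y(j := t)) i * a i x)" if "x \<in> I" for x
        proof -
          have "(\<Sum>i\<in>insert j J. (y(j := t)) i * a i x) = t * a j x + (\<Sum>i\<in>J. y i * a i x)"
            using insert.hyps by (simp, intro sum.cong) auto
          also have "(\<Sum>i\<in>J. y i * a i x) = (\<Sum>i\<in>J. y i * a' i x) + (\<Sum>i\<in>J. y i * (S i / al)) * a j x"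
            unfolding sum_distrib_right sum.distrib[symmetric] by (intro sum.cong) (simp_all add: a'_def algebra_simps)
          also have "(\<Sum>i\<in>J. y i * a' i x) = b' x" using 3 that by simp
          finally show ?thesis by (simp add: b'_def t_def algebra_simps)
        qed
        then show ?thesis using 3 t by (intro disjI1 exI[of _ "y(j := t)"]) auto
      next
        case 4
        define r where "r = ?s (a j) z / al"
        define w where "w x = z x - r * z0 x" for x
        have lin: "?s f w = ?s f z - r * ?s f z0" for f
          by (simp add: w_def algebra_simps sum_subtractf sum_distrib_left)
        have lin': "?s (\<lambda>x. f x - c / al * a j x) z = ?s f z - c / al * ?s (a j) z" for f c
          by (simp add: algebra_simps sum_subtractf sum_distrib_left)
        have "?s (a i) w = ?s (a' i) z" for i
          unfolding lin a'_def lin' S_def r_def by simp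
        moreover have "?s b w = ?s b' z"
          unfolding lin b'_def lin' r_def by simp
        moreover have "?s (a j) w = 0"
          unfolding lin r_def using al by (simp add: al_def[symmetric])
        ultimately show ?thesis using 4 by (intro disjI2 exI[of _ w]) auto
      qed
    qed
  qed
qed

context rank_ladder
begin

lemma chain_remove:
  assumes "chain c s" "i < s"
  shows "chain (\<lambda>j. c (if j < i then j else Suc j)) (s - 1)"
  using assms unfolding chain_def by auto

text \<open>Positions with z > 1 contribute nothing and are removed one by one. The start of the
  chain can only move north-east, where \<open>tau\<close> is not larger. When all z are at most 1,
  the bound is the covering inequality, or trivial for a chain shorter than
  \<open>tau\<close>.\<close>

lemma chain_positive_part:
  fixes z :: "nat \<times> nat \<Rightarrow> real"
  assumes nonneg: "\<And>x. 0 \<le> z x"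
    and heavy: "\<And>c s. chain c s \<Longrightarrow> 0 < s \<Longrightarrow> tau (c 0) \<le> s \<Longrightarrow> real s - (real (tau (c 0)) - 1) \<le> (\<Sum>i<s. z (c i))"
    and "chain c s" "0 < s"
  shows "(\<Sum>i<s. max 0 (1 - z (c i))) \<le> real (tau (c 0)) - 1"
  using assms(3,4)
proof (induction s arbitrary: c)
  case (Suc s)
  have c0: "c 0 \<in> L" using Suc.prems by (auto simp: chain_def)
  show ?case
  proof (cases "\<exists>i<Suc s. 1 < z (c i)")
    case True
    then obtain i where i: "i < Suc s" "1 < z (c i)" by blast
    define r where "r = (\<lambda>j. if j < i then j else Suc j)"
    have ch: "chain (c \<circ> r) s" using chain_remove[OF Suc.prems(1) i(1)] by (simp add: r_def comp_def)
    have "{..<Suc s} - {i} = r ` {..<s}"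
    proof (rule Set.set_eqI)
      fix k show "k \<in> {..<Suc s} - {i} \<longleftrightarrow> k \<in> r ` {..<s}"
      proof
        assume k: "k \<in> {..<Suc s} - {i}"
        show "k \<in> r ` {..<s}"
        proof (cases "k < i")
          case True then show ?thesis using k i by (intro image_eqI[of _ _ k]) (auto simp: r_def)
        next
          case False then show ?thesis using k i by (intro image_eqI[of _ _ "k - 1"]) (auto simp: r_def)
        qed
      qed (use i in \<open>auto simp: r_def\<close>)
    qed
    moreover have "inj_on r {..<s}" by (auto simp: inj_on_def r_def split: if_splits)
    ultimately have "(\<Sum>k\<in>{..<Suc s} - {i}. max 0 (1 - z (c k))) = (\<Sum>k<s. max 0 (1 - z ((c \<circ> r) k)))"
      by (simp add: sum.reindex)
    then have eq: "(\<Sum>k<Suc s. max 0 (1 - z (c k))) = (\<Sum>k<s. max 0 (1 - z ((c \<circ> r) k)))"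
      using sum.remove[of "{..<Suc s}" i "\<lambda>k. max 0 (1 - z (c k))"] i by simp
    show ?thesis
    proof (cases "s = 0")
      case True then show ?thesis unfolding eq using tau_pos[OF c0] by simp
    next
      case False
      have "real (tau ((c \<circ> r) 0)) \<le> real (tau (c 0))"
      proof (cases "i = 0")
        case True
        then have "(c \<circ> r) 0 = c 1" by (simp add: r_def)
        moreover have "c 1 \<in> L" "ne (c 0) (c 1)" using Suc.prems False by (auto simp: chain_def)
        ultimately show ?thesis using tau_mono[of "fst (c 0)" "snd (c 0)" "fst (c 1)" "snd (c 1)"] c0
          by (auto simp: ne_def)
      qed (simp add: r_def)
      then show ?thesis unfolding eq using Suc.IH[OF ch] False by linarith
    qed
  next
    case False
    then have "z (c i) \<le> 1" if "i < Suc s" for i using that by (meson not_less)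
    then have "(\<Sum>i<Suc s. max 0 (1 - z (c i))) = (\<Sum>i<Suc s. 1 - z (c i))"
      by (intro sum.cong) (auto simp: max_def)
    also have "\<dots> = real (Suc s) - (\<Sum>i<Suc s. z (c i))" by (simp add: sum_subtractf)
    also have "\<dots> \<le> real (tau (c 0)) - 1"
    proof (cases "tau (c 0) \<le> Suc s")
      case True then show ?thesis using heavy[OF Suc.prems True] by linarith
    next
      case False
      then have "real (Suc s) \<le> real (tau (c 0)) - 1" by linarith
      moreover have "0 \<le> (\<Sum>i<Suc s. z (c i))" using nonneg by (intro sum_nonneg) auto
      ultimately show ?thesis by linarith
    qed
    finally show ?thesis .
  qed
qed simp

text \<open>Cut the heights of the elements at a residue class modulo \<open>N\<close>; averaging over the classes
  shows that a fractional cover of the chains weighs at least as much as the lightest complement of a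
  face.\<close>
lemma threshold_faces:
  fixes om :: "nat \<times> nat \<Rightarrow> nat"
  assumes N: "0 < N" and omN: "\<And>x. om x \<le> N"
    and light: "\<And>c s. chain c s \<Longrightarrow> 0 < s \<Longrightarrow> (\<Sum>i<s. om (c i)) \<le> N * (tau (c 0) - 1)"
    and faces: "\<And>F. face F \<Longrightarrow> n \<le> odeg F m"
  shows "N * n \<le> (\<Sum>x\<in>L. lookup m x * (N - om x))"
proof -
  define P where "P x v \<longleftrightarrow> (\<exists>c s. chain c s \<and> 0 < s \<and> c 0 = x \<and> v = (\<Sum>i<s. om (c i)))" for x v
  \<comment> \<open>The largest total of \<open>om\<close> along a chain starting at x. It plays the
    part of a height function, increasing by at least \<open>om x\<close> when \<open>x\<close> is
    put in front.\<close>
  define H where "H x = (GREATEST v. P x v)" for x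
  have bound: "v \<le> N * (tau x - 1)" if "P x v" for x v
    using that light by (auto simp: P_def)
  have P1: "P x (om x)" if "x \<in> L" for x
    unfolding P_def using that by (intro exI[of _ "\<lambda>_. x"] exI[of _ 1]) (auto simp: chain_def)
  have PH: "P x (H x)" if "x \<in> L" for x
    unfolding H_def by (rule GreatestI_nat[of "P x" "om x" "N * (tau x - 1)"]) (use P1[OF that] bound in auto)
  have H_ge: "v \<le> H x" if "P x v" for x v
    unfolding H_def by (rule Greatest_le_nat[of "P x" v "N * (tau x - 1)"]) (use that bound in auto)
  have Hom: "om x \<le> H x" if "x \<in> L" for x using H_ge[OF P1[OF that]] .
  have Hstep: "om x + H y \<le> H x" if x: "x \<in> L" and y: "y \<in> L" and xy: "ne x y" for x y
  proof -
    obtain c s where c: "chain c s" "0 < s" "c 0 = y" "H y = (\<Sum>i<s. om (c i))"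
      using PH[OF y] by (auto simp: P_def)
    have "chain (case_nat x c) (Suc s)" using c x xy by (intro chain_Cons) auto
    moreover have "(\<Sum>i<Suc s. om (case_nat x c i)) = om x + H y"
      unfolding c(4) by (subst sum.lessThan_Suc_shift) simp
    ultimately have "P x (om x + H y)" unfolding P_def
      by (intro exI[of _ "case_nat x c"] exI[of _ "Suc s"]) auto
    then show ?thesis by (rule H_ge)
  qed
  \<comment> \<open>By \<open>Hstep\<close> the half-open intervals from \<open>H x - om x\<close>
    to \<open>H x\<close> are disjoint and ordered along chains. \<open>F k\<close> collects the
    positions whose interval contains a number congruent to k modulo N; the quotient gives the
    level.\<close>
  define F where "F k = {x\<in>L. \<exists>t. H x - om x < k + N * t \<and> k + N * t \<le> H x}" for k
  have faceF: "face (F k)" if k: "1 \<le> k" for k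
  proof -
    define t where "t x = (SOME t. H x - om x < k + N * t \<and> k + N * t \<le> H x)" for x
    have t: "H x - om x < k + N * t x" "k + N * t x \<le> H x" if "x \<in> F k" for x
      using someI_ex[of "\<lambda>t. H x - om x < k + N * t \<and> k + N * t \<le> H x"] that by (auto simp: F_def t_def)
    have "levels (F k) (\<lambda>x. Suc (t x))"
      unfolding levels_def
    proof (intro ballI conjI impI)
      fix x assume x: "x \<in> F k"
      then have xL: "x \<in> L" by (simp add: F_def)
      have "k + N * t x \<le> N * (tau x - 1)" using t[OF x] bound[OF PH[OF xL]] by linarith
      then have "N * t x < N * (tau x - 1)" using k by linarith
      then have "t x < tau x - 1" by simp
      then show "Suc (t x) < tau x" by linarith
      fix y assume y: "y \<in> F k" and xy: "ne x y"
      have "om x + H y \<le> H x" using Hstep[OF xL _ xy] y by (simp add: F_def)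
      then have "N * t y < N * t x" using t[OF x] t[OF y] by linarith
      then show "Suc (t y) < Suc (t x)" by simp
    qed simp
    then show ?thesis by (auto simp: face_def F_def)
  qed
  have count: "om x \<le> card {k\<in>{1..N}. x \<in> F k}" if x: "x \<in> L" for x
  proof -
    \<comment> \<open>Representatives of the residue classes in 1..N instead of 0..N-1:
      \<open>faceF\<close> needs k at least 1 to keep the level strictly below
      \<open>tau\<close>.\<close>
    define r where "r v = Suc ((v - 1) mod N)" for v
    have "inj_on r {H x - om x<..H x}"
    proof (rule inj_onI)
      fix v v' assume v: "v \<in> {H x - om x<..H x}" "v' \<in> {H x - om x<..H x}" "r v = r v'"
      have *: "v1 = v2" if "v1 \<le> v2" "(v1 - 1) mod N = (v2 - 1) mod N" "H x - om x < v1" "v2 \<le> H x" for v1 v2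
      proof -
        have "N dvd (v2 - 1) - (v1 - 1)" using that by (metis diff_le_mono mod_eq_dvd_iff_nat)
        moreover have "(v2 - 1) - (v1 - 1) < N" using that omN[of x] Hom[OF x] by linarith
        ultimately have "(v2 - 1) - (v1 - 1) = 0" by (meson dvd_imp_le not_le gr0I)
        then show ?thesis using that by linarith
      qed
      show "v = v'" using *[of v v'] *[of v' v] v by (auto simp: r_def not_le nat_le_linear) (metis nat_le_linear)
    qed
    moreover have "r ` {H x - om x<..H x} \<subseteq> {k\<in>{1..N}. x \<in> F k}"
    proof
      fix k assume "k \<in> r ` {H x - om x<..H x}"
      then obtain v where v: "H x - om x < v" "v \<le> H x" "k = r v" by auto
      have "v = k + N * ((v - 1) div N)" using v by (simp add: r_def)
      then have "x \<in> F k" using x v by (auto simp: F_def intro!: exI[of _ "(v - 1) div N"])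
      moreover have "k \<in> {1..N}" using N v(3) by (simp add: r_def Suc_leI)
      ultimately show "k \<in> {k\<in>{1..N}. x \<in> F k}" by simp
    qed
    ultimately have "card {H x - om x<..H x} \<le> card {k\<in>{1..N}. x \<in> F k}"
      by (intro card_inj_on_le) auto
    then show ?thesis using Hom[OF x] by simp
  qed
  have "N * n = (\<Sum>k\<in>{1..N}. n)" by simp
  also have "\<dots> \<le> (\<Sum>k\<in>{1..N}. odeg (F k) m)" using faces[OF faceF] by (intro sum_mono) auto
  also have "\<dots> = (\<Sum>k\<in>{1..N}. \<Sum>x\<in>L. if x \<notin> F k then lookup m x else 0)"
    unfolding odeg_def by (intro sum.cong refl sum.mono_neutral_cong_left) (use finite_L in auto)
  also have "\<dots> = (\<Sum>x\<in>L. \<Sum>k\<in>{1..N}. if x \<notin> F k then lookup m x else 0)"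
    by (rule sum.swap)
  also have "\<dots> = (\<Sum>x\<in>L. lookup m x * card {k\<in>{1..N}. x \<notin> F k})"
    by (intro sum.cong refl) (simp add: sum.If_cases Int_def)
  also have "\<dots> \<le> (\<Sum>x\<in>L. lookup m x * (N - om x))"
  proof (intro sum_mono mult_le_mono order_refl)
    fix x assume x: "x \<in> L"
    have "{k\<in>{1..N}. x \<notin> F k} = {1..N} - {k\<in>{1..N}. x \<in> F k}" by auto
    then have "card {k\<in>{1..N}. x \<notin> F k} = N - card {k\<in>{1..N}. x \<in> F k}"
      using card_Diff_subset[of "{k\<in>{1..N}. x \<in> F k}" "{1..N}"] by (simp del: atLeastAtMost_iff)
    then show "card {k\<in>{1..N}. x \<notin> F k} \<le> N - om x" using count[OF x] by linarith
  qed
  finally show ?thesis .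
qed

text \<open>The capacities 1 - z, cut off at 0, are scaled by N and rounded down so that
  \<open>threshold_faces\<close> applies. Rounding costs at most the constant \<open>M\<close>,
  which disappears on dividing by a large N.\<close>

lemma fractional_cover_bound:
  fixes z :: "nat \<times> nat \<Rightarrow> real"
  assumes nonneg: "\<And>x. 0 \<le> z x"
    and heavy: "\<And>c s. chain c s \<Longrightarrow> 0 < s \<Longrightarrow> tau (c 0) \<le> s \<Longrightarrow> real s - (real (tau (c 0)) - 1) \<le> (\<Sum>i<s. z (c i))"
    and faces: "\<And>F. face F \<Longrightarrow> n \<le> odeg F m"
  shows "real n \<le> (\<Sum>x\<in>L. real (lookup m x) * z x)"
proof -
  define M where "M = (\<Sum>x\<in>L. real (lookup m x))"
  have step: "real N * real n \<le> real N * (\<Sum>x\<in>L. real (lookup m x) * z x) + M" if N: "0 < N" for N :: nat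
  proof -
    define om where "om x = nat \<lfloor>real N * max 0 (1 - z x)\<rfloor>" for x
    have omle: "real (om x) \<le> real N * max 0 (1 - z x)" for x
      by (simp add: om_def)
    have omN: "om x \<le> N" for x
    proof -
      have "real N * max 0 (1 - z x) \<le> real N * 1" using nonneg[of x] by (intro mult_left_mono) auto
      then show ?thesis using omle[of x] by linarith
    qed
    have omge: "real N - real (om x) \<le> real N * z x + 1" for x
    proof -
      have "real N * (1 - z x) \<le> real N * max 0 (1 - z x)" by (intro mult_left_mono) auto
      also have "\<dots> \<le> real (om x) + 1" unfolding om_def by linarith
      finally show ?thesis by (simp add: algebra_simps)
    qed
    have light: "(\<Sum>i<s. om (c i)) \<le> N * (tau (c 0) - 1)" if c: "chain c s" "0 < s" for c s
    proof -
      have t: "1 \<le> tau (c 0)" using c tau_pos[of "c 0"] by (auto simp: chain_def)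
      have "real (\<Sum>i<s. om (c i)) \<le> (\<Sum>i<s. real N * max 0 (1 - z (c i)))"
        unfolding of_nat_sum by (intro sum_mono omle)
      also have "\<dots> = real N * (\<Sum>i<s. max 0 (1 - z (c i)))" by (simp add: sum_distrib_left)
      also have "\<dots> \<le> real N * (real (tau (c 0)) - 1)"
        using chain_positive_part[OF nonneg heavy c] by (intro mult_left_mono) auto
      also have "\<dots> = real (N * (tau (c 0) - 1))" using t by (simp add: of_nat_diff)
      finally show ?thesis by (simp only: of_nat_le_iff)
    qed
    have "real (N * n) \<le> real (\<Sum>x\<in>L. lookup m x * (N - om x))"
      using threshold_faces[OF N omN light faces] by (simp only: of_nat_le_iff)
    also have "\<dots> = (\<Sum>x\<in>L. real (lookup m x) * (real N - real (om x)))"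
      using omN by (simp add: of_nat_diff)
    also have "\<dots> \<le> (\<Sum>x\<in>L. real (lookup m x) * (real N * z x + 1))"
      by (intro sum_mono mult_left_mono omge) auto
    also have "\<dots> = real N * (\<Sum>x\<in>L. real (lookup m x) * z x) + M"
      by (simp add: M_def algebra_simps sum.distrib sum_distrib_left)
    finally show ?thesis by simp
  qed
  show ?thesis
  proof (rule ccontr)
    assume "\<not> ?thesis"
    then have d: "0 < real n - (\<Sum>x\<in>L. real (lookup m x) * z x)" (is "0 < ?d") by simp
    obtain N :: nat where N: "M / ?d < real N" using reals_Archimedean2 by blast
    have "0 \<le> M / ?d" using d by (simp add: M_def sum_nonneg)
    then have "0 < N" using N by (cases N) auto
    have "M < real N * ?d" using N d by (simp add: pos_divide_less_eq)
    then show False using step[OF \<open>0 < N\<close>] by (simp add: algebra_simps)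
  qed
qed

text \<open>Chains are indexed by lists to make the linear program finite.\<close>
definition chains :: "(nat \<times> nat) list set" where
  "chains = {l. chain (nth l) (length l) \<and> l \<noteq> [] \<and> tau (l ! 0) \<le> length l}"

text \<open>The exponent of the symbolic power that contains the minor of the chain, by
  \<open>cminor_in_symb\<close>. It is at least 1 on \<open>chains\<close>.\<close>

definition cweight :: "(nat \<times> nat) list \<Rightarrow> nat" where
  "cweight l = length l - (tau (l ! 0) - 1)"

lemma finite_chains: "finite chains"
proof (rule finite_subset)
  show "chains \<subseteq> {l. set l \<subseteq> L \<and> length l \<le> nr}"
  proof
    fix l assume l: "l \<in> chains"
    then have c: "chain (nth l) (length l)" "l \<noteq> []" by (auto simp: chains_def)
    have inL: "set l \<subseteq> L" using c(1) unfolding chain_def by (metis in_set_conv_nth subsetI)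
    have "l ! 0 \<in> L" "l ! (length l - 1) \<in> L" using c by (auto simp: chain_def)
    then have "fst (l ! 0) \<le> nr" "1 \<le> fst (l ! (length l - 1))" using L_subset by auto
    then have "length l \<le> nr" using chain_length[OF c(1), of "length l - 1"] c(2) by auto
    with inL show "l \<in> {l. set l \<subseteq> L \<and> length l \<le> nr}" by simp
  qed
qed (rule finite_lists_length_le[OF finite_L])

text \<open>Linear programming duality. The row \<open>None\<close> asks for total weight n, the
  rows \<open>Some x\<close> are capacities, and the columns \<open>Inr\<close> are slack variables
  that turn inequalities into equations. A certificate of infeasibility would be a fractional cover
  of weight below n, against \<open>fractional_cover_bound\<close>.\<close>

lemma fractional_packing:
  assumes faces: "\<And>F. face F \<Longrightarrow> n \<le> odeg F m"
  obtains y :: "(nat \<times> nat) list \<Rightarrow> real" where "\<And>l. l \<in> chains \<Longrightarrow> 0 \<le> y l"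
    "\<And>x. x \<in> L \<Longrightarrow> (\<Sum>l\<in>chains. if x \<in> set l then y l else 0) \<le> real (lookup m x)"
    "real n \<le> (\<Sum>l\<in>chains. y l * real (cweight l))"
proof -
  define J where "J = Inl ` chains \<union> Inr ` insert None (Some ` L)"
  define I where "I = insert None (Some ` L)"
  define a where "a j v = (case j of
      Inl l \<Rightarrow> (case v of None \<Rightarrow> real (cweight l) | Some x \<Rightarrow> if x \<in> set l then 1 else 0)
    | Inr u \<Rightarrow> (if u = v then (if u = None then -1 else 1) else 0))" for j :: "(nat \<times> nat) list + (nat \<times> nat) option" and v
  define b where "b v = (case v of None \<Rightarrow> real n | Some x \<Rightarrow> real (lookup m x))" for v
  have finJ: "finite J" "finite I" using finite_chains finite_L by (auto simp: J_def I_def)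
  have sI: "(\<Sum>v\<in>I. f v) = f None + (\<Sum>x\<in>L. f (Some x))" for f :: "_ \<Rightarrow> real"
    using finite_L unfolding I_def by (simp add: sum.reindex)
  have sJ: "(\<Sum>j\<in>J. f j) = (\<Sum>l\<in>chains. f (Inl l)) + (f (Inr None) + (\<Sum>x\<in>L. f (Inr (Some x))))" for f :: "_ \<Rightarrow> real"
  proof -
    have "(\<Sum>j\<in>J. f j) = (\<Sum>j\<in>Inl ` chains. f j) + (\<Sum>j\<in>Inr ` I. f j)"
      using finite_chains finJ(2) unfolding J_def I_def by (intro sum.union_disjoint) auto
    then show ?thesis by (simp add: sum.reindex sI)
  qed
  have ifm: "(if P then 1 else 0) * r = (if P then r else 0)" for P and r :: real by simp
  consider (1) y where "\<forall>j\<in>J. 0 \<le> y j" "\<forall>v\<in>I. b v = (\<Sum>j\<in>J. y j * a j v)"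
    | (2) z where "\<forall>j\<in>J. (\<Sum>v\<in>I. a j v * z v) \<le> 0" "0 < (\<Sum>v\<in>I. b v * z v)"
    using farkas[OF finJ, of b a] by blast
  then show ?thesis
  proof cases
    case 1
    have nn: "0 \<le> y (Inr None)" "\<And>x. x \<in> L \<Longrightarrow> 0 \<le> y (Inr (Some x))" "\<And>l. l \<in> chains \<Longrightarrow> 0 \<le> y (Inl l)"
      using 1(1) by (auto simp: J_def)
    have "b None = (\<Sum>j\<in>J. y j * a j None)" using 1(2) by (simp add: I_def)
    then have "real n = (\<Sum>l\<in>chains. y (Inl l) * real (cweight l)) - y (Inr None)"
      unfolding sJ by (simp add: a_def b_def)
    moreover have "(\<Sum>l\<in>chains. if x \<in> set l then y (Inl l) else 0) \<le> real (lookup m x)" if x: "x \<in> L" for x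
    proof -
      have "b (Some x) = (\<Sum>j\<in>J. y j * a j (Some x))" using 1(2) x by (simp add: I_def)
      also have "\<dots> = (\<Sum>l\<in>chains. if x \<in> set l then y (Inl l) else 0) + y (Inr (Some x))"
        unfolding sJ using x finite_L by (simp add: a_def if_distrib cong: if_cong)
      finally show ?thesis using nn(2)[OF x] by (simp add: b_def)
    qed
    ultimately show ?thesis using that[of "\<lambda>l. y (Inl l)"] nn by simp
  next
    case 2
    have zl: "z None * real (cweight l) + (\<Sum>x\<in>L. if x \<in> set l then z (Some x) else 0) \<le> 0" if "l \<in> chains" for l
    proof -
      have "(\<Sum>v\<in>I. a (Inl l) v * z v) \<le> 0" using 2(1) that by (auto simp: J_def)
      then show ?thesis unfolding sI by (simp add: a_def ifm mult.commute[of _ "z None"])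
    qed
    have zx: "z (Some x) \<le> 0" if "x \<in> L" for x
    proof -
      have "(\<Sum>v\<in>I. a (Inr (Some x)) v * z v) \<le> 0" using 2(1) that by (auto simp: J_def)
      then show ?thesis unfolding sI using finite_L that by (simp add: a_def ifm cong: if_cong)
    qed
    have zN: "0 \<le> z None"
    proof -
      have "(\<Sum>v\<in>I. a (Inr None) v * z v) \<le> 0" using 2(1) by (auto simp: J_def)
      then show ?thesis unfolding sI by (simp add: a_def)
    qed
    have pos: "0 < real n * z None + (\<Sum>x\<in>L. real (lookup m x) * z (Some x))"
      using 2(2) unfolding sI by (simp add: b_def)
    have "(\<Sum>x\<in>L. real (lookup m x) * z (Some x)) \<le> 0"
      using zx by (intro sum_nonpos mult_nonneg_nonpos) auto
    then have zNpos: "0 < z None" using zN pos by (cases "z None = 0") auto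
    \<comment> \<open>Dividing by the multiplier of the row \<open>None\<close>, which is positive,
      normalises the certificate to a fractional cover; outside \<open>L\<close> the value is
      immaterial to the sums and set to 0 for nonnegativity.\<close>
    define w where "w x = (if x \<in> L then - z (Some x) / z None else 0)" for x
    have "real n \<le> (\<Sum>x\<in>L. real (lookup m x) * w x)"
    proof (rule fractional_cover_bound[OF _ _ faces])
      show "0 \<le> w x" for x using zx zNpos by (auto simp: w_def divide_nonpos_pos)
      fix c s assume c: "chain c s" "0 < s" "tau (c 0) \<le> s"
      define l where "l = map c [0..<s]"
      have l: "l ! i = c i" if "i < s" for i using that by (simp add: l_def)
      have len: "length l = s" by (simp add: l_def)
      have lc: "l \<in> chains" using c l len by (auto simp: chains_def chain_def l_def)
      have t: "1 \<le> tau (c 0)" using c tau_pos[of "c 0"] by (auto simp: chain_def)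
      have inj: "inj_on c {..<s}"
        using c(1) by (intro inj_onI) (metis chain_def lessThan_iff ne_def nat_neq_iff less_irrefl)
      have sl: "set l = c ` {..<s}" by (auto simp: l_def)
      have sL: "set l \<subseteq> L" using c(1) unfolding sl by (auto simp: chain_def)
      have "(\<Sum>x\<in>L. if x \<in> set l then z (Some x) else 0) = (\<Sum>x\<in>set l. z (Some x))"
        using finite_L sL by (simp add: sum.If_cases Int_absorb1)
      also have "\<dots> = (\<Sum>i<s. z (Some (c i)))" unfolding sl by (simp add: sum.reindex[OF inj])
      finally have "z None * real (cweight l) \<le> (\<Sum>i<s. - z (Some (c i)))"
        using zl[OF lc] by (simp add: sum_negf)
      also have "\<dots> = z None * (\<Sum>i<s. w (c i))"
        using c(1) zNpos unfolding sum_distrib_left by (intro sum.cong) (auto simp: w_def chain_def)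
      finally have "real (cweight l) \<le> (\<Sum>i<s. w (c i))" using zNpos by simp
      moreover have "real (cweight l) = real s - (real (tau (c 0)) - 1)"
        using c(2,3) t len l[of 0] by (simp add: cweight_def of_nat_diff)
      ultimately show "real s - (real (tau (c 0)) - 1) \<le> (\<Sum>i<s. w (c i))" by simp
    qed
    also have "(\<Sum>x\<in>L. real (lookup m x) * w x) = - (\<Sum>x\<in>L. real (lookup m x) * z (Some x)) / z None"
      by (simp add: w_def sum_negf sum_divide_distrib)
    finally have "real n * z None \<le> - (\<Sum>x\<in>L. real (lookup m x) * z (Some x))"
      using zNpos by (simp add: field_simps)
    then show ?thesis using pos by linarith
  qed
qed

subsection \<open>Initial monomials of symbolic powers\<close>

text \<open>The packing scaled by q is rounded down, which loses less than one copy of each chain.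
  The loss in symbolic degree is therefore at most the sum of all \<open>cweight\<close>, whatever q
  is; the part of the monomial left over is multiplied in as it stands.\<close>

lemma asymptotic_leading:
  assumes faces: "\<And>F. face F \<Longrightarrow> n \<le> odeg F m" and mL: "keys m \<subseteq> L"
  obtains C where "\<And>q. \<exists>g \<in> (symQ (q * n - C) :: 'k::field matrix_poly set). leading antidiag_wt (scl q m) 1 g"
proof
  interpret prime_in "polys_in L" "Q :: 'k matrix_poly set" by (rule prime_in_Q)
  obtain y where y: "\<And>l. l \<in> chains \<Longrightarrow> 0 \<le> y l"
    "\<And>x. x \<in> L \<Longrightarrow> (\<Sum>l\<in>chains. if x \<in> set l then y l else 0) \<le> real (lookup m x)"
    "real n \<le> (\<Sum>l\<in>chains. y l * real (cweight l))"
    using fractional_packing[OF faces] by blast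
  show "\<exists>g \<in> (symQ (q * n - (\<Sum>l\<in>chains. cweight l)) :: 'k matrix_poly set). leading antidiag_wt (scl q m) 1 g" for q
  proof -
    define a where "a l = nat \<lfloor>real q * y l\<rfloor>" for l
    have a: "real (a l) \<le> real q * y l" "real q * y l - 1 \<le> real (a l)" if "l \<in> chains" for l
      using y(1)[OF that] by (auto simp: a_def)
    define ms where "ms = (\<Sum>l\<in>chains. \<Sum>i<a l. cmon (nth l) (length l))"
    have lms: "lookup ms x = (\<Sum>l\<in>chains. if x \<in> set l then a l else 0)" for x
    proof -
      have "lookup ms x = (\<Sum>l\<in>chains. a l * lookup (cmon (nth l) (length l)) x)"
        by (simp add: ms_def lookup_sum)
      also have "\<dots> = (\<Sum>l\<in>chains. if x \<in> set l then a l else 0)"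
      proof (rule sum.cong[OF refl])
        fix l assume "l \<in> chains"
        then have "chain (nth l) (length l)" by (simp add: chains_def)
        moreover have "set l = nth l ` {..<length l}" by (auto simp: set_conv_nth)
        ultimately show "a l * lookup (cmon (nth l) (length l)) x = (if x \<in> set l then a l else 0)"
          by (simp add: lookup_cmon)
      qed
      finally show ?thesis .
    qed
    have le: "lookup ms x \<le> lookup (scl q m) x" for x
    proof (cases "x \<in> L")
      case True
      have "real (lookup ms x) = (\<Sum>l\<in>chains. if x \<in> set l then real (a l) else 0)"
        by (simp add: lms if_distrib cong: if_cong)
      also have "\<dots> \<le> (\<Sum>l\<in>chains. real q * (if x \<in> set l then y l else 0))"
        using a(1) by (intro sum_mono) auto
      also have "\<dots> \<le> real q * real (lookup m x)"
        unfolding sum_distrib_left[symmetric] using y(2)[OF True] by (intro mult_left_mono) auto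
      finally show ?thesis by (simp flip: of_nat_mult)
    next
      case False
      have "x \<notin> set l" if "l \<in> chains" for l
        using that False by (auto simp: chains_def chain_def set_conv_nth)
      then show ?thesis by (simp add: lms)
    qed
    define rest where "rest = scl q m - ms"
    have rest: "scl q m = ms + rest"
      using le by (intro poly_mapping_eqI) (simp add: rest_def lookup_add lookup_minus)
    have restL: "keys rest \<subseteq> L"
    proof
      fix x assume "x \<in> keys rest"
      then have "lookup m x \<noteq> 0" by (intro notI) (simp add: rest_def in_keys_iff lookup_minus)
      then show "x \<in> L" using mL by (auto simp: in_keys_iff)
    qed
    define g where "g = (\<Prod>l\<in>chains. cminor (nth l) (length l) ^ a l) * (single rest 1 :: 'k matrix_poly)"
    have cl: "(cminor (nth l) (length l) :: 'k matrix_poly) ^ a l \<in> symQ (a l * cweight l)" if "l \<in> chains" for l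
    proof -
      have "(cminor (nth l) (length l) :: 'k matrix_poly) \<in> symQ (cweight l)"
        using that cminor_in_symb[of "nth l" "length l"] by (simp add: chains_def cweight_def)
      then show ?thesis by (rule symb_power)
    qed
    have "g \<in> symQ ((\<Sum>l\<in>chains. a l * cweight l) + 0)"
      unfolding g_def using cl restL
      by (intro symb_mult symb_prod finite_chains) (auto simp: symb_0 intro: polys_in_single)
    moreover have "q * n - (\<Sum>l\<in>chains. cweight l) \<le> (\<Sum>l\<in>chains. a l * cweight l)"
    proof -
      have "real (q * n) \<le> real q * (\<Sum>l\<in>chains. y l * real (cweight l))"
        unfolding of_nat_mult using y(3) by (intro mult_left_mono) auto
      also have "\<dots> \<le> (\<Sum>l\<in>chains. (real (a l) + 1) * real (cweight l))"
      proof -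
        have "real q * y l * real (cweight l) \<le> (real (a l) + 1) * real (cweight l)" if "l \<in> chains" for l
          using a(2)[OF that] by (intro mult_right_mono) auto
        then show ?thesis unfolding sum_distrib_left by (intro sum_mono) (simp add: mult.assoc)
      qed
      also have "\<dots> = real ((\<Sum>l\<in>chains. a l * cweight l) + (\<Sum>l\<in>chains. cweight l))"
        by (simp add: algebra_simps sum.distrib)
      finally show ?thesis by linarith
    qed
    ultimately have "g \<in> symQ (q * n - (\<Sum>l\<in>chains. cweight l))"
      using symb_antimono by auto
    moreover have "leading antidiag_wt (scl q m) 1 g"
    proof -
      have "leading antidiag_wt (ms + rest) ((\<Prod>l\<in>chains. 1 ^ a l) * 1) g"
        unfolding g_def ms_def
        by (intro leading_mult leading_prod leading_power leading_single leading_cminor) (simp add: chains_def)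
      then show ?thesis by (simp add: rest)
    qed
    ultimately show ?thesis by blast
  qed
qed

end

context perfect_rank_ladder
begin

theorem exists_symb_leading:
  assumes faces: "\<And>F. face F \<Longrightarrow> n \<le> odeg F m" and mL: "keys m \<subseteq> L"
  shows "\<exists>g \<in> (symQ n :: 'k matrix_poly set). leading antidiag_wt m 1 g"
proof -
  interpret prime_in "polys_in L" "Q :: 'k matrix_poly set" by (rule prime_in_Q)
  \<comment> \<open>The product of all indeterminates of \<open>L\<close>. Outside any face its
    degree is at least \<open>height_Q\<close>, because the greedy face is largest.\<close>
  define u :: "nat \<times> nat \<Rightarrow>\<^sub>0 nat" where "u = (\<Sum>x\<in>L. single x 1)"
  have lu: "lookup u x = (if x \<in> L then 1 else 0)" for x
    using finite_L by (simp add: u_def lookup_sum lookup_single when_def)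
  have "height_Q \<le> odeg F u" if "face F" for F
    using card_face_le[OF that] by (simp add: height_Q_def odeg_def lu)
  moreover have "keys u \<subseteq> L" by (auto simp: in_keys_iff lu split: if_splits)
  ultimately obtain C2 where C2: "\<And>q. \<exists>g \<in> (symQ (q * height_Q - C2) :: 'k matrix_poly set). leading antidiag_wt (scl q u) 1 g"
    using asymptotic_leading[of height_Q u] by blast
  obtain C1 where C1: "\<And>q. \<exists>g \<in> (symQ (q * n - C1) :: 'k matrix_poly set). leading antidiag_wt (scl q m) 1 g"
    using asymptotic_leading[OF faces mL] by blast
  \<comment> \<open>All that is needed is p^e > C1 + C2: the inequality of
    \<open>trace_symb\<close>, with exponents (q - 1)h - C2 and qn - C1, then holds by its slack of
    q.\<close>
  define e where "e = C1 + C2"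
  define q where "q = p ^ e"
  have "p \<ge> 2" using prime_p prime_ge_2_nat by blast
  then have "2 ^ e \<le> q" unfolding q_def by (rule power_mono) simp
  moreover have "e < 2 ^ e" by (rule less_exp)
  ultimately have qC: "C1 + C2 < q" unfolding e_def by linarith
  obtain g1 where g1: "g1 \<in> (symQ (q * n - C1) :: 'k matrix_poly set)" "leading antidiag_wt (scl q m) 1 g1"
    using C1 by blast
  obtain g2 where g2: "g2 \<in> (symQ ((q - 1) * height_Q - C2) :: 'k matrix_poly set)" "leading antidiag_wt (scl (q - 1) u) 1 g2"
    using C2 by blast
  let ?g = "trace e (scl (q - 1) u) (g2 * g1)"
  have "?g \<in> symQ n"
  proof (rule trace_symb[OF symb_mult[OF g2(1) g1(1)]])
    show "lookup (scl (q - 1) u) x < p ^ e" for x using qC by (simp add: lu flip: q_def)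
    assume "n > 0"
    then obtain n' where n: "n = Suc n'" by (cases n) auto
    obtain q' where q': "q = Suc q'" using qC by (cases q) auto
    show "p ^ e * (n - 1) + height_Q * (p ^ e - 1) < ((q - 1) * height_Q - C2) + (q * n - C1)"
      unfolding q_def[symmetric] using qC by (simp add: n q' mult.commute[of height_Q])
  qed
  moreover have "leading antidiag_wt m 1 ?g"
    using trace_leading[of antidiag_wt "scl (q - 1) u" e m "g2 * g1"] leading_mult[OF g2(2) g1(2)] by (simp add: q_def)
  ultimately show ?thesis by blast
qed

end

subsection \<open>The symbolic Rees algebra as a set of polynomials\<close>

text \<open>Stated for any finite family of functions, so that the defining inequalities of a monoid
  can be used as coordinates as well. Elements with a large value of the new function are dominated
  by the old finite set; the others fall into finitely many level sets.\<close>

lemma dickson: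
  fixes Fs :: "('a \<Rightarrow> nat) set"
  assumes "finite Fs"
  shows "\<exists>E\<subseteq>A. finite E \<and> (\<forall>x\<in>A. \<exists>e\<in>E. \<forall>f\<in>Fs. f e \<le> f x)"
  using assms
proof (induction Fs arbitrary: A rule: finite_induct)
  case empty
  show ?case
  proof (cases "A = {}")
    case False
    then obtain a where "a \<in> A" by blast
    then show ?thesis by (intro exI[of _ "{a}"]) auto
  qed auto
next
  case (insert f Fs)
  obtain E where E: "E \<subseteq> A" "finite E" "\<forall>x\<in>A. \<exists>e\<in>E. \<forall>f\<in>Fs. f e \<le> f x" using insert.IH by blast
  define N where "N = Max (insert 0 (f ` E))"
  have N: "f e \<le> N" if "e \<in> E" for e using that E(2) by (simp add: N_def)
  have "\<exists>D. \<forall>k. D k \<subseteq> {x\<in>A. f x = k} \<and> finite (D k) \<and>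
      (\<forall>x\<in>{x\<in>A. f x = k}. \<exists>e\<in>D k. \<forall>f\<in>Fs. f e \<le> f x)"
    by (intro choice allI insert.IH)
  then obtain D where "\<forall>k. D k \<subseteq> {x\<in>A. f x = k} \<and> finite (D k) \<and>
      (\<forall>x\<in>{x\<in>A. f x = k}. \<exists>e\<in>D k. \<forall>f\<in>Fs. f e \<le> f x)" by blast
  then have D: "\<And>k. D k \<subseteq> {x\<in>A. f x = k}" "\<And>k. finite (D k)"
    "\<And>k. \<forall>x\<in>{x\<in>A. f x = k}. \<exists>e\<in>D k. \<forall>f\<in>Fs. f e \<le> f x" by simp_all
  show ?case
  proof (intro exI[of _ "E \<union> (\<Union>k\<in>{..N}. D k)"] conjI ballI)
    show "E \<union> (\<Union>k\<in>{..N}. D k) \<subseteq> A" using E(1) D(1) by blast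
    show "finite (E \<union> (\<Union>k\<in>{..N}. D k))" using E(2) D(2) by simp
    fix x assume x: "x \<in> A"
    show "\<exists>e\<in>E \<union> (\<Union>k\<in>{..N}. D k). \<forall>f\<in>insert f Fs. f e \<le> f x"
    proof (cases "f x \<le> N")
      case True
      then obtain e where "e \<in> D (f x)" "\<forall>f\<in>Fs. f e \<le> f x" using D(3)[of "f x"] x by blast
      then show ?thesis using True D(1)[of "f x"] by (intro bexI[of _ e]) auto
    next
      case False
      obtain e where "e \<in> E" "\<forall>f\<in>Fs. f e \<le> f x" using E(3) x by blast
      then show ?thesis using False N[of e] by (intro bexI[of _ e]) auto
    qed
  qed
qed

abbreviation cf :: "'a::zero poly \<Rightarrow> nat \<Rightarrow> 'a" where "cf \<equiv> Polynomial.coeff"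
abbreviation mm :: "'a::zero \<Rightarrow> nat \<Rightarrow> 'a poly" where "mm \<equiv> Polynomial.monom"

definition msup :: "'k::zero matrix_poly poly \<Rightarrow> ((nat \<times> nat \<Rightarrow>\<^sub>0 nat) \<times> nat) set" where
  "msup F = {(m, n). m \<in> keys (cf F n)}"

lemma finite_msup: "finite (msup F)"
proof (rule finite_subset)
  show "msup F \<subseteq> (\<Union>n\<in>{..Polynomial.degree F}. (\<lambda>m. (m, n)) ` keys (cf F n))"
  proof
    fix x assume "x \<in> msup F"
    then obtain m n where x: "x = (m, n)" "m \<in> keys (cf F n)" by (auto simp: msup_def)
    then have "cf F n \<noteq> 0" by auto
    then have "n \<le> Polynomial.degree F" by (rule le_degree)
    then show "x \<in> (\<Union>n\<in>{..Polynomial.degree F}. (\<lambda>m. (m, n)) ` keys (cf F n))" using x by auto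
  qed
qed simp

lemma msup_empty: "msup F = {} \<longleftrightarrow> F = 0"
proof
  assume "msup F = {}"
  then have none: "m \<notin> keys (cf F n)" for m n unfolding msup_def by blast
  have "cf F n = 0" for n using none[of _ n] by (intro poly_mapping_eqI) (simp add: in_keys_iff)
  then show "F = 0" by (intro poly_eqI) simp
qed (simp add: msup_def)

context rank_ladder
begin

definition Rees_polys :: "'k::field matrix_poly poly set" where
  "Rees_polys = {F. \<forall>n. cf F n \<in> symQ n}"

text \<open>The exponents of the leading monomials of \<open>Rees_polys\<close>, the second component being the
  exponent of $T$.\<close>
definition lead_monoid :: "((nat \<times> nat \<Rightarrow>\<^sub>0 nat) \<times> nat) set" where
  "lead_monoid = {(m, n). keys m \<subseteq> L \<and> (\<forall>F. face F \<longrightarrow> n \<le> odeg F m)}"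

text \<open>T gets weight 1, so that in the Rees algebra, too, only finitely many monomials lie
  below a given weight.\<close>

definition total_wt :: "(nat \<times> nat \<Rightarrow>\<^sub>0 nat) \<times> nat \<Rightarrow> int" where
  "total_wt mu = wt antidiag_wt (fst mu) + int (snd mu)"

lemma Rees_polys_0 [simp]: "0 \<in> Rees_polys"
  by (simp add: Rees_polys_def prime_in.symb_0_mem[OF prime_in_Q])

lemma Rees_polys_1 [simp]: "1 \<in> Rees_polys"
  using prime_in.symb_0[OF prime_in_Q] prime_in.symb_0_mem[OF prime_in_Q]
  by (auto simp: Rees_polys_def coeff_1)

lemma Rees_polys_add: "F \<in> Rees_polys \<Longrightarrow> G \<in> Rees_polys \<Longrightarrow> F + G \<in> Rees_polys"
  by (simp add: Rees_polys_def prime_in.symb_add[OF prime_in_Q])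

lemma Rees_polys_uminus: "F \<in> Rees_polys \<Longrightarrow> - F \<in> Rees_polys"
  by (simp add: Rees_polys_def prime_in.symb_uminus[OF prime_in_Q])

lemma Rees_polys_minus: "F \<in> Rees_polys \<Longrightarrow> G \<in> Rees_polys \<Longrightarrow> F - G \<in> Rees_polys"
  using Rees_polys_add[OF _ Rees_polys_uminus, of F G] by simp

lemma Rees_polys_mult: "F \<in> Rees_polys \<Longrightarrow> G \<in> Rees_polys \<Longrightarrow> F * G \<in> Rees_polys"
proof -
  assume *: "F \<in> Rees_polys" "G \<in> Rees_polys"
  have "cf F i * cf G (n - i) \<in> symQ n" if "i \<le> n" for i n
    using prime_in.symb_mult[OF prime_in_Q, of "cf F i" i "cf G (n - i)" "n - i"] * that by (simp add: Rees_polys_def)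
  then show ?thesis
    by (auto simp: Rees_polys_def coeff_mult intro!: prime_in.symb_sum[OF prime_in_Q])
qed

lemma Rees_polys_sum: "(\<And>i. i \<in> I \<Longrightarrow> F i \<in> Rees_polys) \<Longrightarrow> sum F I \<in> Rees_polys"
  by (induction I rule: infinite_finite_induct) (auto intro: Rees_polys_add)

lemma Rees_polys_power: "F \<in> Rees_polys \<Longrightarrow> F ^ n \<in> Rees_polys"
  by (induction n) (auto intro: Rees_polys_mult)

lemma Rees_polys_monom: "g \<in> symQ n \<Longrightarrow> mm g n \<in> Rees_polys"
  by (simp add: Rees_polys_def prime_in.symb_0_mem[OF prime_in_Q])

lemma Rees_polys_const: "mm (pconst c) 0 \<in> Rees_polys"
  by (rule Rees_polys_monom) (simp add: prime_in.symb_0[OF prime_in_Q])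

lemma Rees_polys_msup: "F \<in> Rees_polys \<Longrightarrow> (m, n) \<in> msup F \<Longrightarrow> keys m \<subseteq> L"
  using prime_in.symb_subset[OF prime_in_Q] by (fastforce simp: Rees_polys_def msup_def polys_in_def)

lemma top_in_lead_monoid:
  assumes "F \<in> Rees_polys" "mu \<in> msup F" "\<And>nu. nu \<in> msup F \<Longrightarrow> total_wt nu \<le> total_wt mu"
  shows "mu \<in> lead_monoid"
proof -
  obtain m n where mu: "mu = (m, n)" by force
  have "top_monom m (cf F n)" using assms(2,3) by (force simp: top_monom_def mu msup_def total_wt_def)
  then have "n \<le> odeg G m" if "face G" for G
    using symb_odeg[of "cf F n" n G m] that assms(1) by (simp add: Rees_polys_def)
  then show ?thesis using Rees_polys_msup[OF assms(1), of m n] assms(2) by (auto simp: lead_monoid_def mu)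
qed

lemma odeg_add: "odeg F (m + m') = odeg F m + odeg F m'"
  by (simp add: odeg_def lookup_add sum.distrib)

lemma odeg_scl: "odeg F (scl q m) = q * odeg F m"
  by (simp add: odeg_def sum_distrib_left)

lemma finite_faces: "finite {F. face F}"
  by (rule finite_subset[of _ "Pow L"]) (auto simp: face_def finite_L)

text \<open>The exponents together with the slacks of the inequalities that define
  \<open>lead_monoid\<close>. Domination in all of them means that the difference is again in the
  monoid, which domination of exponents alone would not give.\<close>

definition mfuns :: "((nat \<times> nat \<Rightarrow>\<^sub>0 nat) \<times> nat \<Rightarrow> nat) set" where
  "mfuns = insert snd ((\<lambda>x mu. lookup (fst mu) x) ` L \<union> (\<lambda>F mu. odeg F (fst mu) - snd mu) ` {F. face F})"

lemma finite_mfuns: "finite mfuns"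
  using finite_L finite_faces by (simp add: mfuns_def)

lemma lead_monoid_diff:
  assumes "mu \<in> lead_monoid" "ep \<in> lead_monoid" "\<And>f. f \<in> mfuns \<Longrightarrow> f ep \<le> f mu"
  shows "(fst mu - fst ep, snd mu - snd ep) \<in> lead_monoid" "fst mu = fst ep + (fst mu - fst ep)"
    "snd mu = snd ep + (snd mu - snd ep)"
proof -
  have le: "snd ep \<le> snd mu" "\<And>x. x \<in> L \<Longrightarrow> lookup (fst ep) x \<le> lookup (fst mu) x"
    "\<And>F. face F \<Longrightarrow> odeg F (fst ep) - snd ep \<le> odeg F (fst mu) - snd mu"
    using assms(3) by (auto simp: mfuns_def)
  have L: "keys (fst mu) \<subseteq> L" "keys (fst ep) \<subseteq> L" using assms(1,2) by (auto simp: lead_monoid_def)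
  have le': "lookup (fst ep) x \<le> lookup (fst mu) x" for x
  proof (cases "x \<in> L")
    case False
    then have "x \<notin> keys (fst ep)" using L(2) by blast
    then show ?thesis by (simp add: in_keys_iff)
  qed (rule le(2))
  show eq: "fst mu = fst ep + (fst mu - fst ep)"
    by (rule poly_mapping_eqI) (simp add: lookup_add lookup_minus le')
  show "snd mu = snd ep + (snd mu - snd ep)" using le(1) by simp
  have "keys (fst mu - fst ep) \<subseteq> L" using L(1) by (auto simp: in_keys_iff lookup_minus subset_iff)
  moreover have "snd mu - snd ep \<le> odeg F (fst mu - fst ep)" if F: "face F" for F
  proof -
    have "odeg F (fst mu) = odeg F (fst ep) + odeg F (fst mu - fst ep)" using odeg_add eq by metis
    moreover have "snd ep \<le> odeg F (fst ep)" "snd mu \<le> odeg F (fst mu)" using assms(1,2) F by (auto simp: lead_monoid_def)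
    ultimately show ?thesis using le(1) le(3)[OF F] by linarith
  qed
  ultimately show "(fst mu - fst ep, snd mu - snd ep) \<in> lead_monoid" by (simp add: lead_monoid_def)
qed

lemma lead_monoid_finite_generation:
  assumes "A \<subseteq> lead_monoid"
  obtains E where "E \<subseteq> A" "finite E"
    "\<And>mu. mu \<in> A \<Longrightarrow> \<exists>ep\<in>E. \<exists>ze\<in>lead_monoid. fst mu = fst ep + fst ze \<and> snd mu = snd ep + snd ze"
proof -
  obtain E where E: "E \<subseteq> A" "finite E" "\<forall>x\<in>A. \<exists>e\<in>E. \<forall>f\<in>mfuns. f e \<le> f x"
    using dickson[OF finite_mfuns, of A] by blast
  have "\<exists>ep\<in>E. \<exists>ze\<in>lead_monoid. fst mu = fst ep + fst ze \<and> snd mu = snd ep + snd ze" if mu: "mu \<in> A" for mu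
  proof -
    obtain e where e: "e \<in> E" "\<forall>f\<in>mfuns. f e \<le> f mu" using E(3) mu by blast
    have "mu \<in> lead_monoid" "e \<in> lead_monoid" using mu e(1) E(1) assms by auto
    from lead_monoid_diff[OF this] e show ?thesis
      by (intro bexI[of _ e] bexI[of _ "(fst mu - fst e, snd mu - snd e)"]) auto
  qed
  then show ?thesis using that E by blast
qed

text \<open>Dickson's lemma is applied in each of the finitely many classes of exponents modulo q. A
  difference within one class is divisible by q, and its quotient stays in the monoid because the
  inequalities are homogeneous.\<close>

lemma lead_monoid_finite_mod:
  assumes q: "q > 0"
  obtains E where "E \<subseteq> lead_monoid" "finite E"
    "\<And>mu. mu \<in> lead_monoid \<Longrightarrow> \<exists>ep\<in>E. \<exists>ze\<in>lead_monoid. fst mu = scl q (fst ze) + fst ep \<and> snd mu = q * snd ze + snd ep"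
proof -
  define r where "r mu = (\<lambda>x. if x \<in> L then lookup (fst mu) x mod q else undefined, snd mu mod q)"
    for mu :: "(nat \<times> nat \<Rightarrow>\<^sub>0 nat) \<times> nat"
  have "r ` lead_monoid \<subseteq> (L \<rightarrow>\<^sub>E {..<q}) \<times> {..<q}" using q by (auto simp: r_def PiE_def extensional_def)
  then have fin: "finite (r ` lead_monoid)" by (rule finite_subset) (simp add: finite_L finite_PiE)
  have "\<exists>E. \<forall>c. E c \<subseteq> {mu\<in>lead_monoid. r mu = c} \<and> finite (E c) \<and>
      (\<forall>x\<in>{mu\<in>lead_monoid. r mu = c}. \<exists>e\<in>E c. \<forall>f\<in>mfuns. f e \<le> f x)"
    by (intro choice allI dickson finite_mfuns)
  then obtain E where "\<forall>c. E c \<subseteq> {mu\<in>lead_monoid. r mu = c} \<and> finite (E c) \<and>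
      (\<forall>x\<in>{mu\<in>lead_monoid. r mu = c}. \<exists>e\<in>E c. \<forall>f\<in>mfuns. f e \<le> f x)" by blast
  then have E: "E c \<subseteq> {mu\<in>lead_monoid. r mu = c}" "finite (E c)"
    "\<forall>x\<in>{mu\<in>lead_monoid. r mu = c}. \<exists>e\<in>E c. \<forall>f\<in>mfuns. f e \<le> f x" for c by blast+
  have "\<exists>ep\<in>\<Union>c\<in>r ` lead_monoid. E c. \<exists>ze\<in>lead_monoid. fst mu = scl q (fst ze) + fst ep \<and> snd mu = q * snd ze + snd ep"
    if mu: "mu \<in> lead_monoid" for mu
  proof -
    obtain e where e: "e \<in> E (r mu)" "\<forall>f\<in>mfuns. f e \<le> f mu" using E(3)[of "r mu"] mu by blast
    have eM: "e \<in> lead_monoid" "r e = r mu" using subsetD[OF E(1) e(1)] by simp_all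
    define d where "d = fst mu - fst e"
    have d: "(d, snd mu - snd e) \<in> lead_monoid" "fst mu = fst e + d" "snd mu = snd e + (snd mu - snd e)"
      using lead_monoid_diff[OF mu eM(1)] e(2) by (auto simp: d_def)
    have dL: "keys d \<subseteq> L" using d(1) by (simp add: lead_monoid_def)
    have "q dvd lookup d x" for x
    proof (cases "x \<in> L")
      case True
      have "lookup (fst e) x mod q = lookup (fst mu) x mod q" using eM(2) True by (auto simp: r_def dest: fun_cong[of _ _ x])
      moreover have "lookup (fst mu) x = lookup (fst e) x + lookup d x" using d(2) by (metis lookup_add)
      ultimately show ?thesis by (metis add_diff_cancel_left' le_add1 mod_eq_dvd_iff_nat)
    next
      case False
      then have "x \<notin> keys d" using dL by blast
      then show ?thesis by (simp add: in_keys_iff)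
    qed
    note dx = this
    define z where "z = Poly_Mapping.map (\<lambda>n. n div q) d"
    have z: "scl q z = d"
    proof (rule poly_mapping_eqI)
      fix x show "lookup (scl q z) x = lookup d x"
        using dx[of x] by (simp add: z_def map.rep_eq when_def)
    qed
    have "snd e mod q = snd mu mod q" using eM(2) by (simp add: r_def)
    then have "q dvd snd mu - snd e" using d(3) by (metis le_add1 mod_eq_dvd_iff_nat)
    then obtain k where k: "snd mu - snd e = q * k" by (auto elim: dvdE)
    have "(z, k) \<in> lead_monoid"
    proof -
      have "keys z \<subseteq> L" using dL z keys_scl[OF q, of z] by simp
      moreover have "k \<le> odeg F z" if "face F" for F
      proof -
        have "q * k \<le> odeg F d" using d(1) that k by (auto simp: lead_monoid_def)
        then show ?thesis using q by (simp add: z[symmetric] odeg_scl)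
      qed
      ultimately show ?thesis by (simp add: lead_monoid_def)
    qed
    moreover have "fst mu = scl q z + fst e" "snd mu = q * k + snd e" using d(2,3) z k by (simp_all add: add.commute)
    moreover have "e \<in> (\<Union>c\<in>r ` lead_monoid. E c)" using e(1) mu by blast
    ultimately show ?thesis by (metis fst_conv snd_conv)
  qed
  moreover have "(\<Union>c\<in>r ` lead_monoid. E c) \<subseteq> lead_monoid" using E(1) by blast
  moreover have "finite (\<Union>c\<in>r ` lead_monoid. E c)" using fin E(2) by blast
  ultimately show ?thesis using that by blast
qed

end

context perfect_rank_ladder
begin

definition lead_lift :: "(nat \<times> nat \<Rightarrow>\<^sub>0 nat) \<times> nat \<Rightarrow> 'k matrix_poly" where
  "lead_lift mu = (SOME g. g \<in> symQ (snd mu) \<and> leading antidiag_wt (fst mu) 1 g)"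

lemma lead_lift:
  assumes "mu \<in> lead_monoid"
  shows "lead_lift mu \<in> symQ (snd mu)" "leading antidiag_wt (fst mu) 1 (lead_lift mu)"
proof -
  have "\<exists>g. g \<in> (symQ (snd mu) :: 'k matrix_poly set) \<and> leading antidiag_wt (fst mu) 1 g"
    using exists_symb_leading[of "snd mu" "fst mu"] assms by (auto simp: lead_monoid_def)
  then show "lead_lift mu \<in> symQ (snd mu)" "leading antidiag_wt (fst mu) 1 (lead_lift mu)"
    unfolding lead_lift_def by (metis (mono_tags, lifting) someI_ex)+
qed

lemma CHAR_mpoly: "CHAR('k matrix_poly poly) = p"
  using char_p by (simp add: CHAR_mpol)

lemma frob_add_poly: "(a + b) ^ p ^ e = a ^ p ^ e + (b ^ p ^ e :: 'k matrix_poly poly)"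
  by (rule freshmans_dream') (use prime_p CHAR_mpoly in simp_all)

lemma frob_sum_poly: "(sum F I) ^ p ^ e = (\<Sum>i\<in>I. F i ^ p ^ e :: 'k matrix_poly poly)"
proof (induction I rule: infinite_finite_induct)
  case (insert x I) then show ?case by (simp add: frob_add_poly)
qed (use p_pos in \<open>simp_all add: power_0_left\<close>)

lemma total_wt_nonneg: "F \<in> Rees_polys \<Longrightarrow> mu \<in> msup F \<Longrightarrow> 0 \<le> total_wt mu" for F :: "'k matrix_poly poly"
proof -
  assume "F \<in> Rees_polys" "mu \<in> msup F"
  then have "keys (fst mu) \<subseteq> L" using Rees_polys_msup[of F "fst mu" "snd mu"] by simp
  then have "0 \<le> wt antidiag_wt (fst mu)" unfolding wt_def using antidiag_wt_pos by (fastforce intro!: sum_nonneg)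
  then show ?thesis by (simp add: total_wt_def)
qed

text \<open>Top terms are removed by downward induction on the weight. A leading exponent is p times
  an element of the monoid plus one of finitely many \<open>ep\<close>, so the p-th power of one
  lift times the lift of \<open>ep\<close> cancels it. Additivity of Frobenius merges the
  multipliers that belong to the same \<open>ep\<close>.\<close>

lemma Rees_polys_F_finite:
  "\<exists>A\<subseteq>Rees_polys. finite A \<and> (\<forall>F\<in>(Rees_polys :: 'k matrix_poly poly set). \<exists>s. (\<forall>a\<in>A. s a \<in> Rees_polys) \<and> F = (\<Sum>a\<in>A. s a ^ p * a))"
proof -
  obtain E where E: "E \<subseteq> lead_monoid" "finite E" and Ez:
    "\<And>mu. mu \<in> lead_monoid \<Longrightarrow> \<exists>ep\<in>E. \<exists>ze\<in>lead_monoid. fst mu = scl p (fst ze) + fst ep \<and> snd mu = p * snd ze + snd ep"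
    using lead_monoid_finite_mod[OF p_pos] by blast
  define b where "b mu = mm (lead_lift mu) (snd mu)" for mu
  have bB: "b mu \<in> Rees_polys" if "mu \<in> lead_monoid" for mu using Rees_polys_monom[OF lead_lift(1)[OF that]] by (simp add: b_def)
  have frob: "(x + y) ^ p = x ^ p + y ^ p" for x y :: "'k matrix_poly poly" using frob_add_poly[of x y 1] by simp
  have main: "\<exists>s. (\<forall>ep\<in>E. s ep \<in> Rees_polys) \<and> F = (\<Sum>ep\<in>E. s ep ^ p * b ep)"
    if "F \<in> Rees_polys" "\<forall>mu\<in>msup F. total_wt mu < int N" for F N
    using that
  proof (induction N arbitrary: F)
    case 0
    then have "msup F = {}" using total_wt_nonneg[OF 0(1)] by force
    then have "F = 0" by (simp add: msup_empty)
    then show ?case using p_pos by (intro exI[of _ "\<lambda>_. 0"]) (simp add: power_0_left)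
  next
    case (Suc N)
    define K where "K = {mu\<in>msup F. total_wt mu = int N}"
    have fK: "finite K" using finite_msup[of F] by (simp add: K_def)
    have KM: "K \<subseteq> lead_monoid"
      using top_in_lead_monoid[OF Suc.prems(1)] Suc.prems(2) by (force simp: K_def)
    have "\<forall>mu\<in>K. \<exists>ep ze. ep \<in> E \<and> ze \<in> lead_monoid \<and> fst mu = scl p (fst ze) + fst ep \<and> snd mu = p * snd ze + snd ep"
      using Ez KM by blast
    then obtain ep ze where ez: "\<And>mu. mu \<in> K \<Longrightarrow> ep mu \<in> E" "\<And>mu. mu \<in> K \<Longrightarrow> ze mu \<in> lead_monoid"
      "\<And>mu. mu \<in> K \<Longrightarrow> fst mu = scl p (fst (ze mu)) + fst (ep mu)"
      "\<And>mu. mu \<in> K \<Longrightarrow> snd mu = p * snd (ze mu) + snd (ep mu)" by metis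
    define c where "c mu = lookup (cf F (snd mu)) (fst mu)" for mu
    \<comment> \<open>The coefficient enters as its p-th root, since the multiplier will be raised
      to the power p.\<close>
    define u where "u mu = mm (pconst (rt 1 (c mu)) * lead_lift (ze mu)) (snd (ze mu))" for mu
    have uB: "u mu \<in> Rees_polys" if "mu \<in> K" for mu
      unfolding u_def using prime_in.symb_smult[OF prime_in_Q polys_in_const lead_lift(1)[OF ez(2)[OF that]]] by (rule Rees_polys_monom)
    define s where "s e = (\<Sum>mu\<in>{mu\<in>K. ep mu = e}. u mu)" for e
    have sB: "s e \<in> Rees_polys" for e unfolding s_def using uB by (intro Rees_polys_sum) auto
    have "s e ^ p * b e = (\<Sum>mu\<in>{mu\<in>K. ep mu = e}. u mu ^ p * b (ep mu))" for e
    proof -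
      have "s e ^ p = (\<Sum>mu\<in>{mu\<in>K. ep mu = e}. u mu ^ p)"
        unfolding s_def using frob_sum_poly[of u "{mu\<in>K. ep mu = e}" 1] by simp
      then show ?thesis by (simp add: sum_distrib_right)
    qed
    then have tot: "(\<Sum>e\<in>E. s e ^ p * b e) = (\<Sum>mu\<in>K. u mu ^ p * b (ep mu))"
      using sum.group[OF fK E(2), of ep "\<lambda>mu. u mu ^ p * b (ep mu)"] ez(1) by (simp add: image_subset_iff)
    define h where "h mu = (pconst (rt 1 (c mu)) * lead_lift (ze mu)) ^ p * lead_lift (ep mu)" for mu
    have ub: "u mu ^ p * b (ep mu) = mm (h mu) (snd mu)" if "mu \<in> K" for mu
      using ez(4)[OF that] by (simp add: u_def b_def h_def monom_power mult_monom ac_simps)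
    have lead_h: "leading antidiag_wt (fst mu) (c mu) (h mu)" if mu: "mu \<in> K" for mu
    proof -
      have e: "ep mu \<in> lead_monoid" using ez(1)[OF mu] E by auto
      have "leading antidiag_wt ((\<Sum>i<p. fst (ze mu)) + fst (ep mu)) ((rt 1 (c mu) * 1) ^ p * 1) (h mu)"
        unfolding h_def by (intro leading_mult leading_power leading_const_mult lead_lift ez(2) mu e)
      moreover have "(\<Sum>i<p. fst (ze mu)) = scl p (fst (ze mu))"
        by (intro poly_mapping_eqI) (simp add: lookup_sum)
      ultimately show ?thesis using ez(3)[OF mu] rt_power[of 1 "c mu"] by simp
    qed
    define F' where "F' = F - (\<Sum>e\<in>E. s e ^ p * b e)"
    have F'B: "F' \<in> Rees_polys"
      unfolding F'_def using sB bB E(1) by (intro Rees_polys_minus Suc.prems Rees_polys_sum Rees_polys_mult Rees_polys_power) auto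
    have cfF': "cf F' n = cf F n - (\<Sum>mu\<in>{mu\<in>K. snd mu = n}. h mu)" for n
    proof -
      have "cf (\<Sum>mu\<in>K. u mu ^ p * b (ep mu)) n = (\<Sum>mu\<in>K. if snd mu = n then h mu else 0)"
        unfolding coeff_sum by (intro sum.cong) (simp_all add: ub)
      also have "\<dots> = (\<Sum>mu\<in>{mu\<in>K. snd mu = n}. h mu)" using fK by (simp add: sum.inter_filter)
      finally show ?thesis by (simp add: F'_def tot)
    qed
    have "\<forall>mu\<in>msup F'. total_wt mu < int N"
    proof
      fix mu assume mu: "mu \<in> msup F'"
      obtain m n where mn: "mu = (m, n)" by force
      define Kn where "Kn = {mu\<in>K. snd mu = n}"
      have "cf F' n = (cf F n - (\<Sum>nu\<in>Kn. single (fst nu) (c nu))) - (\<Sum>nu\<in>Kn. h nu - single (fst nu) (c nu))"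
        by (simp add: cfF' Kn_def sum_subtractf)
      moreover have "wt_less antidiag_wt (int N - int n) (\<Sum>nu\<in>Kn. h nu - single (fst nu) (c nu))"
      proof (rule wt_less_sum)
        fix nu assume "nu \<in> Kn"
        then have "nu \<in> K" "wt antidiag_wt (fst nu) = int N - int n" by (auto simp: Kn_def K_def total_wt_def)
        then show "wt_less antidiag_wt (int N - int n) (h nu - single (fst nu) (c nu))"
          using lead_h[of nu] by (simp add: leading_def)
      qed
      moreover have "wt_less antidiag_wt (int N - int n) (cf F n - (\<Sum>nu\<in>Kn. single (fst nu) (c nu)))"
      proof -
        have "(\<Sum>nu\<in>Kn. single (fst nu) (c nu)) = (\<Sum>m\<in>{m\<in>keys (cf F n). wt antidiag_wt m = int N - int n}. single m (lookup (cf F n) m))"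
          by (rule sum.reindex_bij_witness[of _ "\<lambda>m. (m, n)" fst])
            (auto simp: Kn_def K_def msup_def total_wt_def c_def)
        then have eq: "(\<Sum>nu\<in>Kn. single (fst nu) (c nu)) = poly_part (\<lambda>m. wt antidiag_wt m = int N - int n) (cf F n)"
          by (simp add: poly_part_def)
        show ?thesis
          unfolding eq wt_less_def
        proof
          fix e assume "e \<in> keys (cf F n - poly_part (\<lambda>m. wt antidiag_wt m = int N - int n) (cf F n))"
          then have e: "e \<in> keys (cf F n)" "wt antidiag_wt e \<noteq> int N - int n"
            by (auto simp: in_keys_iff lookup_minus lookup_poly_part split: if_splits)
          then have "(e, n) \<in> msup F" by (simp add: msup_def)
          then have "total_wt (e, n) < int (Suc N)" using Suc.prems(2) by blast
          then show "wt antidiag_wt e < int N - int n" using e(2) by (simp add: total_wt_def)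
        qed
      qed
      ultimately have "wt_less antidiag_wt (int N - int n) (cf F' n)" by (simp only: wt_less_minus)
      then show "total_wt mu < int N" using mu by (force simp: mn msup_def wt_less_def total_wt_def)
    qed
    from Suc.IH[OF F'B this] obtain t where t: "\<forall>ep\<in>E. t ep \<in> Rees_polys" "F' = (\<Sum>ep\<in>E. t ep ^ p * b ep)" by blast
    have "F = F' + (\<Sum>e\<in>E. s e ^ p * b e)" by (simp add: F'_def)
    also have "\<dots> = (\<Sum>e\<in>E. (t e + s e) ^ p * b e)"
      by (simp add: t(2) frob distrib_right sum.distrib)
    finally show ?case using t(1) sB by (intro exI[of _ "\<lambda>e. t e + s e"]) (auto intro: Rees_polys_add)
  qed
  have fin: "\<exists>N. \<forall>mu\<in>msup F. total_wt mu < int N" for F :: "'k matrix_poly poly"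
  proof -
    have "total_wt mu < int (\<Sum>mu\<in>msup F. nat (total_wt mu) + 1)" if "mu \<in> msup F" for mu
    proof -
      have "nat (total_wt mu) + 1 \<le> (\<Sum>mu\<in>msup F. nat (total_wt mu) + 1)"
        using that finite_msup by (intro member_le_sum) auto
      then show ?thesis by linarith
    qed
    then show ?thesis by blast
  qed
  show ?thesis
  proof (intro exI[of _ "b ` E"] conjI ballI)
    show "b ` E \<subseteq> Rees_polys" using bB E(1) by auto
    show "finite (b ` E)" using E(2) by simp
    fix F :: "'k matrix_poly poly" assume "F \<in> Rees_polys"
    then obtain s where s: "\<forall>ep\<in>E. s ep \<in> Rees_polys" "F = (\<Sum>ep\<in>E. s ep ^ p * b ep)" using main fin by blast
    \<comment> \<open>Distinct indices might have the same lift, so the multipliers of equal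
      generators are added up.\<close>
    define t where "t a = (\<Sum>ep\<in>{ep\<in>E. b ep = a}. s ep)" for a
    have tp: "t a ^ p * a = (\<Sum>ep\<in>{ep\<in>E. b ep = a}. s ep ^ p * b ep)" for a
      unfolding t_def using frob_sum_poly[of s "{ep\<in>E. b ep = a}" 1] by (simp add: sum_distrib_right)
    have "F = (\<Sum>a\<in>b ` E. t a ^ p * a)"
      unfolding s(2) tp using sum.image_gen[OF E(2), of "\<lambda>ep. s ep ^ p * b ep" b] by simp
    moreover have "\<forall>a\<in>b ` E. t a \<in> Rees_polys" unfolding t_def using s(1) by (auto intro: Rees_polys_sum)
    ultimately show "\<exists>s. (\<forall>a\<in>b ` E. s a \<in> Rees_polys) \<and> F = (\<Sum>a\<in>b ` E. s a ^ p * a)" by blast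
  qed
qed

end

subsection \<open>Noetherianity and the splitting\<close>

type_synonym bimon = "(nat \<times> nat \<Rightarrow>\<^sub>0 nat) \<times> nat"

context perfect_rank_ladder
begin

text \<open>Ties in the weight are broken by the order on exponents, so that the reduction in
  \<open>Rees_polys_noetherian\<close> has a single leading term.\<close>

definition bikey :: "bimon \<Rightarrow> int \<times> (nat \<times> nat \<Rightarrow>\<^sub>0 nat) \<times> nat" where
  "bikey mu = (total_wt mu, fst mu, snd mu)"

definition bplus :: "bimon \<Rightarrow> bimon \<Rightarrow> bimon" where
  "bplus mu nu = (fst mu + fst nu, snd mu + snd nu)"

definition isLM :: "bimon \<Rightarrow> 'k \<Rightarrow> 'k matrix_poly poly \<Rightarrow> bool" where
  "isLM mu c F \<longleftrightarrow> c \<noteq> 0 \<and> lookup (cf F (snd mu)) (fst mu) = c \<and> (\<forall>nu\<in>msup F. bikey nu \<le> bikey mu)"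

lemma bikey_inj: "bikey mu = bikey nu \<Longrightarrow> mu = nu"
  by (simp add: bikey_def prod_eq_iff)

lemma total_wt_bplus: "total_wt (bplus mu nu) = total_wt mu + total_wt nu"
  by (simp add: total_wt_def bplus_def wt_add)

lemma bikey_bplus_mono: "bikey mu \<le> bikey nu \<Longrightarrow> bikey (bplus la mu) \<le> bikey (bplus la nu)"
  by (cases mu; cases nu; cases la) (auto simp: bikey_def total_wt_bplus, auto simp: bplus_def add_left_mono)

lemma bikey_total_wt_less: "total_wt mu < total_wt nu \<Longrightarrow> bikey mu \<le> bikey nu"
  by (simp add: bikey_def)

lemma isLM_exists: "F \<noteq> 0 \<Longrightarrow> \<exists>mu c. isLM mu c F \<and> mu \<in> msup F"
proof -
  assume "F \<noteq> 0"
  then have ne: "finite (bikey ` msup F)" "bikey ` msup F \<noteq> {}" using finite_msup[of F] by (auto simp: msup_empty)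
  then obtain mu where mu: "mu \<in> msup F" "bikey mu = Max (bikey ` msup F)" using Max_in by (metis imageE)
  have "bikey nu \<le> bikey mu" if "nu \<in> msup F" for nu using Max_ge[OF ne(1)] that mu(2) by simp
  moreover have "lookup (cf F (snd mu)) (fst mu) \<noteq> 0" using mu(1) by (auto simp: msup_def in_keys_iff)
  ultimately show ?thesis using mu(1) unfolding isLM_def by blast
qed

lemma isLM_top: "isLM mu c F \<Longrightarrow> mu \<in> msup F \<and> (\<forall>nu\<in>msup F. total_wt nu \<le> total_wt mu)"
  by (cases mu) (fastforce simp: isLM_def msup_def in_keys_iff bikey_def)

text \<open>The factor \<open>g\<close> leads strictly in weight, so ties occur only among terms of
  \<open>F\<close> times the leading monomial of \<open>g\<close>, where the tie-breaking order is
  compatible with addition.\<close>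

lemma isLM_monom_mult:
  assumes g: "leading antidiag_wt (fst mu) 1 g" and F: "isLM nu c F"
  shows "isLM (bplus mu nu) c (mm g (snd mu) * F)"
proof -
  define g' where "g' = g - single (fst mu) 1"
  have g': "wt_less antidiag_wt (wt antidiag_wt (fst mu)) g'" using g by (simp add: leading_def g'_def)
  have cfm: "cf (mm g (snd mu) * F) (snd mu + n) = g * cf F n" for n
    by (simp add: coeff_monom_mult)
  have "lookup (g' * cf F (snd nu)) (fst mu + fst nu) = 0"
  proof (rule ccontr)
    assume "\<not> ?thesis"
    then have "fst mu + fst nu \<in> keys (g' * cf F (snd nu))" by (simp add: in_keys_iff)
    then obtain a b where ab: "fst mu + fst nu = a + b" "a \<in> keys g'" "b \<in> keys (cf F (snd nu))"
      using keys_mult by blast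
    have "(b, snd nu) \<in> msup F" using ab(3) by (simp add: msup_def)
    then have "total_wt (b, snd nu) \<le> total_wt nu" using isLM_top[OF F] by blast
    then have "wt antidiag_wt b \<le> wt antidiag_wt (fst nu)" by (simp add: total_wt_def)
    moreover have "wt antidiag_wt a < wt antidiag_wt (fst mu)" using g' ab(2) by (simp add: wt_less_def)
    moreover have "wt antidiag_wt (fst mu) + wt antidiag_wt (fst nu) = wt antidiag_wt a + wt antidiag_wt b" using ab(1) by (metis wt_add)
    ultimately show False by linarith
  qed
  moreover have "g * cf F (snd nu) = single (fst mu) 1 * cf F (snd nu) + g' * cf F (snd nu)"
    by (simp add: g'_def algebra_simps)
  ultimately have "lookup (g * cf F (snd nu)) (fst mu + fst nu) = c"
    using F by (simp add: lookup_add lookup_single_mult isLM_def)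
  moreover have "bikey la \<le> bikey (bplus mu nu)" if la: "la \<in> msup (mm g (snd mu) * F)" for la
  proof -
    obtain e k where lk: "la = (e, k)" "e \<in> keys (cf (mm g (snd mu) * F) k)" using la by (auto simp: msup_def)
    then have "\<not> k < snd mu" by (auto simp: coeff_monom_mult)
    then obtain k' where k: "k = snd mu + k'" by (metis le_add_diff_inverse not_le)
    have "e \<in> keys (g * cf F k')" using lk(2) by (simp add: k cfm)
    then obtain a b where ab: "e = a + b" "a \<in> keys g" "b \<in> keys (cf F k')" using keys_mult by blast
    have b: "(b, k') \<in> msup F" using ab(3) by (simp add: msup_def)
    have la': "la = bplus (a, snd mu) (b, k')" by (simp add: lk(1) k ab(1) bplus_def)
    from leading_keys[OF g ab(2)] show ?thesis
    proof
      assume "a = fst mu"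
      then have "la = bplus mu (b, k')" by (simp add: la')
      then show ?thesis using bikey_bplus_mono[of "(b, k')" nu mu] F b by (auto simp: isLM_def)
    next
      assume "wt antidiag_wt a < wt antidiag_wt (fst mu)"
      moreover have "total_wt (b, k') \<le> total_wt nu" using isLM_top[OF F] b by blast
      ultimately have "total_wt la < total_wt (bplus mu nu)" unfolding la' total_wt_bplus by (simp add: total_wt_def)
      then show ?thesis by (rule bikey_total_wt_less)
    qed
  qed
  ultimately show ?thesis using F cfm[of "snd nu"] by (simp add: isLM_def bplus_def)
qed

section \<open>Noetherianity\<close>

definition bspan :: "'k matrix_poly poly set \<Rightarrow> 'k matrix_poly poly set" where
  "bspan A = {F. \<exists>s. (\<forall>a\<in>A. s a \<in> Rees_polys) \<and> F = (\<Sum>a\<in>A. s a * a)}"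

lemma bspan_add: "F \<in> bspan A \<Longrightarrow> G \<in> bspan A \<Longrightarrow> F + G \<in> bspan A"
proof -
  assume "F \<in> bspan A" "G \<in> bspan A"
  then obtain s t where "\<forall>a\<in>A. s a \<in> Rees_polys" "F = (\<Sum>a\<in>A. s a * a)" "\<forall>a\<in>A. t a \<in> Rees_polys" "G = (\<Sum>a\<in>A. t a * a)"
    by (auto simp: bspan_def)
  then show ?thesis unfolding bspan_def
    by (intro CollectI exI[of _ "\<lambda>a. s a + t a"]) (auto simp: distrib_right sum.distrib intro: Rees_polys_add)
qed

lemma bspan_mult: "H \<in> Rees_polys \<Longrightarrow> F \<in> bspan A \<Longrightarrow> H * F \<in> bspan A"
proof -
  assume H: "H \<in> Rees_polys" "F \<in> bspan A"
  then obtain s where "\<forall>a\<in>A. s a \<in> Rees_polys" "F = (\<Sum>a\<in>A. s a * a)" by (auto simp: bspan_def)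
  then show ?thesis using H unfolding bspan_def
    by (intro CollectI exI[of _ "\<lambda>a. H * s a"]) (auto simp: sum_distrib_left mult.assoc intro: Rees_polys_mult)
qed

lemma bspan_gen: "finite A \<Longrightarrow> a \<in> A \<Longrightarrow> a \<in> bspan A"
  unfolding bspan_def
  by (intro CollectI exI[of _ "\<lambda>x. if x = a then 1 else 0"]) (auto simp: if_distrib if_distribR cong: if_cong)

lemma finite_bounded_monomials: "finite {mu. keys (fst mu) \<subseteq> L \<and> total_wt mu \<le> N}"
proof -
  define bd where "bd = nat N"
  have "{mu. keys (fst mu) \<subseteq> L \<and> total_wt mu \<le> N} \<subseteq> {m. keys m \<subseteq> L \<and> (\<forall>x. lookup m x \<le> bd)} \<times> {..bd}"
  proof
    fix mu assume mu: "mu \<in> {mu. keys (fst mu) \<subseteq> L \<and> total_wt mu \<le> N}"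
    have nn: "0 \<le> int (lookup (fst mu) x) * antidiag_wt x" if "x \<in> L" for x using antidiag_wt_pos[OF that] by simp
    have wts: "wt antidiag_wt (fst mu) = (\<Sum>x\<in>L. int (lookup (fst mu) x) * antidiag_wt x)"
      using mu finite_L by (intro wt_superset) auto
    have "0 \<le> wt antidiag_wt (fst mu)" unfolding wts by (rule sum_nonneg[OF nn])
    then have "int (snd mu) \<le> N" using mu by (simp add: total_wt_def)
    then have sn: "snd mu \<le> bd" by (simp add: bd_def)
    have "lookup (fst mu) x \<le> bd" for x
    proof (cases "x \<in> L")
      case True
      have "int (lookup (fst mu) x) * 1 \<le> int (lookup (fst mu) x) * antidiag_wt x"
        using antidiag_wt_pos[OF True] by (intro mult_left_mono) auto
      also have "\<dots> \<le> wt antidiag_wt (fst mu)" unfolding wts using nn finite_L True by (intro member_le_sum) auto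
      also have "\<dots> \<le> N" using mu by (simp add: total_wt_def)
      finally show ?thesis by (simp add: bd_def)
    next
      case False
      then have "x \<notin> keys (fst mu)" using mu by blast
      then show ?thesis by (simp add: in_keys_iff)
    qed
    then show "mu \<in> {m. keys m \<subseteq> L \<and> (\<forall>x. lookup m x \<le> bd)} \<times> {..bd}" using sn mu by (cases mu) auto
  qed
  moreover have "finite {m :: nat \<times> nat \<Rightarrow>\<^sub>0 nat. keys m \<subseteq> L \<and> (\<forall>x. lookup m x \<le> bd)}"
  proof (rule finite_imageD)
    let ?h = "\<lambda>m. \<lambda>x. if x \<in> L then lookup m x else undefined"
    show "finite (?h ` {m. keys m \<subseteq> L \<and> (\<forall>x. lookup m x \<le> bd)})"
    proof (rule finite_subset)
      show "?h ` {m. keys m \<subseteq> L \<and> (\<forall>x. lookup m x \<le> bd)} \<subseteq> (L \<rightarrow>\<^sub>E {..bd})"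
        by (auto simp: PiE_def extensional_def)
      show "finite (L \<rightarrow>\<^sub>E {..bd})" by (intro finite_PiE finite_L) simp
    qed
    show "inj_on ?h {m. keys m \<subseteq> L \<and> (\<forall>x. lookup m x \<le> bd)}"
    proof (rule inj_onI)
      fix m m' assume *: "m \<in> {m. keys m \<subseteq> L \<and> (\<forall>x. lookup m x \<le> bd)}" "m' \<in> {m. keys m \<subseteq> L \<and> (\<forall>x. lookup m x \<le> bd)}" "?h m = ?h m'"
      show "m = m'"
      proof (rule poly_mapping_eqI)
        fix x show "lookup m x = lookup m' x"
        proof (cases "x \<in> L")
          case True then show ?thesis using fun_cong[OF *(3), of x] by simp
        next
          case False
          then have "x \<notin> keys m" "x \<notin> keys m'" using * by blast+
          then show ?thesis by (simp add: in_keys_iff)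
        qed
      qed
    qed
  qed
  ultimately show ?thesis using finite_subset by blast
qed

text \<open>Division with respect to leading monomials. Those of \<open>J\<close> are finitely
  generated over \<open>lead_monoid\<close>, and every element of this monoid is realised by a lift
  in the Rees algebra, so each leading term of \<open>J\<close> can be cancelled inside the
  algebra.\<close>

lemma Rees_polys_noetherian:
  assumes J: "J \<subseteq> Rees_polys" and J0: "0 \<in> J" and Jadd: "\<And>F G. F \<in> J \<Longrightarrow> G \<in> J \<Longrightarrow> F + G \<in> J"
    and Jmult: "\<And>H F. H \<in> Rees_polys \<Longrightarrow> F \<in> J \<Longrightarrow> H * F \<in> J"
  shows "\<exists>A\<subseteq>J. finite A \<and> J \<subseteq> bspan A"
proof -
  define LMs where "LMs = {mu. \<exists>F\<in>J. \<exists>c. isLM mu c F}"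
  have "LMs \<subseteq> lead_monoid" using top_in_lead_monoid isLM_top J unfolding LMs_def by blast
  then obtain E where E: "E \<subseteq> LMs" "finite E"
    "\<And>mu. mu \<in> LMs \<Longrightarrow> \<exists>ep\<in>E. \<exists>ze\<in>lead_monoid. fst mu = fst ep + fst ze \<and> snd mu = snd ep + snd ze"
    using lead_monoid_finite_generation by metis
  have "\<forall>ep\<in>E. \<exists>F. F \<in> J \<and> (\<exists>c. isLM ep c F)" using E(1) unfolding LMs_def by blast
  then obtain G where G: "\<And>ep. ep \<in> E \<Longrightarrow> G ep \<in> J" "\<And>ep. ep \<in> E \<Longrightarrow> \<exists>c. isLM ep c (G ep)" by metis
  define A where "A = G ` E"
  have A: "A \<subseteq> J" "finite A" using G(1) E(2) by (auto simp: A_def)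
  \<comment> \<open>Termination is measured by the number of monomials up to \<open>mu\<close>,
    finite because the weight is compared first and is positive on every indeterminate.\<close>
  define dn where "dn mu = {nu. keys (fst nu) \<subseteq> L \<and> bikey nu \<le> bikey mu}" for mu
  have dnfin: "finite (dn mu)" for mu
    by (rule finite_subset[OF _ finite_bounded_monomials[of "total_wt mu"]]) (auto simp: dn_def bikey_def)
  have main: "F \<in> bspan A" if "F \<in> J" "isLM mu c F" for F mu c
    using that
  proof (induction "card (dn mu)" arbitrary: F mu c rule: less_induct)
    case less
    have muL: "mu \<in> LMs" using less.prems by (auto simp: LMs_def)
    obtain ep ze where ez: "ep \<in> E" "ze \<in> lead_monoid" "fst mu = fst ep + fst ze" "snd mu = snd ep + snd ze"
      using E(3)[OF muL] by blast
    obtain d where d: "isLM ep d (G ep)" using G(2)[OF ez(1)] by blast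
    define H where "H = mm (lead_lift ze) (snd ze)"
    have HB: "H \<in> Rees_polys" unfolding H_def by (rule Rees_polys_monom[OF lead_lift(1)[OF ez(2)]])
    have mu: "mu = bplus ze ep" using ez(3,4) by (simp add: bplus_def prod_eq_iff add.commute)
    have LMH: "isLM mu d (H * G ep)" unfolding mu H_def by (rule isLM_monom_mult[OF lead_lift(2)[OF ez(2)] d])
    have d0: "d \<noteq> 0" using d by (simp add: isLM_def)
    define R where "R = mm (pconst (c / d)) 0 * (H * G ep)"
    have RJ: "R \<in> J" unfolding R_def using Rees_polys_const HB G(1)[OF ez(1)] by (intro Jmult)
    have Rspan: "R \<in> bspan A" unfolding R_def
      using Rees_polys_const HB bspan_gen[OF A(2), of "G ep"] ez(1) by (intro bspan_mult) (auto simp: A_def)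
    have cfR: "lookup (cf R n) m = c / d * lookup (cf (H * G ep) n) m" for n m
      using lookup_single_mult[of 0 "c / d" "cf (H * G ep) n" m]
      by (simp add: R_def coeff_monom_mult pconst_def)
    define F' where "F' = F - R"
    have F'J: "F' \<in> J"
    proof -
      have "- R = mm (pconst (- 1)) 0 * R"
        by (intro poly_eqI) (simp add: coeff_monom_mult)
      then have "- R \<in> J" using Jmult[OF Rees_polys_const RJ] by metis
      then show ?thesis using Jadd[OF less.prems(1), of "- R"] by (simp add: F'_def)
    qed
    have sub: "msup F' \<subseteq> msup F \<union> msup (H * G ep)"
      by (auto simp: msup_def F'_def in_keys_iff lookup_minus cfR)
    have "F' \<in> bspan A"
    proof (cases "F' = 0")
      case True
      then show ?thesis unfolding bspan_def by (intro CollectI exI[of _ "\<lambda>_. 0"]) simp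
    next
      case False
      then obtain nu c' where nu: "isLM nu c' F'" "nu \<in> msup F'" using isLM_exists by blast
      have le: "bikey nu \<le> bikey mu" using sub nu(2) less.prems(2) LMH by (auto simp: isLM_def)
      have "nu \<noteq> mu"
      proof
        assume "nu = mu"
        then have "lookup (cf F' (snd mu)) (fst mu) \<noteq> 0" using nu(1) by (auto simp: isLM_def)
        moreover have "lookup (cf F' (snd mu)) (fst mu) = c - c / d * d"
          using less.prems(2) LMH by (simp add: F'_def lookup_minus cfR isLM_def)
        ultimately show False using d0 by simp
      qed
      then have lt: "bikey nu < bikey mu" using le bikey_inj by (metis le_less)
      have "mu \<in> dn mu"
      proof -
        have "mu \<in> lead_monoid" using muL \<open>LMs \<subseteq> lead_monoid\<close> by blast
        then show ?thesis by (auto simp: dn_def lead_monoid_def)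
      qed
      moreover have "mu \<notin> dn nu" using lt by (auto simp: dn_def)
      moreover have "dn nu \<subseteq> dn mu" using le by (auto simp: dn_def)
      ultimately have "card (dn nu) < card (dn mu)" using dnfin by (intro psubset_card_mono) auto
      from less.hyps[OF this F'J nu(1)] show ?thesis .
    qed
    then show ?case using bspan_add[OF _ Rspan, of F'] by (simp add: F'_def)
  qed
  have "J \<subseteq> bspan A"
  proof
    fix F assume F: "F \<in> J"
    show "F \<in> bspan A"
    proof (cases "F = 0")
      case True
      then show ?thesis unfolding bspan_def by (intro CollectI exI[of _ "\<lambda>_. 0"]) simp
    next
      case False
      then show ?thesis using isLM_exists main F by blast
    qed
  qed
  then show ?thesis using A by blast
qed

lemma Rees_polys_splitting:
  fixes c :: "'k matrix_poly poly"
  assumes c: "c \<in> Rees_polys" "c \<noteq> 0"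
  shows "\<exists>e>0. \<exists>Phi. (\<forall>F\<in>Rees_polys. Phi F \<in> Rees_polys) \<and> (\<forall>F\<in>Rees_polys. \<forall>G\<in>Rees_polys. Phi (F + G) = Phi F + Phi G) \<and>
    (\<forall>s\<in>Rees_polys. \<forall>F\<in>Rees_polys. Phi (s ^ p ^ e * F) = s * Phi F) \<and> Phi c = 1"
proof -
  interpret prime_in "polys_in L" "Q :: 'k matrix_poly set" by (rule prime_in_Q)
  obtain mu a where mu: "isLM mu a c" using isLM_exists[OF c(2)] by blast
  obtain m n where mn: "mu = (m, n)" by force
  have top: "(m, n) \<in> msup c" "\<And>nu. nu \<in> msup c \<Longrightarrow> total_wt nu \<le> total_wt (m, n)" using isLM_top[OF mu] by (auto simp: mn)
  have a: "a \<noteq> 0" "lookup (cf c n) m = a" using mu by (auto simp: isLM_def mn)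
  have mM: "keys m \<subseteq> L" "\<And>F. face F \<Longrightarrow> n \<le> odeg F m" using top_in_lead_monoid[OF c(1) top] by (auto simp: lead_monoid_def)
  \<comment> \<open>Then q exceeds n plus the degree of \<open>m\<close>: so \<open>m\<close>
    divides \<open>rho\<close>, its degree outside a face is at most q - 1, and n is a residue
    modulo q. The \<open>Suc\<close> makes e positive.\<close>
  define e where "e = Suc (n + (\<Sum>x\<in>L. lookup m x))"
  define q where "q = p ^ e"
  have "p \<ge> 2" using prime_p prime_ge_2_nat by blast
  then have "2 ^ e \<le> q" unfolding q_def by (rule power_mono) simp
  moreover have "e < 2 ^ e" by (rule less_exp)
  ultimately have q: "n + (\<Sum>x\<in>L. lookup m x) < q" unfolding e_def by linarith
  have q0: "q > 0" using q by simp
  have mq: "lookup m x < q" if "x \<in> L" for x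
    using member_le_sum[OF that, of "lookup m"] finite_L q by simp
  define u :: "nat \<times> nat \<Rightarrow>\<^sub>0 nat" where "u = (\<Sum>x\<in>L. single x 1)"
  have lu: "lookup u x = (if x \<in> L then 1 else 0)" for x
    using finite_L by (simp add: u_def lookup_sum lookup_single when_def)
  define rho where "rho = scl (q - 1) u"
  have rho: "lookup rho x = (if x \<in> L then q - 1 else 0)" for x by (simp add: rho_def lu)
  have rhoq: "lookup rho x < p ^ e" for x using q0 by (simp add: rho flip: q_def)
  have lmx: "x \<notin> L \<Longrightarrow> lookup m x = 0" for x using mM(1) by (auto simp: in_keys_iff)
  have rhom: "rho = (rho - m) + m"
  proof (rule poly_mapping_eqI)
    fix x show "lookup rho x = lookup (rho - m + m) x"
      using mq[of x] lmx[of x] by (cases "x \<in> L") (simp_all add: lookup_add lookup_minus rho)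
  qed
  have kr: "keys (rho - m) \<subseteq> L" by (auto simp: in_keys_iff lookup_minus rho split: if_splits)
  \<comment> \<open>Outside a face \<open>rho\<close> has degree at least h(q - 1), and
    \<open>m\<close> takes away at most q - 1. For h = 0 the truncated subtraction makes the bound
    0.\<close>
  have "(height_Q - 1) * (q - 1) - n \<le> odeg F (rho - m)" if F: "face F" for F
  proof -
    have "odeg F rho = card (L - F) * (q - 1)" by (simp add: odeg_def rho)
    moreover have "odeg F rho = odeg F (rho - m) + odeg F m" using rhom odeg_add by metis
    moreover have "height_Q \<le> card (L - F)" using card_face_le[OF F] by (simp add: height_Q_def)
    then have "height_Q * (q - 1) \<le> card (L - F) * (q - 1)" by (rule mult_le_mono1)
    moreover have "odeg F m \<le> q - 1"
    proof -
      have "odeg F m \<le> (\<Sum>x\<in>L. lookup m x)" unfolding odeg_def using finite_L by (intro sum_mono2) auto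
      then show ?thesis using q by linarith
    qed
    moreover have "height_Q = 0 \<or> (height_Q - 1) * (q - 1) + (q - 1) = height_Q * (q - 1)"
      by (cases height_Q) simp_all
    ultimately show ?thesis by (elim disjE) (simp, linarith)
  qed
  then obtain g :: "'k matrix_poly" where g: "g \<in> symQ ((height_Q - 1) * (q - 1) - n)" "leading antidiag_wt (rho - m) 1 g"
    using exists_symb_leading[of "(height_Q - 1) * (q - 1) - n" "rho - m"] kr by blast
  \<comment> \<open>The trace extended to T: among powers of T only those with exponent congruent to
    n modulo q survive, because the leading monomial of \<open>c\<close> carries T^n.\<close>
  define Ph where "Ph F = Abs_poly (\<lambda>i. trace e rho (g * cf F (q * i + n)))" for F :: "'k matrix_poly poly"
  have cPh: "cf (Ph F) i = trace e rho (g * cf F (q * i + n))" for F i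
  proof -
    have "trace e rho (g * cf F (q * i + n)) = 0" if "i > Polynomial.degree F" for i
    proof -
      have "i \<le> q * i" using q0 by simp
      then have "Polynomial.degree F < q * i + n" using that by linarith
      then show ?thesis by (simp add: coeff_eq_0)
    qed
    then show ?thesis unfolding Ph_def by (subst coeff_Abs_poly) auto
  qed
  have PhB: "Ph F \<in> Rees_polys" if F: "F \<in> Rees_polys" for F
    unfolding Rees_polys_def
  proof (intro CollectI allI)
    fix i
    have "g * cf F (q * i + n) \<in> symQ (((height_Q - 1) * (q - 1) - n) + (q * i + n))"
      using F by (intro symb_mult g) (simp add: Rees_polys_def)
    then show "cf (Ph F) i \<in> symQ i"
      unfolding cPh
    proof (rule trace_symb[OF _ rhoq])
      assume "i > 0"
      then obtain i' where i: "i = Suc i'" by (cases i) auto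
      obtain q' where q': "q = Suc q'" using q0 by (cases q) auto
      \<comment> \<open>The left side falls short by at least 1: (h - 1)(q - 1) + qi exceeds q(i -
        1) + h(q - 1) by exactly q - (q - 1) when h is positive.\<close>
      show "p ^ e * (i - 1) + height_Q * (p ^ e - 1) < (height_Q - 1) * (q - 1) - n + (q * i + n)"
        unfolding q_def[symmetric] by (cases height_Q) (simp_all add: i q')
    qed
  qed
  have Phadd: "Ph (F + G) = Ph F + Ph G" for F G
    by (intro poly_eqI) (simp add: cPh distrib_left trace_add)
  have Phmon: "Ph (mm s j ^ q * F) = mm s j * Ph F" for s j F
  proof (rule poly_eqI)
    fix i
    show "cf (Ph (mm s j ^ q * F)) i = cf (mm s j * Ph F) i"
    proof (cases "j \<le> i")
      case True
      then obtain k where k: "i = j + k" using le_Suc_ex by blast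
      have "q * i + n - j * q = q * k + n" "\<not> q * i + n < j * q" by (simp_all add: k algebra_simps)
      then have "cf (mm s j ^ q * F) (q * i + n) = s ^ q * cf F (q * k + n)"
        by (simp only: monom_power coeff_monom_mult if_False)
      then have "cf (Ph (mm s j ^ q * F)) i = trace e rho (s ^ q * (g * cf F (q * k + n)))"
        by (simp add: cPh mult_ac)
      also have "\<dots> = s * trace e rho (g * cf F (q * k + n))" unfolding q_def by (rule trace_mult[OF rhoq])
      finally show ?thesis by (simp add: coeff_monom_mult k cPh)
    next
      case False
      then have "q * Suc i \<le> q * j" by (intro mult_le_mono2) simp
      then have "q * i + n < j * q" using q by (simp add: mult.commute)
      then have "cf (mm s j ^ q * F) (q * i + n) = 0"
        by (simp only: monom_power coeff_monom_mult if_True)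
      then show ?thesis using False by (simp add: cPh coeff_monom_mult)
    qed
  qed
  have Phlin: "Ph (s ^ q * F) = s * Ph F" for s F
  proof -
    have "Ph ((\<Sum>j\<in>I. mm (cf s j) j) ^ q * F) = (\<Sum>j\<in>I. mm (cf s j) j) * Ph F" if "finite I" for I
      using that
    proof (induction I)
      case empty
      have "Ph 0 = 0" by (intro poly_eqI) (simp add: cPh)
      then show ?case using q0 by (simp add: power_0_left)
    next
      case (insert j I)
      then show ?case
        by (simp add: frob_add_poly[of _ _ e, folded q_def] distrib_right Phadd Phmon)
    qed
    from this[of "{..Polynomial.degree s}"] show ?thesis by (simp add: poly_as_sum_of_monoms)
  qed
  have Phc: "Ph c = mm (pconst (rt e a)) 0"
  proof (rule poly_eqI, rule poly_mapping_eqI)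
    fix i z
    have lkc: "lookup (cf (Ph c) i) z = rt e (lookup (g * cf c (q * i + n)) (rho + scl q z))"
      by (simp add: cPh lookup_trace q_def)
    \<comment> \<open>No term of g c outweighs rho T^n, so a surviving exponent (z, i) has weight at
      most 0. Weights being positive, only the constant term is left.\<close>
    have key: "i = 0 \<and> z = 0" if "lookup (cf (Ph c) i) z \<noteq> 0"
    proof -
      have zk: "z \<in> keys (cf (Ph c) i)" using that by (simp add: in_keys_iff)
      then have zL: "keys z \<subseteq> L" using Rees_polys_msup[OF PhB[OF c(1)], of z i] by (simp add: msup_def)
      have "rho + scl q z \<in> keys (g * cf c (q * i + n))" using that lkc by (auto simp: in_keys_iff)
      then obtain b m' where bm: "rho + scl q z = b + m'" "b \<in> keys g" "m' \<in> keys (cf c (q * i + n))"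
        using keys_mult by blast
      have "total_wt (m', q * i + n) \<le> total_wt (m, n)" using bm(3) by (intro top(2)) (simp add: msup_def)
      then have "wt antidiag_wt m' + int (q * i) \<le> wt antidiag_wt m" by (simp add: total_wt_def)
      moreover have "wt antidiag_wt b \<le> wt antidiag_wt (rho - m)" using leading_keys[OF g(2) bm(2)] by auto
      moreover have "wt antidiag_wt rho + int q * wt antidiag_wt z = wt antidiag_wt b + wt antidiag_wt m'"
        using arg_cong[OF bm(1), of "wt antidiag_wt"] by (simp add: wt_add wt_scl)
      moreover have "wt antidiag_wt rho = wt antidiag_wt (rho - m) + wt antidiag_wt m" using arg_cong[OF rhom, of "wt antidiag_wt"] by (simp add: wt_add)
      ultimately have le: "int q * wt antidiag_wt z + int (q * i) \<le> 0" by linarith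
      have wz: "0 \<le> wt antidiag_wt z" unfolding wt_def using zL antidiag_wt_pos by (fastforce intro!: sum_nonneg)
      have i0: "i = 0"
      proof (rule ccontr)
        assume "i \<noteq> 0"
        then have "0 < int (q * i)" using q0 by (simp del: of_nat_mult)
        moreover have "0 \<le> int q * wt antidiag_wt z" using wz by simp
        ultimately show False using le by linarith
      qed
      then have "int q * wt antidiag_wt z \<le> 0" using le by simp
      then have wz0: "wt antidiag_wt z = 0" using wz q0 by (simp add: mult_le_0_iff)
      have "z = 0"
      proof (rule ccontr)
        assume "z \<noteq> 0"
        then obtain x where x: "x \<in> keys z" by (metis in_keys_iff poly_mapping_eqI lookup_zero)
        have "0 < antidiag_wt x" using subsetD[OF zL x] antidiag_wt_pos[of x] by simp
        then have "0 < int (lookup z x) * antidiag_wt x" using x by (simp add: in_keys_iff)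
        also have "\<dots> \<le> wt antidiag_wt z" unfolding wt_def
          using x zL antidiag_wt_pos by (intro member_le_sum) (fastforce simp: subset_iff)+
        finally show False using wz0 by simp
      qed
      then show ?thesis using i0 by simp
    qed
    show "lookup (cf (Ph c) i) z = lookup (cf (mm (pconst (rt e a)) 0) i) z"
    proof (cases "i = 0 \<and> z = 0")
      case True
      \<comment> \<open>At \<open>rho\<close> itself the product g c has coefficient
        \<open>a\<close>: terms of \<open>g\<close> below its leading monomial would need terms of
        \<open>c\<close> above \<open>m\<close>.\<close>
      define g' where "g' = g - single (rho - m) 1"
      have "lookup (g' * cf c n) rho = 0"
      proof (rule ccontr)
        assume "\<not> ?thesis"
        then have "rho \<in> keys (g' * cf c n)" by (simp add: in_keys_iff)
        then obtain b m' where bm: "rho = b + m'" "b \<in> keys g'" "m' \<in> keys (cf c n)" using keys_mult by blast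
        have "total_wt (m', n) \<le> total_wt (m, n)" using bm(3) by (intro top(2)) (simp add: msup_def)
        then have "wt antidiag_wt m' \<le> wt antidiag_wt m" by (simp add: total_wt_def)
        moreover have "wt antidiag_wt b < wt antidiag_wt (rho - m)" using g(2) bm(2) by (simp add: leading_def wt_less_def g'_def)
        moreover have "wt antidiag_wt rho = wt antidiag_wt b + wt antidiag_wt m'" using bm(1) by (metis wt_add)
        moreover have "wt antidiag_wt rho = wt antidiag_wt (rho - m) + wt antidiag_wt m" using arg_cong[OF rhom, of "wt antidiag_wt"] by (simp add: wt_add)
        ultimately show False by linarith
      qed
      moreover have "g * cf c n = single (rho - m) 1 * cf c n + g' * cf c n" by (simp add: g'_def algebra_simps)
      moreover have "lookup (single (rho - m) 1 * cf c n) rho = a"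
        using lookup_single_mult[of "rho - m" 1 "cf c n" m] a(2) rhom by simp
      ultimately have "lookup (g * cf c n) rho = a" by (simp add: lookup_add)
      then show ?thesis using True lkc by (simp add: pconst_def)
    next
      case False
      then have "lookup (cf (Ph c) i) z = 0" using key by blast
      moreover have "lookup (cf (mm (pconst (rt e a)) 0) i) z = 0"
        using False by (auto simp: pconst_def lookup_single when_def)
      ultimately show ?thesis by simp
    qed
  qed
  have ra: "rt e a \<noteq> 0" using a(1) by (simp add: rt_eq_0)
  \<comment> \<open>The constant term is the root of the leading coefficient of \<open>c\<close>;
    scaling by its inverse gives the value 1.\<close>
  define K where "K = mm (pconst (inverse (rt e a)) :: 'k matrix_poly) 0"
  have KB: "K \<in> Rees_polys" unfolding K_def by (rule Rees_polys_const)
  have "K * Ph c = 1"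
  proof -
    have "pconst (inverse (rt e a)) * pconst (rt e a) = (1 :: 'k matrix_poly)"
      using ra by (simp flip: pconst_simps(4))
    then show ?thesis unfolding Phc K_def by (simp add: mult_monom)
  qed
  moreover have "K * Ph (s ^ p ^ e * F) = s * (K * Ph F)" for s F
    using Phlin[of s F] by (simp add: q_def mult_ac)
  ultimately show ?thesis
    using PhB Rees_polys_mult[OF KB] Phadd
    by (intro exI[of _ e] conjI exI[of _ "\<lambda>F. K * Ph F"]) (auto simp: e_def distrib_left)
qed

end

subsection \<open>Transfer to the algebra library\<close>

text \<open>An isomorphism from a subring \<open>B\<close> of a domain given as a type onto
  \<open>R\<close>. It allows computing with class operations; elements of \<open>UP\<close> are
  coefficient functions, hence \<open>phi\<close> cannot simply be the identity.\<close>

locale ring_model =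
  fixes R :: "('a, 'm) ring_scheme" (structure) and B :: "'b::idom set" and phi :: "'b \<Rightarrow> 'a"
  assumes inj: "inj_on phi B" and carr: "carrier R = phi ` B"
    and phi_add: "\<lbrakk>x \<in> B; y \<in> B\<rbrakk> \<Longrightarrow> phi (x + y) = phi x \<oplus> phi y"
    and phi_mult: "\<lbrakk>x \<in> B; y \<in> B\<rbrakk> \<Longrightarrow> phi (x * y) = phi x \<otimes> phi y"
    and phi_0: "phi 0 = \<zero>" and phi_1: "phi 1 = \<one>"
    and B_0: "0 \<in> B" and B_1: "1 \<in> B"
    and B_add: "\<lbrakk>x \<in> B; y \<in> B\<rbrakk> \<Longrightarrow> x + y \<in> B" and B_uminus: "x \<in> B \<Longrightarrow> - x \<in> B"
    and B_mult: "\<lbrakk>x \<in> B; y \<in> B\<rbrakk> \<Longrightarrow> x * y \<in> B"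
begin

lemma phi_carr [intro]: "x \<in> B \<Longrightarrow> phi x \<in> carrier R"
  by (simp add: carr)

lemma carrE: "a \<in> carrier R \<Longrightarrow> (\<And>x. x \<in> B \<Longrightarrow> a = phi x \<Longrightarrow> thesis) \<Longrightarrow> thesis"
  by (auto simp: carr)

lemma phi_eq_iff: "x \<in> B \<Longrightarrow> y \<in> B \<Longrightarrow> phi x = phi y \<longleftrightarrow> x = y"
  using inj by (auto simp: inj_on_def)

lemma cring_R: "cring R"
proof (intro cringI abelian_groupI comm_monoidI)
  show "\<zero> \<in> carrier R" using phi_carr[OF B_0] by (simp add: phi_0)
  show "\<one> \<in> carrier R" using phi_carr[OF B_1] by (simp add: phi_1)
next
  fix a assume "a \<in> carrier R"
  then show "\<zero> \<oplus> a = a" using phi_add[OF B_0] by (elim carrE) (simp add: phi_0)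
next
  fix a assume "a \<in> carrier R"
  then show "\<one> \<otimes> a = a" using phi_mult[OF B_1] by (elim carrE) (simp add: phi_1)
next
  fix a assume "a \<in> carrier R"
  then obtain x where x: "x \<in> B" "a = phi x" by (rule carrE)
  show "\<exists>b\<in>carrier R. b \<oplus> a = \<zero>"
    using phi_add[OF B_uminus[OF x(1)] x(1)] x B_uminus by (intro bexI[of _ "phi (- x)"]) (auto simp: phi_0)
next
  fix a b assume "a \<in> carrier R" "b \<in> carrier R"
  then obtain x y where x: "x \<in> B" "a = phi x" "y \<in> B" "b = phi y" by (elim carrE) auto
  show "a \<oplus> b \<in> carrier R" "a \<otimes> b \<in> carrier R" "a \<oplus> b = b \<oplus> a" "a \<otimes> b = b \<otimes> a"
    using x B_add B_mult by (auto simp flip: phi_add phi_mult simp: add.commute mult.commute)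
next
  fix a b c assume "a \<in> carrier R" "b \<in> carrier R" "c \<in> carrier R"
  then obtain x y z where x: "x \<in> B" "a = phi x" "y \<in> B" "b = phi y" "z \<in> B" "c = phi z" by (elim carrE) auto
  have "(a \<oplus> b) \<oplus> c = phi (x + y + z)" "a \<oplus> (b \<oplus> c) = phi (x + (y + z))"
    "(a \<otimes> b) \<otimes> c = phi (x * y * z)" "a \<otimes> (b \<otimes> c) = phi (x * (y * z))"
    "(a \<oplus> b) \<otimes> c = phi ((x + y) * z)" "(a \<otimes> c) \<oplus> (b \<otimes> c) = phi (x * z + y * z)"
    using x by (simp_all add: phi_add phi_mult B_add B_mult)
  then show "(a \<oplus> b) \<oplus> c = a \<oplus> (b \<oplus> c)" "(a \<otimes> b) \<otimes> c = a \<otimes> (b \<otimes> c)"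
    "(a \<oplus> b) \<otimes> c = a \<otimes> c \<oplus> b \<otimes> c"
    by (simp_all add: algebra_simps)
qed

lemma domain_R: "domain R"
proof (rule domain.intro[OF cring_R domain_axioms.intro])
  show "\<one> \<noteq> \<zero>" using phi_eq_iff[OF B_1 B_0] by (simp add: phi_0 phi_1)
  fix a b assume "a \<otimes> b = \<zero>" "a \<in> carrier R" "b \<in> carrier R"
  then obtain x y where x: "x \<in> B" "a = phi x" "y \<in> B" "b = phi y" "phi (x * y) = phi 0"
    by (elim carrE) (auto simp: phi_mult phi_0)
  then have "x * y = 0" using phi_eq_iff[OF B_mult B_0] by simp
  then show "a = \<zero> \<or> b = \<zero>" using x by (auto simp: phi_0)
qed

lemma B_power: "x \<in> B \<Longrightarrow> x ^ n \<in> B"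
  by (induction n) (auto intro: B_1 B_mult)

lemma B_sum: "(\<And>i. i \<in> I \<Longrightarrow> f i \<in> B) \<Longrightarrow> sum f I \<in> B"
  by (induction I rule: infinite_finite_induct) (auto intro: B_0 B_add)

lemma phi_power: "x \<in> B \<Longrightarrow> phi (x ^ n) = phi x [^] n"
proof (induction n)
  case 0
  interpret cring R by (rule cring_R)
  show ?case by (simp add: phi_1)
next
  case (Suc n)
  interpret cring R by (rule cring_R)
  show ?case using Suc by (simp add: phi_mult B_power mult.commute[of x])
qed

lemma phi_sum: "finite I \<Longrightarrow> (\<And>i. i \<in> I \<Longrightarrow> f i \<in> B) \<Longrightarrow> phi (sum f I) = (\<Oplus>i\<in>I. phi (f i))"
proof (induction I rule: finite_induct)
  case empty
  interpret cring R by (rule cring_R)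
  show ?case by (simp add: phi_0)
next
  case (insert i I)
  interpret cring R by (rule cring_R)
  show ?case using insert by (simp add: phi_add B_sum phi_carr Pi_def)
qed

lemma phi_of_nat: "of_nat n \<in> B \<and> phi (of_nat n) = [n] \<cdot> \<one>"
proof (induction n)
  case 0
  interpret cring R by (rule cring_R)
  show ?case by (simp add: B_0 phi_0)
next
  case (Suc n)
  interpret cring R by (rule cring_R)
  show ?case using Suc phi_add[of 1 "of_nat n"] by (simp add: B_add B_1 phi_1 add.m_comm)
qed

lemma strongly_F_regular_if:
  assumes p: "Factorial_Ring.prime p" and char: "CHAR('b) = p"
    and noeth: "\<And>J. \<lbrakk>J \<subseteq> B; 0 \<in> J; \<And>x y. x \<in> J \<Longrightarrow> y \<in> J \<Longrightarrow> x + y \<in> J; \<And>x y. x \<in> B \<Longrightarrow> y \<in> J \<Longrightarrow> x * y \<in> J\<rbrakk>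
        \<Longrightarrow> \<exists>A\<subseteq>J. finite A \<and> (\<forall>x\<in>J. \<exists>s. (\<forall>a\<in>A. s a \<in> B) \<and> x = (\<Sum>a\<in>A. s a * a))"
    and ffin: "\<exists>A\<subseteq>B. finite A \<and> (\<forall>x\<in>B. \<exists>s. (\<forall>a\<in>A. s a \<in> B) \<and> x = (\<Sum>a\<in>A. s a ^ p * a))"
    and split: "\<And>c. c \<in> B \<Longrightarrow> c \<noteq> 0 \<Longrightarrow> \<exists>e>0. \<exists>Phi. (\<forall>x\<in>B. Phi x \<in> B) \<and>
        (\<forall>x\<in>B. \<forall>y\<in>B. Phi (x + y) = Phi x + Phi y) \<and> (\<forall>s\<in>B. \<forall>x\<in>B. Phi (s ^ p ^ e * x) = s * Phi x) \<and> Phi c = 1"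
  shows "strongly_F_regular p R"
proof -
  interpret domain R by (rule domain_R)
  have frob: "(x + y) ^ p ^ e = x ^ p ^ e + (y ^ p ^ e :: 'b)" for x y e
    by (rule freshmans_dream') (use p char in simp_all)
  have "noetherian_ring R"
  proof (rule noetherian_ringI)
    fix J assume J: "ideal J R"
    then interpret J: ideal J R .
    define K where "K = {x\<in>B. phi x \<in> J}"
    have "\<exists>A\<subseteq>K. finite A \<and> (\<forall>x\<in>K. \<exists>s. (\<forall>a\<in>A. s a \<in> B) \<and> x = (\<Sum>a\<in>A. s a * a))"
      by (rule noeth) (auto simp: K_def B_0 phi_0 phi_add phi_mult B_add B_mult phi_carr
          intro: J.a_closed J.I_l_closed)
    then obtain A where A: "A \<subseteq> K" "finite A" "\<And>x. x \<in> K \<Longrightarrow> \<exists>s. (\<forall>a\<in>A. s a \<in> B) \<and> x = (\<Sum>a\<in>A. s a * a)"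
      by blast
    have AB: "A \<subseteq> B" "phi ` A \<subseteq> J" using A(1) by (auto simp: K_def)
    then have Ac: "phi ` A \<subseteq> carrier R" by auto
    interpret I: ideal "Idl (phi ` A)" R by (rule genideal_ideal[OF Ac])
    have "J \<subseteq> Idl (phi ` A)"
    proof
      fix b assume b: "b \<in> J"
      obtain x where x: "x \<in> B" "b = phi x" by (rule carrE[OF J.Icarr[OF b]])
      then obtain s where s: "\<forall>a\<in>A. s a \<in> B" "x = (\<Sum>a\<in>A. s a * a)" using A(3)[of x] b by (auto simp: K_def)
      have "phi (\<Sum>a\<in>D. s a * a) \<in> Idl (phi ` A)" if "D \<subseteq> A" for D
        using finite_subset[OF that A(2)] that
      proof (induction D rule: finite_induct)
        case empty then show ?case by (simp add: phi_0)
      next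
        case (insert a D)
        then have aA: "a \<in> A" "a \<in> B" "s a \<in> B" using AB s by auto
        have "(\<Sum>a\<in>D. s a * a) \<in> B" using insert.prems AB s by (intro B_sum B_mult) auto
        then have "phi (\<Sum>a\<in>insert a D. s a * a) = phi (s a) \<otimes> phi a \<oplus> phi (\<Sum>a\<in>D. s a * a)"
          using insert.hyps aA by (simp add: phi_add phi_mult B_mult)
        moreover have "phi a \<in> Idl (phi ` A)" using genideal_self[OF Ac] aA by auto
        ultimately show ?case using insert aA by (auto intro!: I.a_closed I.I_l_closed)
      qed
      then show "b \<in> Idl (phi ` A)" using s x by auto
    qed
    moreover have "Idl (phi ` A) \<subseteq> J" using genideal_minimal[OF J AB(2)] .
    ultimately show "\<exists>A\<subseteq>carrier R. finite A \<and> J = Idl A" using Ac A(2) by blast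
  qed
  moreover have "reduced_ring R"
    unfolding reduced_ring_def
  proof (intro ballI allI impI)
    fix a and n :: nat assume "a \<in> carrier R" and a: "a [^] n = \<zero>"
    then obtain x where x: "x \<in> B" "a = phi x" by (elim carrE)
    then have "phi (x ^ n) = phi 0" using a by (simp add: phi_power phi_0)
    then have "x ^ n = 0" using phi_eq_iff[OF B_power[OF x(1)] B_0] by simp
    then show "a = \<zero>" using x by (auto simp: phi_0)
  qed
  moreover have "has_characteristic R p"
    unfolding has_characteristic_def
  proof
    fix n :: nat
    have "[n] \<cdot> \<one> = \<zero> \<longleftrightarrow> phi (of_nat n) = phi 0" using phi_of_nat by (simp add: phi_0)
    also have "\<dots> \<longleftrightarrow> of_nat n = (0 :: 'b)" using phi_of_nat B_0 by (intro phi_eq_iff) auto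
    also have "\<dots> \<longleftrightarrow> p dvd n" by (simp add: of_nat_eq_0_iff_char_dvd char)
    finally show "[n] \<cdot> \<one> = \<zero> \<longleftrightarrow> p dvd n" .
  qed
  moreover have "F_finite p R"
  proof -
    obtain A where A: "A \<subseteq> B" "finite A" "\<And>x. x \<in> B \<Longrightarrow> \<exists>s. (\<forall>a\<in>A. s a \<in> B) \<and> x = (\<Sum>a\<in>A. s a ^ p * a)"
      using ffin by blast
    let ?M = "frobenius_root p 1 R"
    \<comment> \<open>A finite sum depends only on carrier, addition and zero, which
      \<open>frobenius_root\<close> leaves unchanged.\<close>
    have fs: "finsum ?M f I = finsum R f I" for f :: "'a \<Rightarrow> 'a" and I
      by (simp add: finsum_def finprod_def frobenius_root_def)
    have injA: "inj_on phi A" using inj A(1) by (rule inj_on_subset)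
    have "\<exists>t\<in>phi ` A \<rightarrow> carrier R. b = (\<Oplus>\<^bsub>?M\<^esub>a\<in>phi ` A. t a \<odot>\<^bsub>?M\<^esub> a)" if b: "b \<in> carrier R" for b
    proof -
      obtain x where x: "x \<in> B" "b = phi x" by (rule carrE[OF b])
      obtain s where s: "\<forall>a\<in>A. s a \<in> B" "x = (\<Sum>a\<in>A. s a ^ p * a)" using A(3)[OF x(1)] by blast
      define t where "t a = phi (s (inv_into A phi a))" for a
      have t: "t (phi a) = phi (s a)" if "a \<in> A" for a using inv_into_f_f[OF injA that] by (simp add: t_def)
      have tc: "t \<in> phi ` A \<rightarrow> carrier R" using s by (auto simp: t phi_carr)
      have trm: "t (phi a) [^] p \<otimes> phi a = phi (s a ^ p * a)" if "a \<in> A" for a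
        using that s A(1) by (simp add: t phi_mult phi_power B_power subset_iff)
      have inB: "s a ^ p * a \<in> B" if "a \<in> A" for a using that s A(1) by (auto intro: B_mult B_power)
      have "b = (\<Oplus>a\<in>A. phi (s a ^ p * a))"
        unfolding x(2) s(2) using A(2) inB by (intro phi_sum) auto
      also have "\<dots> = (\<Oplus>a\<in>A. t (phi a) [^] p \<otimes> phi a)"
        using trm inB by (intro finsum_cong') (auto simp: phi_carr)
      also have "\<dots> = (\<Oplus>a\<in>phi ` A. t a [^] p \<otimes> a)"
        using injA by (intro finsum_reindex[symmetric]) (auto simp: trm inB phi_carr)
      finally have "b = (\<Oplus>\<^bsub>?M\<^esub>a\<in>phi ` A. t a \<odot>\<^bsub>?M\<^esub> a)" unfolding fs by (simp add: frobenius_root_def)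
      then show ?thesis using tc by blast
    qed
    moreover have "phi ` A \<subseteq> carrier ?M" "finite (phi ` A)" "carrier ?M = carrier R"
      using A by (auto simp: frobenius_root_def)
    ultimately show ?thesis unfolding F_finite_def finitely_generated_module_def
      by (intro exI[of _ "phi ` A"]) simp
  qed
  moreover have "\<exists>e>0. linear_map_splits R (self_module R) (frobenius_root p e R) (\<lambda>s. s \<odot>\<^bsub>frobenius_root p e R\<^esub> c)"
    if c: "c \<in> carrier R" "\<forall>P\<in>minimal_primes R {\<zero>}. c \<notin> P" for c
  proof -
    \<comment> \<open>In a domain the zero ideal is the only minimal prime, so the condition on
      \<open>c\<close> is that it is nonzero.\<close>
    have "c \<noteq> \<zero>" using c(2) minimal_primes_primeideal[OF zeroprimeideal] by auto
    then obtain x where x: "x \<in> B" "c = phi x" "x \<noteq> 0" using c(1) phi_0 by (elim carrE) auto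
    obtain e Phi where e: "e > 0" and PB: "\<forall>x\<in>B. Phi x \<in> B" and Pa: "\<forall>x\<in>B. \<forall>y\<in>B. Phi (x + y) = Phi x + Phi y"
      and Pl: "\<forall>s\<in>B. \<forall>x\<in>B. Phi (s ^ p ^ e * x) = s * Phi x" and Pc: "Phi x = 1"
      using split[OF x(1,3)] by blast
    define psi where "psi = inv_into B phi"
    have psi: "psi (phi y) = y" if "y \<in> B" for y using inv_into_f_f[OF inj that] by (simp add: psi_def)
    define g where "g a = phi (Phi (psi a))" for a
    let ?M = "frobenius_root p e R"
    have f: "(\<lambda>s. s \<odot>\<^bsub>?M\<^esub> c) \<in> linear_maps R (self_module R) ?M"
      unfolding linear_maps_def
    proof (intro CollectI conjI ballI)
      show "(\<lambda>s. s \<odot>\<^bsub>?M\<^esub> c) \<in> carrier (self_module R) \<rightarrow> carrier ?M"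
        using c(1) by (auto simp: self_module_def frobenius_root_def)
      fix a b assume "a \<in> carrier (self_module R)" "b \<in> carrier (self_module R)"
      then obtain y z where y: "y \<in> B" "a = phi y" "z \<in> B" "b = phi z"
        by (auto simp: self_module_def elim!: carrE)
      have "phi ((y + z) ^ p ^ e * x) = phi (y ^ p ^ e * x) \<oplus> phi (z ^ p ^ e * x)"
        unfolding frob distrib_right using y x by (intro phi_add B_mult B_power)
      then show "(a \<oplus>\<^bsub>self_module R\<^esub> b) \<odot>\<^bsub>?M\<^esub> c = a \<odot>\<^bsub>?M\<^esub> c \<oplus>\<^bsub>?M\<^esub> b \<odot>\<^bsub>?M\<^esub> c"
        using y x by (simp add: self_module_def frobenius_root_def phi_mult phi_power phi_add B_add B_power)
    next
      fix a b assume "a \<in> carrier R" "b \<in> carrier (self_module R)"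
      then obtain y z where y: "y \<in> B" "a = phi y" "z \<in> B" "b = phi z"
        by (auto simp: self_module_def elim!: carrE)
      have "phi ((y * z) ^ p ^ e * x) = phi (y ^ p ^ e * (z ^ p ^ e * x))"
        by (simp add: power_mult_distrib mult.assoc)
      then show "(a \<odot>\<^bsub>self_module R\<^esub> b) \<odot>\<^bsub>?M\<^esub> c = a \<odot>\<^bsub>?M\<^esub> (b \<odot>\<^bsub>?M\<^esub> c)"
        using y x by (simp add: self_module_def frobenius_root_def phi_mult phi_power B_mult B_power)
    qed
    have g: "g \<in> linear_maps R ?M (self_module R)"
      unfolding linear_maps_def
    proof (intro CollectI conjI ballI)
      show "g \<in> carrier ?M \<rightarrow> carrier (self_module R)"
        using PB by (auto simp: self_module_def frobenius_root_def g_def psi phi_carr elim!: carrE)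
      fix a b assume "a \<in> carrier ?M" "b \<in> carrier ?M"
      then obtain y z where y: "y \<in> B" "a = phi y" "z \<in> B" "b = phi z"
        by (auto simp: frobenius_root_def elim!: carrE)
      then have "g (a \<oplus> b) = g a \<oplus> g b"
        using Pa PB by (simp add: g_def psi B_add flip: phi_add)
      then show "g (a \<oplus>\<^bsub>?M\<^esub> b) = g a \<oplus>\<^bsub>self_module R\<^esub> g b"
        by (simp add: self_module_def frobenius_root_def)
    next
      fix a b assume "a \<in> carrier R" "b \<in> carrier ?M"
      then obtain y z where y: "y \<in> B" "a = phi y" "z \<in> B" "b = phi z"
        by (auto simp: frobenius_root_def elim!: carrE)
      then have "g (a [^] (p ^ e) \<otimes> b) = a \<otimes> g b"
        using Pl PB by (simp add: g_def psi B_mult B_power flip: phi_mult phi_power)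
      then show "g (a \<odot>\<^bsub>?M\<^esub> b) = a \<odot>\<^bsub>self_module R\<^esub> g b"
        by (simp add: self_module_def frobenius_root_def)
    qed
    have "g (a \<odot>\<^bsub>?M\<^esub> c) = a" if a: "a \<in> carrier (self_module R)" for a
    proof -
      have "a \<in> carrier R" using a by (simp add: self_module_def)
      then obtain y where y: "y \<in> B" "a = phi y" by (rule carrE)
      then have "g (a [^] (p ^ e) \<otimes> c) = phi (y * Phi x)"
        using Pl x by (simp add: g_def psi B_mult B_power flip: phi_mult phi_power)
      then show ?thesis using Pc y by (simp add: frobenius_root_def)
    qed
    then have "linear_map_splits R (self_module R) ?M (\<lambda>s. s \<odot>\<^bsub>?M\<^esub> c)"
      unfolding linear_map_splits_def using f g by blast
    then show ?thesis using e by blast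
  qed
  ultimately show ?thesis unfolding strongly_F_regular_def using p cring_R by blast
qed

end

section \<open>Sums of ideals, the ladder ring and its univariate polynomials\<close>

lemma (in cring) finsum_ideals:
  assumes "finite I" "\<And>i. i \<in> I \<Longrightarrow> ideal (F i) R"
  shows "ideal (\<Oplus>\<^bsub>ideals_set R\<^esub>i\<in>I. F i) R"
    and "i \<in> I \<Longrightarrow> F i \<subseteq> (\<Oplus>\<^bsub>ideals_set R\<^esub>i\<in>I. F i)"
    and "ideal J R \<Longrightarrow> (\<And>i. i \<in> I \<Longrightarrow> F i \<subseteq> J) \<Longrightarrow> (\<Oplus>\<^bsub>ideals_set R\<^esub>i\<in>I. F i) \<subseteq> J"
proof -
  interpret IS: semiring "ideals_set R" by (rule ideals_set_is_semiring)
  have "ideal (\<Oplus>\<^bsub>ideals_set R\<^esub>i\<in>I. F i) R \<and> (\<forall>i\<in>I. F i \<subseteq> (\<Oplus>\<^bsub>ideals_set R\<^esub>i\<in>I. F i)) \<and>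
    (\<forall>J. ideal J R \<longrightarrow> (\<forall>i\<in>I. F i \<subseteq> J) \<longrightarrow> (\<Oplus>\<^bsub>ideals_set R\<^esub>i\<in>I. F i) \<subseteq> J)"
    using assms
  proof (induction I rule: finite_induct)
    case empty
    have "(\<Oplus>\<^bsub>ideals_set R\<^esub>i\<in>{}. F i) = {\<zero>}"
      unfolding IS.finsum_empty by (simp add: ideals_set_def)
    moreover have "{\<zero>} \<subseteq> J" if "ideal J R" for J
      using additive_subgroup.zero_closed[OF ideal.axioms(1)[OF that]] by blast
    ultimately show ?case using zeroideal by simp
  next
    case (insert i I)
    let ?S = "\<Oplus>\<^bsub>ideals_set R\<^esub>i\<in>I. F i"
    have F: "F \<in> I \<rightarrow> carrier (ideals_set R)" "F i \<in> carrier (ideals_set R)"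
      using insert.prems by (auto simp: ideals_set_def)
    have S: "ideal ?S R" and Fi: "ideal (F i) R" using insert by simp_all
    have eq: "(\<Oplus>\<^bsub>ideals_set R\<^esub>i\<in>insert i I. F i) = set_add R (F i) ?S"
      using IS.finsum_insert[OF insert.hyps F] by (simp add: ideals_set_def)
    have z: "\<zero> \<in> ?S" "\<zero> \<in> F i" using additive_subgroup.zero_closed[OF ideal.axioms(1)] S Fi by blast+
    have "F i \<subseteq> set_add R (F i) ?S"
    proof
      fix x assume "x \<in> F i"
      then have "x = x \<oplus> \<zero>" using ideal.Icarr[OF Fi] by simp
      then show "x \<in> set_add R (F i) ?S" using \<open>x \<in> F i\<close> z unfolding set_add_def' by blast
    qed
    moreover have "?S \<subseteq> set_add R (F i) ?S"
    proof
      fix x assume "x \<in> ?S"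
      then have "x = \<zero> \<oplus> x" using ideal.Icarr[OF S] by simp
      then show "x \<in> set_add R (F i) ?S" using \<open>x \<in> ?S\<close> z unfolding set_add_def' by blast
    qed
    moreover have "set_add R (F i) ?S \<subseteq> J" if "ideal J R" "F i \<subseteq> J" "?S \<subseteq> J" for J
      using that additive_subgroup.a_closed[OF ideal.axioms(1)[OF that(1)]]
      unfolding set_add_def' by blast
    moreover have "ideal (set_add R (F i) ?S) R" by (rule add_ideals[OF Fi S])
    moreover have "\<forall>j\<in>I. F j \<subseteq> ?S" "\<And>J. ideal J R \<Longrightarrow> (\<forall>j\<in>I. F j \<subseteq> J) \<Longrightarrow> ?S \<subseteq> J"
      using insert.IH insert.prems by simp_all
    ultimately show ?case unfolding eq ball_simps by (meson subset_trans)
  qed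
  then show "ideal (\<Oplus>\<^bsub>ideals_set R\<^esub>i\<in>I. F i) R" "i \<in> I \<Longrightarrow> F i \<subseteq> (\<Oplus>\<^bsub>ideals_set R\<^esub>i\<in>I. F i)"
    "ideal J R \<Longrightarrow> (\<And>i. i \<in> I \<Longrightarrow> F i \<subseteq> J) \<Longrightarrow> (\<Oplus>\<^bsub>ideals_set R\<^esub>i\<in>I. F i) \<subseteq> J" by blast+
qed

lemma ladder_ring_simps [simp]:
  "carrier (ladder_ring L :: 'k::field matrix_poly ring) = polys_in L"
  "monoid.mult (ladder_ring L :: 'k matrix_poly ring) = (*)"
  "ring.add (ladder_ring L :: 'k matrix_poly ring) = (+)"
  "monoid.one (ladder_ring L :: 'k matrix_poly ring) = 1"
  "ring.zero (ladder_ring L :: 'k matrix_poly ring) = 0"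
  by (auto simp: ladder_ring_def ring_of_type_algebra_def polys_in_def)

lemma ladder_ring_model: "ring_model (ladder_ring L) (polys_in L :: 'k::field matrix_poly set) (\<lambda>f. f)"
  by unfold_locales auto

lemma cring_ladder_ring: "cring (ladder_ring L :: 'k::field matrix_poly ring)"
  using ring_model.cring_R[OF ladder_ring_model] .

lemma finsum_ladder_ring:
  assumes "finite I" "\<And>i. i \<in> I \<Longrightarrow> f i \<in> polys_in L"
  shows "(\<Oplus>\<^bsub>ladder_ring L\<^esub>i\<in>I. f i) = (\<Sum>i\<in>I. f i :: 'k::field matrix_poly)"
  using ring_model.phi_sum[OF ladder_ring_model assms] by simp

lemma ideal_ladder_ringI:
  assumes "I \<subseteq> polys_in L" "0 \<in> I" "\<And>f g. f \<in> I \<Longrightarrow> g \<in> I \<Longrightarrow> f + g \<in> I"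
    and m: "\<And>f g. f \<in> polys_in L \<Longrightarrow> g \<in> I \<Longrightarrow> f * g \<in> I"
  shows "ideal I (ladder_ring L :: 'k::field matrix_poly ring)"
proof -
  interpret cring "ladder_ring L :: 'k matrix_poly ring" by (rule cring_ladder_ring)
  have neg: "\<ominus>\<^bsub>ladder_ring L\<^esub> f = (- f :: 'k matrix_poly)" if "f \<in> polys_in L" for f
    using minus_equality[of "- f" f] that by auto
  have "- f \<in> I" if "f \<in> I" for f using m[of "- 1" f] that by auto
  then have "subgroup I (add_monoid (ladder_ring L :: 'k matrix_poly ring))"
    using assms neg by (intro add.subgroupI) (auto simp flip: a_inv_def)
  moreover have "g * f \<in> I" if "f \<in> polys_in L" "g \<in> I" for f g using m[OF that] by (simp add: mult.commute)
  ultimately show ?thesis using m by (intro idealI ring_axioms) auto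
qed

lemma coeff_UP_ladder_ring:
  fixes F :: "'k::field matrix_poly poly"
  assumes F: "\<And>n. cf F n \<in> polys_in L"
  shows "cf F \<in> carrier (UP (ladder_ring L))" and "up_ring.coeff (UP (ladder_ring L)) (cf F) = cf F"
proof -
  show "cf F \<in> carrier (UP (ladder_ring L))"
    using F coeff_eq_0[of F] by (auto simp: UP_def up_def bound_def)
  then show "up_ring.coeff (UP (ladder_ring L)) (cf F) = cf F" by (simp add: UP_def)
qed

lemma UP_ladder_ring_ops:
  fixes F G :: "'k::field matrix_poly poly"
  assumes F: "\<And>n. cf F n \<in> polys_in L" and G: "\<And>n. cf G n \<in> polys_in L"
  shows "cf F \<otimes>\<^bsub>UP (ladder_ring L)\<^esub> cf G = cf (F * G)"
    and "cf F \<oplus>\<^bsub>UP (ladder_ring L)\<^esub> cf G = cf (F + G)"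
proof -
  have up: "cf F \<in> up (ladder_ring L)" "cf G \<in> up (ladder_ring L)"
    using coeff_UP_ladder_ring(1)[OF F] coeff_UP_ladder_ring(1)[OF G] by (simp_all add: UP_def)
  show "cf F \<oplus>\<^bsub>UP (ladder_ring L)\<^esub> cf G = cf (F + G)"
    using up by (auto simp: UP_def)
  show "cf F \<otimes>\<^bsub>UP (ladder_ring L)\<^esub> cf G = cf (F * G)"
    using up F G by (auto simp: UP_def coeff_mult finsum_ladder_ring polys_in_mult)
qed

lemma UP_ladder_ring_carrierE:
  assumes "f \<in> carrier (UP (ladder_ring L))"
  obtains F :: "'k::field matrix_poly poly" where "f = cf F" "\<And>n. cf F n \<in> polys_in L"
proof -
  obtain n where n: "bound 0 n f" and f: "\<And>i. f i \<in> polys_in L"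
    using assms by (auto simp: UP_def up_def)
  then have "cf (Abs_poly f) = f"
    by (intro Abs_poly_inverse) (auto simp: MOST_nat bound_def)
  then show ?thesis using that[of "Abs_poly f"] f by simp
qed

context rank_ladder
begin

lemma primeideal_Q: "primeideal (Q :: 'k::field matrix_poly set) (ladder_ring L)"
proof -
  interpret cring "ladder_ring L :: 'k matrix_poly ring" by (rule cring_ladder_ring)
  interpret P: prime_in "polys_in L" "Q :: 'k matrix_poly set" by (rule prime_in_Q)
  have I: "ideal Q (ladder_ring L :: 'k matrix_poly ring)"
    using P.Q_subset by (intro ideal_ladder_ringI) auto
  show ?thesis
  proof (intro primeideal.intro I cring_axioms primeideal_axioms.intro)
    show "carrier (ladder_ring L) \<noteq> (Q :: 'k matrix_poly set)" unfolding ladder_ring_simps using P.Q_1 P.S_1 by metis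
  qed (use P.Q_prime in auto)
qed

text \<open>The additive closure in \<open>ipow\<close> is the product of ideals of the library;
  exponent 0 gives the unit ideal on both sides.\<close>

lemma ideal_power_Q: "(Q :: 'k::field matrix_poly set) [^]\<^bsub>ideals_set (ladder_ring L)\<^esub> n = prime_in.ipow (polys_in L) Q n"
proof (induction n)
  case 0
  then show ?case by (simp add: nat_pow_def ideals_set_def prime_in.ipow.simps[OF prime_in_Q])
next
  case (Suc n)
  have "ideal_prod (ladder_ring L) I J = asum {a * b |a b. a \<in> I \<and> b \<in> J}" (is "?l = ?r")
    if "0 \<in> I" "0 \<in> J" for I J :: "'k matrix_poly set"
  proof
    show "?l \<subseteq> ?r"
    proof
      fix x assume "x \<in> ?l"
      then show "x \<in> ?r"
        by (induction rule: ideal_prod.induct) (auto intro: asum.intros)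
    qed
    show "?r \<subseteq> ?l"
    proof
      fix x assume "x \<in> ?r"
      then show "x \<in> ?l"
      proof induction
        case asum_0
        show ?case using ideal_prod.prod[of 0 I 0 J "ladder_ring L"] that by simp
      next
        case (asum_gen a)
        then show ?case using ideal_prod.prod[of _ I _ J "ladder_ring L"] by auto
      next
        case (asum_add a b)
        then show ?case using ideal_prod.sum[of a "ladder_ring L" I J b] by simp
      qed
    qed
  qed
  note * = this[OF prime_in.ipow_0[OF prime_in_Q] prime_in.Q_0[OF prime_in_Q]]
  have "(Q :: 'k matrix_poly set) [^]\<^bsub>ideals_set (ladder_ring L)\<^esub> Suc n =
    ideal_prod (ladder_ring L) (Q [^]\<^bsub>ideals_set (ladder_ring L)\<^esub> n) Q"
    by (simp add: nat_pow_def ideals_set_def)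
  then show ?case using * Suc by (simp add: prime_in.ipow.simps[OF prime_in_Q])
qed

lemma symbolic_power_Q: "symbolic_power (ladder_ring L) (Q :: 'k::field matrix_poly set) n = symQ n"
  by (simp add: symbolic_power_primeideal[OF primeideal_Q] prime_in.symb_def[OF prime_in_Q] ideal_power_Q)

end

context perfect_rank_ladder
begin

lemma Rees_model:
  "ring_model (symbolic_Rees_algebra (ladder_ring L) (Q :: 'k matrix_poly set)) Rees_polys Polynomial.coeff"
proof -
  let ?U = "UP (ladder_ring L :: 'k matrix_poly ring)"
  have S: "cf F n \<in> polys_in L" if "F \<in> Rees_polys" for F n
    using that prime_in.symb_subset[OF prime_in_Q] by (auto simp: Rees_polys_def)
  have carr: "carrier (symbolic_Rees_algebra (ladder_ring L) (Q :: 'k matrix_poly set)) = cf ` Rees_polys"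
  proof
    show "cf ` Rees_polys \<subseteq> carrier (symbolic_Rees_algebra (ladder_ring L) (Q :: 'k matrix_poly set))"
    proof
      fix f :: "nat \<Rightarrow> 'k matrix_poly" assume "f \<in> cf ` Rees_polys"
      then obtain F :: "'k matrix_poly poly" where F: "F \<in> Rees_polys" "f = cf F" by blast
      then show "f \<in> carrier (symbolic_Rees_algebra (ladder_ring L) (Q :: 'k matrix_poly set))"
        using coeff_UP_ladder_ring[OF S[OF F(1)]]
        by (simp add: symbolic_Rees_algebra_def symbolic_power_Q Rees_polys_def)
    qed
    show "carrier (symbolic_Rees_algebra (ladder_ring L) (Q :: 'k matrix_poly set)) \<subseteq> cf ` Rees_polys"
    proof
      fix f assume "f \<in> carrier (symbolic_Rees_algebra (ladder_ring L) (Q :: 'k matrix_poly set))"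
      then have f: "f \<in> carrier ?U" "\<And>n. up_ring.coeff ?U f n \<in> symQ n"
        by (auto simp: symbolic_Rees_algebra_def symbolic_power_Q)
      obtain F :: "'k matrix_poly poly" where F: "f = cf F" "\<And>n. cf F n \<in> polys_in L"
        using UP_ladder_ring_carrierE[OF f(1)] by metis
      have "F \<in> Rees_polys" using f(2) F(1) coeff_UP_ladder_ring(2)[OF F(2)] by (simp add: Rees_polys_def)
      then show "f \<in> cf ` Rees_polys" using F(1) by blast
    qed
  qed
  have ops: "monoid.mult (symbolic_Rees_algebra (ladder_ring L) (Q :: 'k matrix_poly set)) = monoid.mult ?U"
    "ring.add (symbolic_Rees_algebra (ladder_ring L) (Q :: 'k matrix_poly set)) = ring.add ?U"
    "\<one>\<^bsub>symbolic_Rees_algebra (ladder_ring L) (Q :: 'k matrix_poly set)\<^esub> = \<one>\<^bsub>?U\<^esub>"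
    "\<zero>\<^bsub>symbolic_Rees_algebra (ladder_ring L) (Q :: 'k matrix_poly set)\<^esub> = \<zero>\<^bsub>?U\<^esub>"
    by (simp_all add: symbolic_Rees_algebra_def)
  show ?thesis
  proof (unfold_locales, goal_cases)
    case 1 show ?case by (simp add: inj_on_def coeff_inject)
  next
    case 2 show ?case by (rule carr)
  next
    case (3 F G) then show ?case using UP_ladder_ring_ops(2)[OF S S, of F G] by (simp add: ops)
  next
    case (4 F G) then show ?case using UP_ladder_ring_ops(1)[OF S S, of F G] by (simp add: ops)
  next
    case 5 show ?case by (auto simp: ops UP_def)
  next
    case 6 show ?case by (auto simp: ops UP_def coeff_1)
  qed (auto intro: Rees_polys_add Rees_polys_uminus Rees_polys_mult)
qed

theorem strongly_F_regular_symbolic_Rees: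
  "strongly_F_regular p (symbolic_Rees_algebra (ladder_ring L) (Q :: 'k matrix_poly set))"
proof (rule ring_model.strongly_F_regular_if[OF Rees_model prime_p CHAR_mpoly _ Rees_polys_F_finite Rees_polys_splitting])
  fix J :: "'k matrix_poly poly set"
  assume "J \<subseteq> Rees_polys" "0 \<in> J" "\<And>x y. x \<in> J \<Longrightarrow> y \<in> J \<Longrightarrow> x + y \<in> J" "\<And>x y. x \<in> Rees_polys \<Longrightarrow> y \<in> J \<Longrightarrow> x * y \<in> J"
  then have "\<exists>A\<subseteq>J. finite A \<and> J \<subseteq> bspan A" by (rule Rees_polys_noetherian)
  then show "\<exists>A\<subseteq>J. finite A \<and> (\<forall>x\<in>J. \<exists>s. (\<forall>a\<in>A. s a \<in> Rees_polys) \<and> x = (\<Sum>a\<in>A. s a * a))"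
    unfolding bspan_def by blast
qed

end

subsection \<open>Mixed ladder determinantal ideals\<close>

text \<open>The last assumption says that the subladders cover \<open>L\<close>, so that the minimum
  defining \<open>rank_bound\<close> is taken over a nonempty set at each position of
  \<open>L\<close>.\<close>

locale mixed_ladder = two_sided_ladder k l L u b a v d c
  for k l L u b a v d c and t :: "nat \<Rightarrow> nat" +
  assumes t_pos: "\<And>h. h \<in> {1..v} \<Longrightarrow> t h > 0"
    and involved: "\<And>x. x \<in> L \<Longrightarrow> \<exists>h\<in>{1..v}. x \<in> subladder l L (d h) (c h)"
begin

definition corners_of :: "nat \<times> nat \<Rightarrow> nat set" where
  "corners_of x = {h \<in> {1..v}. fst x \<le> d h \<and> c h \<le> snd x}"

lemma in_subladder: "x \<in> subladder l L (d h) (c h) \<longleftrightarrow> x \<in> L \<and> fst x \<le> d h \<and> c h \<le> snd x"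
  using entries by (auto simp: subladder_def)

lemma corners_of_nonempty: "x \<in> L \<Longrightarrow> corners_of x \<noteq> {}"
  using involved[of x] by (auto simp: corners_of_def in_subladder)

definition rank_bound :: "nat \<times> nat \<Rightarrow> nat" where
  "rank_bound x = Min (t ` corners_of x)"

lemma finite_corners_of: "finite (corners_of x)"
  by (simp add: corners_of_def)

lemma rank_bound_le: "h \<in> corners_of x \<Longrightarrow> rank_bound x \<le> t h"
  unfolding rank_bound_def using finite_corners_of by (intro Min_le) auto

lemma rank_bound_attained: "x \<in> L \<Longrightarrow> \<exists>h\<in>corners_of x. rank_bound x = t h"
  using Min_in[OF finite_imageI[OF finite_corners_of], of t x] corners_of_nonempty[of x]
  unfolding rank_bound_def by blast

text \<open>A position below and to the left of a lower-outside corner would, by the ladder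
  property, put both the lower and the left neighbour of the corner into \<open>L\<close>.\<close>

lemma below_corner:
  assumes h: "h \<in> {1..v}" and x: "(r, w) \<in> L" "d h < r"
  shows "c h \<le> w"
proof (rule ccontr)
  assume "\<not> c h \<le> w"
  moreover have "(d h, c h) \<in> L" using lower_corners(1) h by auto
  ultimately have "(d h + 1, c h) \<in> L" "(d h, c h - 1) \<in> L"
    using ladder[of "d h" "c h" r w] x by simp_all
  then show False using lower_corners(3)[OF h] by simp
qed

sublocale RL: rank_ladder k l L rank_bound
proof
  show "L \<subseteq> {1..k} \<times> {1..l}" by (rule entries)
next
  fix i j i' j' r w
  assume "(i, j) \<in> L" "(i', j') \<in> L" "i \<le> i'" "j' \<le> j" "i \<le> r" "r \<le> i'" "j' \<le> w" "w \<le> j"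
  then show "(r, w) \<in> L" by (rule ladder)
next
  fix x assume "x \<in> L"
  then obtain h where "h \<in> corners_of x" "rank_bound x = t h" using rank_bound_attained by blast
  then show "1 \<le> rank_bound x" using t_pos[of h] by (simp add: corners_of_def)
next
  fix i j i' j' assume "(i, j) \<in> L" "i' \<le> i" "j \<le> j'"
  then obtain h where "h \<in> corners_of (i, j)" "rank_bound (i, j) = t h" using rank_bound_attained by blast
  moreover from this have "h \<in> corners_of (i', j')" using \<open>i' \<le> i\<close> \<open>j \<le> j'\<close> by (auto simp: corners_of_def)
  ultimately show "rank_bound (i', j') \<le> rank_bound (i, j)" using rank_bound_le by metis
next
  fix i j i' j' assume *: "(i, j) \<in> L" "(i, j') \<in> L" "(i', j) \<in> L" "(i', j') \<in> L" "i < i'" "j < j'"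
  then obtain h where h: "h \<in> corners_of (i, j')" "rank_bound (i, j') = t h" using rank_bound_attained by blast
  \<comment> \<open>If row i' is still above the corner or level with it, the corner serves (i',
    j'). Otherwise (i', j) lies below it, so by \<open>below_corner\<close> column j is not left of
    it and it serves (i, j).\<close>
  have "h \<in> corners_of (i, j) \<or> h \<in> corners_of (i', j')"
    using h(1) below_corner[of h i' j] * by (fastforce simp: corners_of_def)
  then show "min (rank_bound (i, j)) (rank_bound (i', j')) \<le> rank_bound (i, j')"
    using rank_bound_le[of h "(i, j)"] rank_bound_le[of h "(i', j')"] h(2) by auto
qed

lemma matrix_minor_in_Q:
  assumes h: "h \<in> {1..v}" and AB: "(A, B) \<in> minor_indices (t h) (subladder l L (d h) (c h))"
  shows "matrix_minor A B \<in> (RL.Q :: 'k::field matrix_poly set)"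
proof -
  have fin: "finite A" "finite B" and card: "card A = t h" "card B = t h"
    and sub: "\<And>i j. i \<in> A \<Longrightarrow> j \<in> B \<Longrightarrow> (i, j) \<in> subladder l L (d h) (c h)"
    using AB by (auto simp: minor_indices_def)
  have entry: "(sorted_list_of_set A ! i, sorted_list_of_set B ! j) \<in> subladder l L (d h) (c h)"
    if "i < t h" "j < t h" for i j
    using that fin card by (intro sub) (metis nth_mem length_sorted_list_of_set set_sorted_list_of_set)+
  show ?thesis
    unfolding matrix_minor_eq_minor[OF card]
  proof (rule RL.minor_in_Q)
    fix i j assume ij: "i < t h" "j < t h"
    show "(sorted_list_of_set A ! i, sorted_list_of_set B ! j) \<in> L" using entry[OF ij] in_subladder by blast
    show "rank_bound (sorted_list_of_set A ! i, sorted_list_of_set B ! j) \<le> t h"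
      using entry[OF ij] h by (intro rank_bound_le) (simp add: corners_of_def in_subladder)
  qed (use t_pos h in auto)
qed

text \<open>A corner whose t attains the minimum at the south-west end of the chain serves the whole
  rectangle, since the other positions lie above or to the right.\<close>

lemma chain_minor_index:
  assumes ch: "RL.chain ch (rank_bound (ch 0))" and pos: "rank_bound (ch 0) > 0"
  shows "\<exists>h\<in>{1..v}. ((fst \<circ> ch) ` {..<rank_bound (ch 0)}, (snd \<circ> ch) ` {..<rank_bound (ch 0)})
    \<in> minor_indices (t h) (subladder l L (d h) (c h))"
proof -
  define s where "s = rank_bound (ch 0)"
  have ch: "RL.chain ch s" and pos: "s > 0" using assms by (simp_all add: s_def)
  have ne: "ne (ch i) (ch j)" if "i < j" "j < s" for i j using ch that by (auto simp: RL.chain_def)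
  have "ch 0 \<in> L" using ch pos by (auto simp: RL.chain_def)
  then obtain h where h: "h \<in> corners_of (ch 0)" "s = t h" using rank_bound_attained s_def by blast
  have "inj_on (fst \<circ> ch) {..<s}" "inj_on (snd \<circ> ch) {..<s}"
    using ne by (intro linorder_inj_onI; force simp: ne_def)+
  then have "card ((fst \<circ> ch) ` {..<s}) = s" "card ((snd \<circ> ch) ` {..<s}) = s" by (simp_all only: card_image card_lessThan)
  moreover have "(fst \<circ> ch) ` {..<s} \<times> (snd \<circ> ch) ` {..<s} \<subseteq> subladder l L (d h) (c h)"
    using RL.chain_rect[OF ch] h(1) by (force simp: in_subladder corners_of_def)
  ultimately show ?thesis using h by (auto simp: minor_indices_def corners_of_def simp flip: s_def)
qed

text \<open>Generating minors lie in the kernel by the factorization on rectangles, and the kernel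
  is generated by minors of chains, each being up to sign a minor of one subladder. In particular
  the ideal is prime.\<close>

lemma mixed_ladder_ideal_eq: "mixed_ladder_ideal l L v d c t = (RL.Q :: 'k::field matrix_poly set)"
proof
  let ?R = "ladder_ring L :: 'k matrix_poly ring"
  let ?D = "\<lambda>h. determinantal_ideal L (t h) (subladder l L (d h) (c h)) :: 'k matrix_poly set"
  let ?G = "\<lambda>h. {matrix_minor A B |A B. (A, B) \<in> minor_indices (t h) (subladder l L (d h) (c h))} :: 'k matrix_poly set"
  let ?I = "mixed_ladder_ideal l L v d c t :: 'k matrix_poly set"
  interpret cring ?R by (rule cring_ladder_ring)
  have QI: "ideal RL.Q ?R" using primeideal.axioms(1)[OF RL.primeideal_Q] .
  have GQ: "?G h \<subseteq> RL.Q" if "h \<in> {1..v}" for h using matrix_minor_in_Q[OF that] by blast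
  then have Gc: "?G h \<subseteq> carrier ?R" if "h \<in> {1..v}" for h
    using that by (force simp: RL.Q_def)
  have D: "ideal (?D h) ?R" if "h \<in> {1..v}" for h
    unfolding determinantal_ideal_def using Gc[OF that] by (rule genideal_ideal)
  have DQ: "?D h \<subseteq> RL.Q" if "h \<in> {1..v}" for h
    unfolding determinantal_ideal_def using QI GQ[OF that] by (rule genideal_minimal)
  show "?I \<subseteq> RL.Q"
    unfolding mixed_ladder_ideal_def using D DQ QI by (intro finsum_ideals(3)) auto
  have I: "ideal ?I ?R" unfolding mixed_ladder_ideal_def using D by (intro finsum_ideals(1)) auto
  interpret I: ideal ?I ?R by (rule I)
  show "RL.Q \<subseteq> ?I"
  proof (rule RL.Q_subset_if_minors)
    show "0 \<in> ?I" using I.zero_closed by simp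
    show "f + g \<in> ?I" if "f \<in> ?I" "g \<in> ?I" for f g using I.a_closed[OF that] by simp
    show *: "f * g \<in> ?I" if "f \<in> polys_in L" "g \<in> ?I" for f g using I.I_l_closed[OF that(2), of f] that(1) by simp
    fix ch assume ch: "RL.chain ch (rank_bound (ch 0))" and pos: "rank_bound (ch 0) > 0"
    let ?s = "rank_bound (ch 0)"
    let ?m = "matrix_minor ((fst \<circ> ch) ` {..<?s}) ((snd \<circ> ch) ` {..<?s}) :: 'k matrix_poly"
    obtain h where h: "h \<in> {1..v}" "?m \<in> ?G h" using chain_minor_index[OF ch pos] by blast
    have "?m \<in> ?D h" unfolding determinantal_ideal_def using genideal_self[OF Gc[OF h(1)]] h(2) by blast
    moreover have "?D h \<subseteq> ?I" unfolding mixed_ladder_ideal_def using D h(1) by (intro finsum_ideals(2)) auto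
    ultimately have m: "?m \<in> ?I" "- ?m \<in> ?I" using *[of "- 1" ?m] by auto
    have ne: "ne (ch i) (ch j)" if "i < j" "j < ?s" for i j using ch that by (auto simp: RL.chain_def)
    then have "RL.cminor ch ?s = ?m \<or> RL.cminor ch ?s = - ?m"
      unfolding RL.cminor_def by (intro minor_eq_matrix_minor) (auto simp: ne_def)
    then show "RL.cminor ch ?s \<in> ?I" using m by auto
  qed
qed

end

theorem theoremA:
  fixes p k l u v :: nat
    and L :: "(nat \<times> nat) set"
    and b a d c t :: "nat \<Rightarrow> nat"
  assumes char: "CHAR('k::field) = p" "p > 0"
    and perfect: "surj (\<lambda>x::'k. x ^ p)"
    and ladder: "two_sided_ladder k l L u b a v d c"
    and t_pos: "\<And>h. h \<in> {1..v} \<Longrightarrow> t h > 0"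
    and involved: "\<And>x. x \<in> L \<Longrightarrow>
          \<exists>h\<in>{1..v}. \<exists>(A, B)\<in>minor_indices (t h) (subladder l L (d h) (c h)). x \<in> A \<times> B"
    and upper_rows_columns: "\<And>h h'. h \<in> {1..u} \<Longrightarrow> h' \<in> {1..u} \<Longrightarrow> h \<noteq> h' \<Longrightarrow>
          b h \<noteq> b h' \<and> a h \<noteq> a h'"
    and irredundant: "\<And>h h'. h \<in> {1..v} \<Longrightarrow> h' \<in> {1..v} \<Longrightarrow> h \<noteq> h' \<Longrightarrow>
          \<not> (determinantal_ideal L (t h) (subladder l L (d h) (c h)) :: 'k matrix_poly set)
            \<subseteq> determinantal_ideal L (t h') (subladder l L (d h') (c h'))"
    and no_proper_submatrix: "\<And>A B. A \<subseteq> {1..k} \<Longrightarrow> B \<subseteq> {1..l} \<Longrightarrow> L \<subseteq> A \<times> B \<Longrightarrow>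
          A = {1..k} \<and> B = {1..l}"
  shows "strongly_F_regular p
           (symbolic_Rees_algebra (ladder_ring L)
              (mixed_ladder_ideal l L v d c t :: 'k matrix_poly set))"
proof -
  have "mixed_ladder k l L u b a v d c t"
  proof (intro mixed_ladder.intro mixed_ladder_axioms.intro ladder t_pos)
    fix x assume "x \<in> L"
    then show "\<exists>h\<in>{1..v}. x \<in> subladder l L (d h) (c h)"
      using involved[of x] unfolding minor_indices_def by fast
  qed
  then interpret M: mixed_ladder k l L u b a v d c t .
  interpret perfect_rank_ladder k l L M.rank_bound p "TYPE('k)"
    by unfold_locales (use char perfect in auto)
  show ?thesis
    unfolding M.mixed_ladder_ideal_eq by (rule strongly_F_regular_symbolic_Rees)
qed

end
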